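(* Let $\Bbbk$ be a field of characteristic zero, $\mathcal C$ a colored operad and $(V,W):\mathcal C\to\mathcal F\mathrm{Vect}_{\Bbbk}$ a map of colored operads such that for each color $c$ of $\mathcal C$ the vector space $V(c)$ is finite dimensional. Let $\Bbbk\subset\mathbb K$ be a field extension. Then $V$ admits a lax symmetric monoidal splitting if and only if $V_{\mathbb K}:=V\otimes_{\Bbbk}\mathbb K:\mathcal C\to\mathcal F\mathrm{Vect}_{\mathbb K}$ admits a lax symmetric monoidal splitting.
   Context: $\mathcal F\mathrm{Vect}_{\Bbbk}$ is the symmetric monoidal category of $\Bbbk$-vector spaces with an increasing $\mathbb Z$-indexed filtration $W$, exhaustive and of finite length; $W_p(A\otimes B)=\sum_{i+j=p}\mathrm{Im}(W_iA\otimes W_jB\to A\otimes B)$, with unit $\Bbbk$ in weight $0$. It is regarded as a colored operad, a multimorphism $(A_1,\dots,A_n)\to B$ being a morphism $A_1\otimes\cdots\otimes A_n\to B$; a map of colored operads $\mathcal C\to\mathcal F\mathrm{Vect}_{\Bbbk}$ is the same as a $\mathcal C$-algebra in $\mathcal F\mathrm{Vect}_{\Bbbk}$ (if $\mathcal C$ is the colored operad of a symmetric monoidal category, it is the same as a lax symmetric monoidal functor). $gr\mathrm{Vect}_{\Bbbk}$ is the symmetric monoidal category of $\mathbb Z$-graded vector spaces (tensor product without signs), and $U^{fil}:gr\mathrm{Vect}_{\Bbbk}\to\mathcal F\mathrm{Vect}_{\Bbbk}$ is the strong symmetric monoidal functor $\bigoplus_pA^p\mapsto(\bigoplus_pA^p,W)$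 with $W_m=\bigoplus_{q\le m}A^q$. The associated graded $Gr^W$ is strong symmetric monoidal, so $Gr^WV$ is a $\mathcal C$-algebra in $gr\mathrm{Vect}_{\Bbbk}$. A lax symmetric monoidal splitting of $(V,W)$ is a lift of $(V,W)$, up to isomorphism, along $U^{fil}$ to a map of colored operads $\mathcal C\to gr\mathrm{Vect}_{\Bbbk}$; equivalently an isomorphism of $\mathcal C$-algebras in filtered vector spaces $V\cong U^{fil}(Gr^WV)$, so $W_pV\cong\bigoplus_{q\le p}Gr^W_qV$. The same definitions apply over $\mathbb K$, with $W_p(V\otimes_{\Bbbk}\mathbb K)=W_pV\otimes_{\Bbbk}\mathbb K$. *)

theory Defs
  imports "Jordan_Normal_Form.VS_Connect" "HOL-Algebra.AbelCoset" "HOL-Combinatorics.Permutations"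
begin

section \<open>Colored operads\<close>

text \<open>
  Colored operads are symmetric, and the symmetric groups act from the right.  The list of
  input colors may be empty.  Operations of different profiles may be represented by the same element
  of the type \<^typ>\<open>'o\<close>, so the structure maps receive the profiles as arguments: if
  \<open>g \<in> ops C cs d\<close> and \<open>fs ! i \<in> ops C (css ! i) (cs ! i)\<close>, then
  \<open>op_comp C css cs d g fs \<in> ops C (concat css) d\<close> is the total composite of \<open>g\<close> with \<open>fs\<close>,
  and \<open>op_act C cs d \<sigma> g \<in> ops C (permute_list \<sigma> cs) d\<close>.
\<close>

record ('c, 'o) operad_data =
  colors :: "'c set"
  ops :: "'c list \<Rightarrow> 'c \<Rightarrow> 'o set"
  op_id :: "'c \<Rightarrow> 'o"
  op_comp :: "'c list list \<Rightarrow> 'c list \<Rightarrow> 'c \<Rightarrow> 'o \<Rightarrow> 'o list \<Rightarrow> 'o"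
  op_act :: "'c list \<Rightarrow> 'c \<Rightarrow> (nat \<Rightarrow> nat) \<Rightarrow> 'o \<Rightarrow> 'o"

definition op_family :: "('c, 'o) operad_data \<Rightarrow> 'c list list \<Rightarrow> 'c list \<Rightarrow> 'o list \<Rightarrow> bool" where
  "op_family C css cs fs \<longleftrightarrow>
     css \<in> lists (lists (colors C)) \<and> cs \<in> lists (colors C) \<and>
     length css = length cs \<and> length fs = length cs \<and>
     (\<forall>i<length cs. fs ! i \<in> ops C (css ! i) (cs ! i))"

fun blocks :: "nat list \<Rightarrow> 'a list \<Rightarrow> 'a list list" where
  "blocks [] xs = []"
| "blocks (n # ns) xs = take n xs # blocks ns (drop n xs)"

definition perm_of_list :: "nat list \<Rightarrow> nat \<Rightarrow> nat" where
  "perm_of_list js i = (if i < length js then js ! i else i)"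

text \<open>
  For lists \<open>xss\<close> with \<open>map length xss = ns\<close> these are the permutations characterised by
  \<open>permute_list (block_perm ns \<sigma>) (concat xss) = concat (permute_list \<sigma> xss)\<close> and
  \<open>permute_list (block_sum ns \<tau>s) (concat xss) = concat (map2 permute_list \<tau>s xss)\<close>.
\<close>

definition block_perm :: "nat list \<Rightarrow> (nat \<Rightarrow> nat) \<Rightarrow> nat \<Rightarrow> nat" where
  "block_perm ns \<sigma> = perm_of_list (concat (permute_list \<sigma> (blocks ns [0..<sum_list ns])))"

definition block_sum :: "nat list \<Rightarrow> (nat \<Rightarrow> nat) list \<Rightarrow> nat \<Rightarrow> nat" where
  "block_sum ns \<tau>s = perm_of_list (concat (map2 permute_list \<tau>s (blocks ns [0..<sum_list ns])))"

locale colored_operad =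
  fixes C :: "('c, 'o) operad_data"
  assumes id_closed: "c \<in> colors C \<Longrightarrow> op_id C c \<in> ops C [c] c"
    and comp_closed:
      "\<lbrakk>d \<in> colors C; g \<in> ops C cs d; op_family C css cs fs\<rbrakk>
        \<Longrightarrow> op_comp C css cs d g fs \<in> ops C (concat css) d"
    and act_closed:
      "\<lbrakk>cs \<in> lists (colors C); d \<in> colors C; f \<in> ops C cs d; \<sigma> permutes {..<length cs}\<rbrakk>
        \<Longrightarrow> op_act C cs d \<sigma> f \<in> ops C (permute_list \<sigma> cs) d"
    and id_left:
      "\<lbrakk>cs \<in> lists (colors C); d \<in> colors C; f \<in> ops C cs d\<rbrakk>
        \<Longrightarrow> op_comp C [cs] [d] d (op_id C d) [f] = f"
    and id_right:
      "\<lbrakk>cs \<in> lists (colors C); d \<in> colors C; f \<in> ops C cs d\<rbrakk>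
        \<Longrightarrow> op_comp C (map (\<lambda>c. [c]) cs) cs d f (map (op_id C) cs) = f"
    and comp_assoc:
      "\<lbrakk>d \<in> colors C; g \<in> ops C cs d; op_family C css cs fs;
        length bsss = length cs; length hss = length cs;
        \<And>i. i < length cs \<Longrightarrow> op_family C (bsss ! i) (css ! i) (hss ! i)\<rbrakk>
        \<Longrightarrow> op_comp C (concat bsss) (concat css) d (op_comp C css cs d g fs) (concat hss) =
            op_comp C (map concat bsss) cs d g
              (map (\<lambda>i. op_comp C (bsss ! i) (css ! i) (cs ! i) (fs ! i) (hss ! i)) [0..<length cs])"
    and act_id:
      "\<lbrakk>cs \<in> lists (colors C); d \<in> colors C; f \<in> ops C cs d\<rbrakk> \<Longrightarrow> op_act C cs d id f = f"
    and act_act: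
      "\<lbrakk>cs \<in> lists (colors C); d \<in> colors C; f \<in> ops C cs d;
        \<sigma> permutes {..<length cs}; \<tau> permutes {..<length cs}\<rbrakk>
        \<Longrightarrow> op_act C (permute_list \<sigma> cs) d \<tau> (op_act C cs d \<sigma> f) = op_act C cs d (\<sigma> \<circ> \<tau>) f"
    and comp_act_outer:
      "\<lbrakk>d \<in> colors C; g \<in> ops C cs d; op_family C css cs fs; \<sigma> permutes {..<length cs}\<rbrakk>
        \<Longrightarrow> op_comp C (permute_list \<sigma> css) (permute_list \<sigma> cs) d
              (op_act C cs d \<sigma> g) (permute_list \<sigma> fs) =
            op_act C (concat css) d (block_perm (map length css) \<sigma>) (op_comp C css cs d g fs)"
    and comp_act_inner:
      "\<lbrakk>d \<in> colors C; g \<in> ops C cs d; op_family C css cs fs; length \<tau>s = length cs;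
        \<And>i. i < length cs \<Longrightarrow> (\<tau>s ! i) permutes {..<length (css ! i)}\<rbrakk>
        \<Longrightarrow> op_comp C (map2 permute_list \<tau>s css) cs d g
              (map (\<lambda>i. op_act C (css ! i) (cs ! i) (\<tau>s ! i) (fs ! i)) [0..<length cs]) =
            op_act C (concat css) d (block_sum (map length css) \<tau>s) (op_comp C css cs d g fs)"

record ('c, 'o, 'd, 'p) operad_map_data =
  on_color :: "'c \<Rightarrow> 'd"
  on_op :: "'c list \<Rightarrow> 'c \<Rightarrow> 'o \<Rightarrow> 'p"

locale operad_map =
  fixes C :: "('c, 'o) operad_data" and D :: "('d, 'p) operad_data"
    and F :: "('c, 'o, 'd, 'p) operad_map_data"
  assumes on_color_closed: "c \<in> colors C \<Longrightarrow> on_color F c \<in> colors D"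
    and on_op_closed:
      "\<lbrakk>cs \<in> lists (colors C); d \<in> colors C; f \<in> ops C cs d\<rbrakk>
        \<Longrightarrow> on_op F cs d f \<in> ops D (map (on_color F) cs) (on_color F d)"
    and on_op_id: "c \<in> colors C \<Longrightarrow> on_op F [c] c (op_id C c) = op_id D (on_color F c)"
    and on_op_comp:
      "\<lbrakk>d \<in> colors C; g \<in> ops C cs d; op_family C css cs fs\<rbrakk>
        \<Longrightarrow> on_op F (concat css) d (op_comp C css cs d g fs) =
            op_comp D (map (map (on_color F)) css) (map (on_color F) cs) (on_color F d)
              (on_op F cs d g) (map (\<lambda>i. on_op F (css ! i) (cs ! i) (fs ! i)) [0..<length cs])"
    and on_op_act:
      "\<lbrakk>cs \<in> lists (colors C); d \<in> colors C; f \<in> ops C cs d; \<sigma> permutes {..<length cs}\<rbrakk>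
        \<Longrightarrow> on_op F (permute_list \<sigma> cs) d (op_act C cs d \<sigma> f) =
            op_act D (map (on_color F) cs) (on_color F d) \<sigma> (on_op F cs d f)"

definition operad_map_comp ::
  "('d, 'p, 'e, 'q) operad_map_data \<Rightarrow> ('c, 'o, 'd, 'p) operad_map_data
    \<Rightarrow> ('c, 'o, 'e, 'q) operad_map_data" (infixl \<open>\<circ>\<^sub>o\<close> 55) where
  "G \<circ>\<^sub>o F =
     \<lparr>on_color = (\<lambda>c. on_color G (on_color F c)),
      on_op = (\<lambda>cs d f. on_op G (map (on_color F) cs) (on_color F d) (on_op F cs d f))\<rparr>"

text \<open>
  An isomorphism of operad maps, that is of \<open>C\<close>-algebras in \<open>D\<close>: invertible unary operations of
  \<open>D\<close>, one for each color of \<open>C\<close>, commuting with all operations of \<open>C\<close>.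
\<close>

definition operad_map_iso ::
  "('c, 'o) operad_data \<Rightarrow> ('d, 'p) operad_data
    \<Rightarrow> ('c, 'o, 'd, 'p) operad_map_data \<Rightarrow> ('c, 'o, 'd, 'p) operad_map_data \<Rightarrow> bool" where
  "operad_map_iso C D F G \<longleftrightarrow>
    (\<exists>\<phi>.
      (\<forall>c\<in>colors C.
         \<phi> c \<in> ops D [on_color F c] (on_color G c) \<and>
         (\<exists>\<psi>\<in>ops D [on_color G c] (on_color F c).
            op_comp D [[on_color F c]] [on_color G c] (on_color F c) \<psi> [\<phi> c] =
              op_id D (on_color F c) \<and>
            op_comp D [[on_color G c]] [on_color F c] (on_color G c) (\<phi> c) [\<psi>] =
              op_id D (on_color G c))) \<and>
      (\<forall>cs\<in>lists (colors C). \<forall>d\<in>colors C. \<forall>f\<in>ops C cs d.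
         op_comp D [map (on_color F) cs] [on_color F d] (on_color G d) (\<phi> d) [on_op F cs d f] =
         op_comp D (map (\<lambda>c. [on_color F c]) cs) (map (on_color G) cs) (on_color G d)
           (on_op G cs d f) (map \<phi> cs)))"


section \<open>Tensor products of vector spaces\<close>

text \<open>
  Vector spaces over the field \<^typ>\<open>'k\<close> are the HOL-Algebra modules over
  \<^term>\<open>class_ring :: 'k::field ring\<close>; the fields \<^const>\<open>mult\<close> and \<^const>\<open>one\<close> of the
  module record carry no information.
\<close>

abbreviation vspan :: "('k::field, 'v, 'm) module_scheme \<Rightarrow> 'v set \<Rightarrow> 'v set" where
  "vspan \<equiv> LinearCombinations.module.span class_ring"

definition free_vs :: "'x set \<Rightarrow> ('k::field, 'x \<Rightarrow> 'k) module" where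
  "free_vs X =
     \<lparr>carrier = {f. finite {x. f x \<noteq> 0} \<and> {x. f x \<noteq> 0} \<subseteq> X},
      mult = undefined, one = undefined,
      zero = (\<lambda>_. 0), add = (\<lambda>f g x. f x + g x), smult = (\<lambda>a f x. a * f x)\<rparr>"

definition single :: "'x \<Rightarrow> 'x \<Rightarrow> 'k::field" where
  "single x = (\<lambda>y. if y = x then 1 else 0)"

definition quotient_vs ::
  "('k::field, 'v, 'm) module_scheme \<Rightarrow> 'v set \<Rightarrow> ('k, 'v set) module" where
  "quotient_vs M N =
     \<lparr>carrier = a_rcosets\<^bsub>M\<^esub> N,
      mult = undefined, one = undefined,
      zero = N, add = (\<lambda>X Y. X <+>\<^bsub>M\<^esub> Y), smult = (\<lambda>a X. \<Union>x\<in>X. N +>\<^bsub>M\<^esub> (a \<odot>\<^bsub>M\<^esub> x))\<rparr>"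

definition linear_maps ::
  "('k::field, 'v, 'm) module_scheme \<Rightarrow> ('k, 'w, 'n) module_scheme \<Rightarrow> ('v \<Rightarrow> 'w) set" where
  "linear_maps M N = LinearCombinations.module_hom class_ring M N \<inter> extensional (carrier M)"

text \<open>
  The \<open>n\<close>-fold tensor product, as the quotient of the free vector space on the tuples by the
  multilinearity relations.  For \<open>n = 0\<close> there is one tuple and no relation, which gives the unit.
\<close>

definition tensor_relations ::
  "('k::field, 'v, 'm) module_scheme list \<Rightarrow> ('v list \<Rightarrow> 'k) set" where
  "tensor_relations Ms =
     {(\<lambda>z. single (xs[i := x \<oplus>\<^bsub>Ms!i\<^esub> y]) z - single (xs[i := x]) z - single (xs[i := y]) z) | xs i x y.
        xs \<in> listset (map carrier Ms) \<and> i < length Ms \<and> x \<in> carrier (Ms!i) \<and> y \<in> carrier (Ms!i)} \<union>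
     {(\<lambda>z. single (xs[i := a \<odot>\<^bsub>Ms!i\<^esub> x]) z - a * single (xs[i := x]) z) | xs i a x.
        xs \<in> listset (map carrier Ms) \<and> i < length Ms \<and> x \<in> carrier (Ms!i)}"

definition tensor_kernel ::
  "('k::field, 'v, 'm) module_scheme list \<Rightarrow> ('v list \<Rightarrow> 'k) set" where
  "tensor_kernel Ms = vspan (free_vs (listset (map carrier Ms))) (tensor_relations Ms)"

definition tensor ::
  "('k::field, 'v, 'm) module_scheme list \<Rightarrow> ('k, ('v list \<Rightarrow> 'k) set) module" where
  "tensor Ms = quotient_vs (free_vs (listset (map carrier Ms))) (tensor_kernel Ms)"

definition pure_tensor ::
  "('k::field, 'v, 'm) module_scheme list \<Rightarrow> 'v list \<Rightarrow> ('v list \<Rightarrow> 'k) set" where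
  "pure_tensor Ms xs = tensor_kernel Ms +>\<^bsub>free_vs (listset (map carrier Ms))\<^esub> single xs"

text \<open>The linear map out of the tensor product given by a multilinear map \<open>m\<close>.\<close>

definition tensor_map ::
  "('k::field, 'v, 'm) module_scheme list \<Rightarrow> ('k, 'w, 'n) module_scheme \<Rightarrow> ('v list \<Rightarrow> 'w)
    \<Rightarrow> ('v list \<Rightarrow> 'k) set \<Rightarrow> 'w" where
  "tensor_map Ms N m =
     (THE h. h \<in> linear_maps (tensor Ms) N \<and>
             (\<forall>xs\<in>listset (map carrier Ms). h (pure_tensor Ms xs) = m xs))"

text \<open>
  The colored operad structure of vector spaces, with multimorphisms the linear maps
  \<open>M\<^sub>1 \<otimes> \<dots> \<otimes> M\<^sub>n \<rightarrow> N\<close>.  The coherence isomorphisms of the tensor product are implicit: the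
  identity is the isomorphism of the one-fold tensor product with the space itself, and the composite
  sends \<open>(x\<^sub>1\<^sub>1 \<otimes> \<dots>) \<otimes> \<dots> \<otimes> (x\<^sub>n\<^sub>1 \<otimes> \<dots>)\<close>, with the inner brackets omitted, to
  \<open>g (f\<^sub>1 (x\<^sub>1\<^sub>1 \<otimes> \<dots>) \<otimes> \<dots> \<otimes> f\<^sub>n (x\<^sub>n\<^sub>1 \<otimes> \<dots>))\<close>.
\<close>

definition multi_id :: "('k::field, 'v, 'm) module_scheme \<Rightarrow> ('v list \<Rightarrow> 'k) set \<Rightarrow> 'v" where
  "multi_id M = tensor_map [M] M hd"

definition multi_comp ::
  "('k::field, 'v, 'm) module_scheme list list \<Rightarrow> ('k, 'v, 'm) module_scheme list
    \<Rightarrow> ('k, 'v, 'm) module_scheme \<Rightarrow> (('v list \<Rightarrow> 'k) set \<Rightarrow> 'v) \<Rightarrow> (('v list \<Rightarrow> 'k) set \<Rightarrow> 'v) list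
    \<Rightarrow> ('v list \<Rightarrow> 'k) set \<Rightarrow> 'v" where
  "multi_comp Mss Ns P g fs =
     tensor_map (concat Mss) P
       (\<lambda>xs. g (pure_tensor Ns
          (map (\<lambda>i. (fs ! i) (pure_tensor (Mss ! i) (blocks (map length Mss) xs ! i)))
            [0..<length Ns])))"

definition multi_act ::
  "('k::field, 'v, 'm) module_scheme list \<Rightarrow> ('k, 'v, 'm) module_scheme \<Rightarrow> (nat \<Rightarrow> nat)
    \<Rightarrow> (('v list \<Rightarrow> 'k) set \<Rightarrow> 'v) \<Rightarrow> ('v list \<Rightarrow> 'k) set \<Rightarrow> 'v" where
  "multi_act Ms N \<sigma> f =
     tensor_map (permute_list \<sigma> Ms) N (\<lambda>xs. f (pure_tensor Ms (permute_list (inv_into UNIV \<sigma>) xs)))"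


section \<open>Filtered and graded vector spaces\<close>

record ('k, 'v) filtered_data = "('k, 'v) module" +
  filt :: "int \<Rightarrow> 'v set"

record ('k, 'v) graded_data = "('k, 'v) module" +
  grad :: "int \<Rightarrow> 'v set"

definition filtered_vs :: "('k::field, 'v) filtered_data \<Rightarrow> bool" where
  "filtered_vs A \<longleftrightarrow>
     vectorspace class_ring A \<and> (\<forall>p. VectorSpace.subspace class_ring (filt A p) A) \<and> mono (filt A) \<and>
     (\<exists>a. filt A a = {\<zero>\<^bsub>A\<^esub>}) \<and> (\<exists>b. filt A b = carrier A)"

text \<open>A graded vector space is given by an internal direct sum decomposition.\<close>

definition graded_vs :: "('k::field, 'v) graded_data \<Rightarrow> bool" where
  "graded_vs A \<longleftrightarrow>
     vectorspace class_ring A \<and> (\<forall>p. VectorSpace.subspace class_ring (grad A p) A) \<and>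
     (\<forall>x\<in>carrier A. \<exists>!u. (\<forall>p. u p \<in> grad A p) \<and> finite {p. u p \<noteq> \<zero>\<^bsub>A\<^esub>} \<and>
        x = (\<Oplus>\<^bsub>A\<^esub>p\<in>{p. u p \<noteq> \<zero>\<^bsub>A\<^esub>}. u p))"

text \<open>
  The image of \<open>W\<^sub>i\<^sub>1 A\<^sub>1 \<otimes> \<dots> \<otimes> W\<^sub>i\<^sub>n A\<^sub>n\<close> in the tensor product is spanned by the pure tensors of
  elements of these subspaces.
  For \<open>n \<ge> 1\<close> the condition \<open>sum_list is \<le> p\<close> may be replaced by \<open>sum_list is = p\<close>, since the
  filtrations are increasing.  As it stands it also puts the unit (\<open>n = 0\<close>) in weight \<open>0\<close>.
\<close>

definition tensor_filt ::
  "('k::field, 'v) filtered_data list \<Rightarrow> int \<Rightarrow> ('v list \<Rightarrow> 'k) set set" where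
  "tensor_filt As p =
     vspan (tensor As)
       (\<Union>is\<in>{is. length is = length As \<and> sum_list is \<le> p}.
          pure_tensor As ` listset (map2 filt As is))"

definition tensor_grad ::
  "('k::field, 'v) graded_data list \<Rightarrow> int \<Rightarrow> ('v list \<Rightarrow> 'k) set set" where
  "tensor_grad As p =
     vspan (tensor As)
       (\<Union>is\<in>{is. length is = length As \<and> sum_list is = p}.
          pure_tensor As ` listset (map2 grad As is))"

definition FVect ::
  "(('k::field, 'v) filtered_data, ('v list \<Rightarrow> 'k) set \<Rightarrow> 'v) operad_data" where
  "FVect =
     \<lparr>colors = {A. filtered_vs A},
      ops = (\<lambda>As B. {f \<in> linear_maps (tensor As) B. \<forall>p. f ` tensor_filt As p \<subseteq> filt B p}),
      op_id = multi_id, op_comp = multi_comp, op_act = multi_act\<rparr>"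

definition GrVect ::
  "(('k::field, 'v) graded_data, ('v list \<Rightarrow> 'k) set \<Rightarrow> 'v) operad_data" where
  "GrVect =
     \<lparr>colors = {A. graded_vs A},
      ops = (\<lambda>As B. {f \<in> linear_maps (tensor As) B. \<forall>p. f ` tensor_grad As p \<subseteq> grad B p}),
      op_id = multi_id, op_comp = multi_comp, op_act = multi_act\<rparr>"

text \<open>
  The functor \<open>U\<^sup>f\<^sup>i\<^sup>l\<close> keeps the underlying vector spaces, hence also their tensor products, so on
  multimorphisms it is the identity.  A graded space with infinitely many nonzero components is sent
  to a filtration of infinite length, which is not isomorphic to any object of \<^const>\<open>FVect\<close>.
\<close>

definition U_fil ::
  "(('k::field, 'v) graded_data, ('v list \<Rightarrow> 'k) set \<Rightarrow> 'v,
    ('k, 'v) filtered_data, ('v list \<Rightarrow> 'k) set \<Rightarrow> 'v) operad_map_data" where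
  "U_fil =
     \<lparr>on_color = (\<lambda>A.
        \<lparr>carrier = carrier A, mult = mult A, one = one A, zero = zero A, add = add A,
         smult = smult A,
         filt = (\<lambda>m. vspan A (\<Union>q\<in>{..m}. grad A q))\<rparr>),
      on_op = (\<lambda>As B f. f)\<rparr>"

definition lax_splitting ::
  "('c, 'o) operad_data
    \<Rightarrow> ('c, 'o, ('k::field, 'v) filtered_data, ('v list \<Rightarrow> 'k) set \<Rightarrow> 'v) operad_map_data \<Rightarrow> bool" where
  "lax_splitting C V \<longleftrightarrow> (\<exists>G. operad_map C GrVect G \<and> operad_map_iso C FVect V (U_fil \<circ>\<^sub>o G))"


section \<open>Extension of scalars\<close>

definition field_as_vs :: "('k::field \<Rightarrow> 'l::field) \<Rightarrow> ('k, 'l) module" where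
  "field_as_vs \<iota> =
     \<lparr>carrier = UNIV, mult = (*), one = 1, zero = 0, add = (+), smult = (\<lambda>a x. \<iota> a * x)\<rparr>"

text \<open>
  The tensor product of two spaces of different types, which \<^const>\<open>tensor\<close> does not cover.
\<close>

definition tensor2_relations ::
  "('k::field, 'v, 'm) module_scheme \<Rightarrow> ('k, 'w, 'n) module_scheme \<Rightarrow> ('v \<times> 'w \<Rightarrow> 'k) set" where
  "tensor2_relations M N =
     {(\<lambda>z. single (x \<oplus>\<^bsub>M\<^esub> x', y) z - single (x, y) z - single (x', y) z) | x x' y.
        x \<in> carrier M \<and> x' \<in> carrier M \<and> y \<in> carrier N} \<union>
     {(\<lambda>z. single (x, y \<oplus>\<^bsub>N\<^esub> y') z - single (x, y) z - single (x, y') z) | x y y'.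
        x \<in> carrier M \<and> y \<in> carrier N \<and> y' \<in> carrier N} \<union>
     {(\<lambda>z. single (a \<odot>\<^bsub>M\<^esub> x, y) z - a * single (x, y) z) | a x y.
        x \<in> carrier M \<and> y \<in> carrier N} \<union>
     {(\<lambda>z. single (x, a \<odot>\<^bsub>N\<^esub> y) z - a * single (x, y) z) | a x y.
        x \<in> carrier M \<and> y \<in> carrier N}"

definition tensor2_kernel ::
  "('k::field, 'v, 'm) module_scheme \<Rightarrow> ('k, 'w, 'n) module_scheme \<Rightarrow> ('v \<times> 'w \<Rightarrow> 'k) set" where
  "tensor2_kernel M N = vspan (free_vs (carrier M \<times> carrier N)) (tensor2_relations M N)"

definition tensor2 ::
  "('k::field, 'v, 'm) module_scheme \<Rightarrow> ('k, 'w, 'n) module_scheme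
    \<Rightarrow> ('k, ('v \<times> 'w \<Rightarrow> 'k) set) module" where
  "tensor2 M N = quotient_vs (free_vs (carrier M \<times> carrier N)) (tensor2_kernel M N)"

definition pure2 ::
  "('k::field, 'v, 'm) module_scheme \<Rightarrow> ('k, 'w, 'n) module_scheme \<Rightarrow> 'v \<Rightarrow> 'w
    \<Rightarrow> ('v \<times> 'w \<Rightarrow> 'k) set" where
  "pure2 M N x y = tensor2_kernel M N +>\<^bsub>free_vs (carrier M \<times> carrier N)\<^esub> single (x, y)"

text \<open>
  The filtered vector space \<open>A \<otimes> 'l\<close> over \<open>'l\<close>, where \<open>'l\<close> acts on the second factor and \<open>W\<^sub>p\<close> is the
  image of \<open>W\<^sub>p A \<otimes> 'l\<close>.
\<close>

definition scalar_ext ::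
  "('k::field \<Rightarrow> 'l::field) \<Rightarrow> ('k, 'v) filtered_data \<Rightarrow> ('l, ('v \<times> 'l \<Rightarrow> 'k) set) filtered_data" where
  "scalar_ext \<iota> A =
     (let L = field_as_vs \<iota>; T = tensor2 A L in
      \<lparr>carrier = carrier T, mult = undefined, one = undefined, zero = \<zero>\<^bsub>T\<^esub>, add = (\<oplus>\<^bsub>T\<^esub>),
       smult = (\<lambda>l. THE h. h \<in> linear_maps T T \<and>
                  (\<forall>x\<in>carrier A. \<forall>y. h (pure2 A L x y) = pure2 A L x (l * y))),
       filt = (\<lambda>p. vspan T {pure2 A L x y | x y. x \<in> filt A p})\<rparr>)"

text \<open>
  On a multimorphism \<open>f\<close> extension of scalars is \<open>f \<otimes> 'l\<close>, composed with the isomorphism of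
  \<open>(A\<^sub>1 \<otimes> 'l) \<otimes> \<dots> \<otimes> (A\<^sub>n \<otimes> 'l)\<close>, the tensor products between the factors being over \<open>'l\<close>, with
  \<open>(A\<^sub>1 \<otimes> \<dots> \<otimes> A\<^sub>n) \<otimes> 'l\<close>.
\<close>

definition base_change ::
  "('k::field \<Rightarrow> 'l::field) \<Rightarrow>
    (('k, 'v) filtered_data, ('v list \<Rightarrow> 'k) set \<Rightarrow> 'v,
     ('l, ('v \<times> 'l \<Rightarrow> 'k) set) filtered_data,
     (('v \<times> 'l \<Rightarrow> 'k) set list \<Rightarrow> 'l) set \<Rightarrow> ('v \<times> 'l \<Rightarrow> 'k) set) operad_map_data" where
  "base_change \<iota> =
     \<lparr>on_color = scalar_ext \<iota>,
      on_op = (\<lambda>As B f. THE h. h \<in> linear_maps (tensor (map (scalar_ext \<iota>) As)) (scalar_ext \<iota> B) \<and>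
        (\<forall>xs\<in>listset (map carrier As). \<forall>ls. length ls = length As \<longrightarrow>
          h (pure_tensor (map (scalar_ext \<iota>) As)
               (map (\<lambda>i. pure2 (As ! i) (field_as_vs \<iota>) (xs ! i) (ls ! i)) [0..<length As])) =
          pure2 B (field_as_vs \<iota>) (f (pure_tensor As xs)) (prod_list ls)))\<rparr>"

end

theory Submission
  imports Defs
begin

text \<open>
  A splitting of a filtered algebra \<open>V\<close> amounts to a derivation \<open>D\<close> of \<open>V\<close> that preserves the filtration
  and acts as multiplication by \<open>p\<close> on the \<open>p\<close>-th graded piece; such a family of operators is called a weight
  derivation below.  Given a splitting, let \<open>D\<close> multiply the part of degree \<open>p\<close> by \<open>p\<close>
  (\<open>splitting_imp_derivation\<close>).  Conversely, in characteristic zero the eigenvalues \<open>p\<close> are pairwise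
  distinct, so along a filtration of finite length \<open>D\<close> is diagonalizable, \<open>W\<^sub>m\<close> is the sum of the eigenspaces
  for \<open>q \<le> m\<close> (\<open>filtration_eigenspaces\<close>), and the Leibniz rule makes every operation add eigenvalues
  (\<open>derivation_imp_splitting\<close>).

  The conditions on a weight derivation are affine linear equations with coefficients in the base field,
  and their solvability does not change under a field extension.  A solution over the small field is extended to \<open>D \<otimes> 1\<close> (\<open>weight_derivation_extend\<close>).  For
  a solution \<open>E\<close> over the large field choose a retraction \<open>r\<close> of the field extension that is linear over the
  small field and put \<open>D x = (1 \<otimes> r) (E (x \<otimes> 1))\<close> (\<open>weight_derivation_restrict\<close>).  The same \<open>r\<close> serves all
  colors, so no compatible choices are needed when there are infinitely many of them.

  The rest relates the quotients that define tensor products to multilinear maps, and shows that base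
  change yields an algebra again (\<open>base_change_operad_map\<close>).
\<close>

section \<open>Vector spaces, linear maps and subspaces\<close>

abbreviation vs :: "('k::field, 'v, 'm) module_scheme \<Rightarrow> bool" where
  "vs M \<equiv> vectorspace class_ring M"

abbreviation lin ::
  "('k::field, 'v, 'm) module_scheme \<Rightarrow> ('k, 'w, 'n) module_scheme \<Rightarrow> ('v \<Rightarrow> 'w) set" where
  "lin M N \<equiv> LinearCombinations.module_hom class_ring M N"

abbreviation subsp :: "'v set \<Rightarrow> ('k::field, 'v, 'm) module_scheme \<Rightarrow> bool" where
  "subsp W M \<equiv> VectorSpace.subspace class_ring W M"

lemma vs_module: "vs M \<Longrightarrow> Module.module class_ring M"
  by (simp add: vectorspace_def)

lemma vs_group: "vs M \<Longrightarrow> abelian_group M"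
  using vs_module Module.module.axioms(2) by blast

lemma
  assumes "vs M"
  shows vs_zero [simp, intro]: "\<zero>\<^bsub>M\<^esub> \<in> carrier M"
    and vs_add [simp, intro]: "\<lbrakk>x \<in> carrier M; y \<in> carrier M\<rbrakk> \<Longrightarrow> x \<oplus>\<^bsub>M\<^esub> y \<in> carrier M"
    and vs_smult [simp, intro]: "x \<in> carrier M \<Longrightarrow> a \<odot>\<^bsub>M\<^esub> x \<in> carrier M"
    and vs_l_zero [simp]: "x \<in> carrier M \<Longrightarrow> \<zero>\<^bsub>M\<^esub> \<oplus>\<^bsub>M\<^esub> x = x"
    and vs_r_zero [simp]: "x \<in> carrier M \<Longrightarrow> x \<oplus>\<^bsub>M\<^esub> \<zero>\<^bsub>M\<^esub> = x"
    and vs_comm: "\<lbrakk>x \<in> carrier M; y \<in> carrier M\<rbrakk> \<Longrightarrow> x \<oplus>\<^bsub>M\<^esub> y = y \<oplus>\<^bsub>M\<^esub> x"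
    and vs_assoc: "\<lbrakk>x \<in> carrier M; y \<in> carrier M; z \<in> carrier M\<rbrakk>
          \<Longrightarrow> x \<oplus>\<^bsub>M\<^esub> y \<oplus>\<^bsub>M\<^esub> z = x \<oplus>\<^bsub>M\<^esub> (y \<oplus>\<^bsub>M\<^esub> z)"
    and vs_l_distr: "x \<in> carrier M \<Longrightarrow> (a + b) \<odot>\<^bsub>M\<^esub> x = a \<odot>\<^bsub>M\<^esub> x \<oplus>\<^bsub>M\<^esub> b \<odot>\<^bsub>M\<^esub> x"
    and vs_r_distr: "\<lbrakk>x \<in> carrier M; y \<in> carrier M\<rbrakk>
          \<Longrightarrow> a \<odot>\<^bsub>M\<^esub> (x \<oplus>\<^bsub>M\<^esub> y) = a \<odot>\<^bsub>M\<^esub> x \<oplus>\<^bsub>M\<^esub> a \<odot>\<^bsub>M\<^esub> y"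
    and vs_smult_assoc: "x \<in> carrier M \<Longrightarrow> a \<odot>\<^bsub>M\<^esub> (b \<odot>\<^bsub>M\<^esub> x) = (a * b) \<odot>\<^bsub>M\<^esub> x"
    and vs_smult_one [simp]: "x \<in> carrier M \<Longrightarrow> 1 \<odot>\<^bsub>M\<^esub> x = x"
    and vs_smult_l_null [simp]: "x \<in> carrier M \<Longrightarrow> 0 \<odot>\<^bsub>M\<^esub> x = \<zero>\<^bsub>M\<^esub>"
    and vs_smult_r_null [simp]: "a \<odot>\<^bsub>M\<^esub> \<zero>\<^bsub>M\<^esub> = \<zero>\<^bsub>M\<^esub>"
proof -
  interpret M: vectorspace class_ring M by fact
  show "\<zero>\<^bsub>M\<^esub> \<in> carrier M" "\<lbrakk>x \<in> carrier M; y \<in> carrier M\<rbrakk> \<Longrightarrow> x \<oplus>\<^bsub>M\<^esub> y \<in> carrier M"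
    "x \<in> carrier M \<Longrightarrow> a \<odot>\<^bsub>M\<^esub> x \<in> carrier M" "x \<in> carrier M \<Longrightarrow> \<zero>\<^bsub>M\<^esub> \<oplus>\<^bsub>M\<^esub> x = x"
    "x \<in> carrier M \<Longrightarrow> x \<oplus>\<^bsub>M\<^esub> \<zero>\<^bsub>M\<^esub> = x"
    "\<lbrakk>x \<in> carrier M; y \<in> carrier M\<rbrakk> \<Longrightarrow> x \<oplus>\<^bsub>M\<^esub> y = y \<oplus>\<^bsub>M\<^esub> x"
    "\<lbrakk>x \<in> carrier M; y \<in> carrier M; z \<in> carrier M\<rbrakk>
          \<Longrightarrow> x \<oplus>\<^bsub>M\<^esub> y \<oplus>\<^bsub>M\<^esub> z = x \<oplus>\<^bsub>M\<^esub> (y \<oplus>\<^bsub>M\<^esub> z)"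
    by (simp_all add: M.M.a_assoc) (rule M.M.a_comm)
  show "x \<in> carrier M \<Longrightarrow> (a + b) \<odot>\<^bsub>M\<^esub> x = a \<odot>\<^bsub>M\<^esub> x \<oplus>\<^bsub>M\<^esub> b \<odot>\<^bsub>M\<^esub> x"
    using M.smult_l_distr[of a b x] by simp
  show "\<lbrakk>x \<in> carrier M; y \<in> carrier M\<rbrakk>
          \<Longrightarrow> a \<odot>\<^bsub>M\<^esub> (x \<oplus>\<^bsub>M\<^esub> y) = a \<odot>\<^bsub>M\<^esub> x \<oplus>\<^bsub>M\<^esub> a \<odot>\<^bsub>M\<^esub> y"
    using M.smult_r_distr[of a x y] by simp
  show "x \<in> carrier M \<Longrightarrow> a \<odot>\<^bsub>M\<^esub> (b \<odot>\<^bsub>M\<^esub> x) = (a * b) \<odot>\<^bsub>M\<^esub> x"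
    using M.smult_assoc1[of a b x] by simp
  show "x \<in> carrier M \<Longrightarrow> 1 \<odot>\<^bsub>M\<^esub> x = x" using M.smult_one[of x] by simp
  show "x \<in> carrier M \<Longrightarrow> 0 \<odot>\<^bsub>M\<^esub> x = \<zero>\<^bsub>M\<^esub>" using M.smult_l_null[of x] by simp
  show "a \<odot>\<^bsub>M\<^esub> \<zero>\<^bsub>M\<^esub> = \<zero>\<^bsub>M\<^esub>" using M.smult_r_null[of a] by simp
qed

lemma vs_neg:
  assumes "vs M" "x \<in> carrier M"
  shows "x \<oplus>\<^bsub>M\<^esub> (-1) \<odot>\<^bsub>M\<^esub> x = \<zero>\<^bsub>M\<^esub>"
  using vs_l_distr[OF assms, of 1 "-1"] assms by simp

lemma vs_lcomm:
  assumes "vs M" "x \<in> carrier M" "y \<in> carrier M" "z \<in> carrier M"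
  shows "x \<oplus>\<^bsub>M\<^esub> (y \<oplus>\<^bsub>M\<^esub> z) = y \<oplus>\<^bsub>M\<^esub> (x \<oplus>\<^bsub>M\<^esub> z)"
  using assms by (metis vs_assoc vs_comm)

lemmas vs_ac = vs_assoc vs_comm vs_lcomm

text \<open>
  Differences are written as \<open>x \<oplus> (-1) \<odot> y\<close>, so that linear maps commute with them by the two laws
  for \<open>\<oplus>\<close> and \<open>\<odot>\<close> alone.
\<close>

lemma vs_diff_add:
  assumes "vs M" "x \<in> carrier M" "y \<in> carrier M"
  shows "(x \<oplus>\<^bsub>M\<^esub> (-1) \<odot>\<^bsub>M\<^esub> y) \<oplus>\<^bsub>M\<^esub> y = x"
  using assms by (simp add: vs_assoc vs_comm[of M _ y] vs_neg)

lemma vs_diff_zero: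
  assumes "vs M" "x \<in> carrier M" "y \<in> carrier M" "x \<oplus>\<^bsub>M\<^esub> (-1) \<odot>\<^bsub>M\<^esub> y = \<zero>\<^bsub>M\<^esub>"
  shows "x = y"
  using vs_diff_add[OF assms(1-3)] assms by simp

lemma vsI:
  fixes M :: "('k::field, 'v, 'm) module_scheme"
  assumes "\<zero>\<^bsub>M\<^esub> \<in> carrier M"
    and "\<And>x y. \<lbrakk>x \<in> carrier M; y \<in> carrier M\<rbrakk> \<Longrightarrow> x \<oplus>\<^bsub>M\<^esub> y \<in> carrier M"
    and "\<And>a x. x \<in> carrier M \<Longrightarrow> a \<odot>\<^bsub>M\<^esub> x \<in> carrier M"
    and "\<And>x. x \<in> carrier M \<Longrightarrow> x \<oplus>\<^bsub>M\<^esub> \<zero>\<^bsub>M\<^esub> = x"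
    and "\<And>x y. \<lbrakk>x \<in> carrier M; y \<in> carrier M\<rbrakk> \<Longrightarrow> x \<oplus>\<^bsub>M\<^esub> y = y \<oplus>\<^bsub>M\<^esub> x"
    and "\<And>x y z. \<lbrakk>x \<in> carrier M; y \<in> carrier M; z \<in> carrier M\<rbrakk>
          \<Longrightarrow> x \<oplus>\<^bsub>M\<^esub> y \<oplus>\<^bsub>M\<^esub> z = x \<oplus>\<^bsub>M\<^esub> (y \<oplus>\<^bsub>M\<^esub> z)"
    and "\<And>a b x. x \<in> carrier M \<Longrightarrow> (a + b) \<odot>\<^bsub>M\<^esub> x = a \<odot>\<^bsub>M\<^esub> x \<oplus>\<^bsub>M\<^esub> b \<odot>\<^bsub>M\<^esub> x"
    and "\<And>a x y. \<lbrakk>x \<in> carrier M; y \<in> carrier M\<rbrakk>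
          \<Longrightarrow> a \<odot>\<^bsub>M\<^esub> (x \<oplus>\<^bsub>M\<^esub> y) = a \<odot>\<^bsub>M\<^esub> x \<oplus>\<^bsub>M\<^esub> a \<odot>\<^bsub>M\<^esub> y"
    and "\<And>a b x. x \<in> carrier M \<Longrightarrow> (a * b) \<odot>\<^bsub>M\<^esub> x = a \<odot>\<^bsub>M\<^esub> (b \<odot>\<^bsub>M\<^esub> x)"
    and "\<And>x. x \<in> carrier M \<Longrightarrow> 1 \<odot>\<^bsub>M\<^esub> x = x"
    and "\<And>x. x \<in> carrier M \<Longrightarrow> 0 \<odot>\<^bsub>M\<^esub> x = \<zero>\<^bsub>M\<^esub>"
  shows "vs M"
proof (rule vs_criteria)
  show "\<forall>v\<in>carrier M. \<exists>neg_v\<in>carrier M. v \<oplus>\<^bsub>M\<^esub> neg_v = \<zero>\<^bsub>M\<^esub>"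
  proof
    fix v assume v: "v \<in> carrier M"
    have "v \<oplus>\<^bsub>M\<^esub> (-1) \<odot>\<^bsub>M\<^esub> v = \<zero>\<^bsub>M\<^esub>"
      using assms(7)[OF v, of 1 "-1"] assms(10,11)[OF v] by simp
    then show "\<exists>neg_v\<in>carrier M. v \<oplus>\<^bsub>M\<^esub> neg_v = \<zero>\<^bsub>M\<^esub>" using assms(3)[OF v] by blast
  qed
qed (use assms class_field in \<open>simp_all\<close>)

lemma linI:
  assumes "\<And>x. x \<in> carrier M \<Longrightarrow> f x \<in> carrier N"
    and "\<And>x y. \<lbrakk>x \<in> carrier M; y \<in> carrier M\<rbrakk> \<Longrightarrow> f (x \<oplus>\<^bsub>M\<^esub> y) = f x \<oplus>\<^bsub>N\<^esub> f y"
    and "\<And>a x. x \<in> carrier M \<Longrightarrow> f (a \<odot>\<^bsub>M\<^esub> x) = a \<odot>\<^bsub>N\<^esub> f x"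
  shows "f \<in> lin M N"
  using assms by (auto simp: LinearCombinations.module_hom_def)

lemma
  assumes "f \<in> lin M N" "x \<in> carrier M"
  shows lin_closed [intro]: "f x \<in> carrier N"
    and lin_add: "y \<in> carrier M \<Longrightarrow> f (x \<oplus>\<^bsub>M\<^esub> y) = f x \<oplus>\<^bsub>N\<^esub> f y"
    and lin_smult: "f (a \<odot>\<^bsub>M\<^esub> x) = a \<odot>\<^bsub>N\<^esub> f x"
  using assms by (auto simp: LinearCombinations.module_hom_def)

lemma lin_zero:
  assumes "f \<in> lin M N" "vs M" "vs N"
  shows "f \<zero>\<^bsub>M\<^esub> = \<zero>\<^bsub>N\<^esub>"
  using lin_smult[OF assms(1) vs_zero[OF assms(2)], of 0] lin_closed[OF assms(1) vs_zero[OF assms(2)]]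
    assms by simp

lemma lin_cong:
  assumes "f \<in> lin M N" "\<And>x. x \<in> carrier M \<Longrightarrow> f x = g x" "vs M"
  shows "g \<in> lin M N"
proof (rule linI)
  fix x y a assume x: "x \<in> carrier M"
  show "g x \<in> carrier N" using assms x lin_closed by metis
  show "g (a \<odot>\<^bsub>M\<^esub> x) = a \<odot>\<^bsub>N\<^esub> g x" using assms x lin_smult vs_smult by metis
  assume y: "y \<in> carrier M"
  show "g (x \<oplus>\<^bsub>M\<^esub> y) = g x \<oplus>\<^bsub>N\<^esub> g y" using assms x y lin_add vs_add by metis
qed

lemma lin_id: "(\<lambda>x. x) \<in> lin M M"
  by (rule linI) auto

lemma lin_comp: "\<lbrakk>f \<in> lin M N; g \<in> lin N P\<rbrakk> \<Longrightarrow> (\<lambda>x. g (f x)) \<in> lin M P"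
  by (rule linI) (simp_all add: lin_closed lin_add lin_smult)

lemma lin_const_zero: "vs N \<Longrightarrow> (\<lambda>x. \<zero>\<^bsub>N\<^esub>) \<in> lin M N"
  by (rule linI) auto

lemma lin_plus:
  assumes "f \<in> lin M N" "g \<in> lin M N" "vs N"
  shows "(\<lambda>x. f x \<oplus>\<^bsub>N\<^esub> g x) \<in> lin M N"
  by (rule linI) (use assms in \<open>simp_all add: lin_closed lin_add lin_smult vs_ac vs_r_distr\<close>)

lemma lin_scale:
  assumes "f \<in> lin M N" "vs N"
  shows "(\<lambda>x. a \<odot>\<^bsub>N\<^esub> f x) \<in> lin M N"
  by (rule linI)
    (use assms in \<open>simp_all add: lin_closed lin_add lin_smult vs_smult_assoc vs_r_distr mult.commute\<close>)

lemma lin_scalar: "vs M \<Longrightarrow> (\<lambda>x. a \<odot>\<^bsub>M\<^esub> x) \<in> lin M M"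
  by (rule lin_scale[OF lin_id])

lemma finsum_closed_vs: "\<lbrakk>vs M; \<And>i. i \<in> I \<Longrightarrow> u i \<in> carrier M\<rbrakk> \<Longrightarrow> finsum M u I \<in> carrier M"
  by (rule abelian_monoid.finsum_closed) (auto simp: abelian_group.axioms vs_group)

lemma finsum_empty_vs: "vs M \<Longrightarrow> finsum M u {} = \<zero>\<^bsub>M\<^esub>"
  by (rule abelian_monoid.finsum_empty) (auto simp: abelian_group.axioms vs_group)

lemma finsum_insert_vs:
  "\<lbrakk>vs M; finite I; j \<notin> I; \<And>i. i \<in> insert j I \<Longrightarrow> u i \<in> carrier M\<rbrakk>
    \<Longrightarrow> finsum M u (insert j I) = u j \<oplus>\<^bsub>M\<^esub> finsum M u I"
  by (rule abelian_monoid.finsum_insert) (auto simp: abelian_group.axioms vs_group)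

lemma finsum_cong_vs:
  "\<lbrakk>vs M; I = J; \<And>i. i \<in> J \<Longrightarrow> u i = w i; \<And>i. i \<in> J \<Longrightarrow> w i \<in> carrier M\<rbrakk>
    \<Longrightarrow> finsum M u I = finsum M w J"
  by (rule abelian_monoid.finsum_cong') (auto simp: abelian_group.axioms vs_group)

lemma finsum_add_vs:
  "\<lbrakk>vs M; \<And>i. i \<in> I \<Longrightarrow> u i \<in> carrier M; \<And>i. i \<in> I \<Longrightarrow> w i \<in> carrier M\<rbrakk>
    \<Longrightarrow> finsum M (\<lambda>i. u i \<oplus>\<^bsub>M\<^esub> w i) I = finsum M u I \<oplus>\<^bsub>M\<^esub> finsum M w I"
  by (rule abelian_monoid.finsum_addf) (auto simp: abelian_group.axioms vs_group)

lemma finsum_mono_neutral_vs: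
  assumes "vs M" "finite J" "I \<subseteq> J" "\<And>i. i \<in> J - I \<Longrightarrow> u i = \<zero>\<^bsub>M\<^esub>"
    "\<And>i. i \<in> J \<Longrightarrow> u i \<in> carrier M"
  shows "finsum M u I = finsum M u J"
proof -
  interpret M: vectorspace class_ring M by fact
  show ?thesis
    by (rule M.M.add.finprod_mono_neutral_cong_left) (use assms in auto)
qed

text \<open>
  The two spaces may be over different fields; this is used for semilinear maps and for maps that are
  linear over a subfield.
\<close>

lemma additive_finsum:
  assumes g: "\<And>x. x \<in> carrier M \<Longrightarrow> g x \<in> carrier N"
      "\<And>x y. \<lbrakk>x \<in> carrier M; y \<in> carrier M\<rbrakk> \<Longrightarrow> g (x \<oplus>\<^bsub>M\<^esub> y) = g x \<oplus>\<^bsub>N\<^esub> g y"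
      "g \<zero>\<^bsub>M\<^esub> = \<zero>\<^bsub>N\<^esub>"
    and vs: "vs M" "vs N" and "finite I" and u: "\<And>i. i \<in> I \<Longrightarrow> u i \<in> carrier M"
  shows "g (finsum M u I) = finsum N (\<lambda>i. g (u i)) I"
  using \<open>finite I\<close> u
proof (induction I rule: finite_induct)
  case empty
  then show ?case using g(3) vs by (simp add: finsum_empty_vs)
next
  case (insert j I)
  then have "g (u j \<oplus>\<^bsub>M\<^esub> finsum M u I) = g (u j) \<oplus>\<^bsub>N\<^esub> g (finsum M u I)"
    by (intro g(2)) (auto intro: finsum_closed_vs[OF vs(1)])
  then show ?case
    using insert finsum_insert_vs[OF vs(1) insert.hyps, of u]
      finsum_insert_vs[OF vs(2) insert.hyps, of "\<lambda>i. g (u i)"] g(1)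
    by simp
qed

lemma lin_finsum:
  assumes f: "f \<in> lin M N" and vs: "vs M" "vs N" and "finite I" and u: "\<And>i. i \<in> I \<Longrightarrow> u i \<in> carrier M"
  shows "f (finsum M u I) = finsum N (\<lambda>i. f (u i)) I"
  using lin_closed[OF f] lin_add[OF f] lin_zero[OF f vs] vs \<open>finite I\<close> u by (rule additive_finsum)

lemma lin_sum:
  assumes vs: "vs N" and "finite I" and f: "\<And>i. i \<in> I \<Longrightarrow> f i \<in> lin M N"
  shows "(\<lambda>x. finsum N (\<lambda>i. f i x) I) \<in> lin M N"
proof (rule linI)
  fix x y a assume x: "x \<in> carrier M"
  note cl = lin_closed[OF f]
  show "finsum N (\<lambda>i. f i x) I \<in> carrier N" using cl x by (intro finsum_closed_vs[OF vs])
  have "finsum N (\<lambda>i. f i (a \<odot>\<^bsub>M\<^esub> x)) I = finsum N (\<lambda>i. a \<odot>\<^bsub>N\<^esub> f i x) I"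
    using cl f x vs by (intro finsum_cong_vs[OF vs]) (auto simp: lin_smult)
  also have "\<dots> = a \<odot>\<^bsub>N\<^esub> finsum N (\<lambda>i. f i x) I"
    using lin_finsum[OF lin_scalar[OF vs], of I "\<lambda>i. f i x" a] cl f x vs \<open>finite I\<close> by simp
  finally show "finsum N (\<lambda>i. f i (a \<odot>\<^bsub>M\<^esub> x)) I = a \<odot>\<^bsub>N\<^esub> finsum N (\<lambda>i. f i x) I" .
  assume y: "y \<in> carrier M"
  have "finsum N (\<lambda>i. f i (x \<oplus>\<^bsub>M\<^esub> y)) I = finsum N (\<lambda>i. f i x \<oplus>\<^bsub>N\<^esub> f i y) I"
    using cl f x y vs by (intro finsum_cong_vs[OF vs]) (auto simp: lin_add)
  then show "finsum N (\<lambda>i. f i (x \<oplus>\<^bsub>M\<^esub> y)) I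
      = finsum N (\<lambda>i. f i x) I \<oplus>\<^bsub>N\<^esub> finsum N (\<lambda>i. f i y) I"
    using cl x y by (simp add: finsum_add_vs[OF vs])
qed

lemma subspI:
  assumes "vs M" "W \<subseteq> carrier M" "\<zero>\<^bsub>M\<^esub> \<in> W"
    "\<And>x y. \<lbrakk>x \<in> W; y \<in> W\<rbrakk> \<Longrightarrow> x \<oplus>\<^bsub>M\<^esub> y \<in> W" "\<And>a x. x \<in> W \<Longrightarrow> a \<odot>\<^bsub>M\<^esub> x \<in> W"
  shows "subsp W M"
  using assms by (simp add: VectorSpace.subspace_def submodule_def vs_module)

lemma
  assumes "subsp W M"
  shows subsp_subset: "W \<subseteq> carrier M"
    and subsp_zero [intro]: "\<zero>\<^bsub>M\<^esub> \<in> W"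
    and subsp_add: "\<lbrakk>x \<in> W; y \<in> W\<rbrakk> \<Longrightarrow> x \<oplus>\<^bsub>M\<^esub> y \<in> W"
    and subsp_smult: "x \<in> W \<Longrightarrow> a \<odot>\<^bsub>M\<^esub> x \<in> W"
    and subsp_vs: "vs M"
  using assms by (auto simp: VectorSpace.subspace_def submodule_def)

lemma subsp_vimage:
  assumes "f \<in> lin M N" "vs M" "subsp W N"
  shows "subsp {x \<in> carrier M. f x \<in> W} M"
  using assms subsp_vs[OF assms(3)]
  by (intro subspI) (auto simp: lin_zero lin_add lin_smult subsp_add subsp_smult subsp_zero)

lemma subsp_eq:
  assumes "f \<in> lin M N" "g \<in> lin M N" "vs M" "vs N"
  shows "subsp {x \<in> carrier M. f x = g x} M"
  using assms by (intro subspI) (auto simp: lin_zero lin_add lin_smult)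

lemma
  assumes "vs M" "S \<subseteq> carrier M"
  shows subsp_span: "subsp (vspan M S) M"
    and span_base: "S \<subseteq> vspan M S"
    and span_least: "\<lbrakk>subsp W M; S \<subseteq> W\<rbrakk> \<Longrightarrow> vspan M S \<subseteq> W"
proof -
  interpret M: vectorspace class_ring M by fact
  show "subsp (vspan M S) M"
    using assms M.span_is_submodule by (simp add: VectorSpace.subspace_def)
  show "S \<subseteq> vspan M S" by (rule M.in_own_span) fact
  show "\<lbrakk>subsp W M; S \<subseteq> W\<rbrakk> \<Longrightarrow> vspan M S \<subseteq> W"
    using M.span_is_subset by simp
qed

lemma span_closed: "\<lbrakk>vs M; S \<subseteq> carrier M\<rbrakk> \<Longrightarrow> vspan M S \<subseteq> carrier M"
  using subsp_span subsp_subset by blast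

lemma span_zero:
  assumes "vs M" "S \<subseteq> {\<zero>\<^bsub>M\<^esub>}"
  shows "vspan M S = {\<zero>\<^bsub>M\<^esub>}"
proof -
  have "subsp {\<zero>\<^bsub>M\<^esub>} M" using assms by (intro subspI) auto
  then have "vspan M S \<subseteq> {\<zero>\<^bsub>M\<^esub>}" using assms subsp_subset by (intro span_least) auto
  moreover have "\<zero>\<^bsub>M\<^esub> \<in> vspan M S" using assms subsp_span[of M S] by auto
  ultimately show ?thesis by blast
qed

lemma span_image_subset:
  assumes "f \<in> lin M N" "vs M" "S \<subseteq> carrier M" "subsp W N" "f ` S \<subseteq> W"
  shows "f ` vspan M S \<subseteq> W"
proof -
  have "vspan M S \<subseteq> {x \<in> carrier M. f x \<in> W}"
    using assms by (intro span_least subsp_vimage) auto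
  then show ?thesis by auto
qed

lemma lin_eq_on_span:
  assumes "f \<in> lin M N" "g \<in> lin M N" "vs M" "vs N" "S \<subseteq> carrier M"
    "\<And>x. x \<in> S \<Longrightarrow> f x = g x" "x \<in> vspan M S"
  shows "f x = g x"
proof -
  have "vspan M S \<subseteq> {x \<in> carrier M. f x = g x}"
    using assms by (intro span_least subsp_eq) auto
  with assms show ?thesis by auto
qed

section \<open>Spaces presented by generators and relations\<close>

lemma linear_maps_iff: "f \<in> linear_maps M N \<longleftrightarrow> f \<in> lin M N \<and> f \<in> extensional (carrier M)"
  by (simp add: linear_maps_def)

lemma free_vs_simps [simp]:
  "\<zero>\<^bsub>free_vs X\<^esub> = (\<lambda>_. 0)" "f \<oplus>\<^bsub>free_vs X\<^esub> g = (\<lambda>x. f x + g x)"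
  "a \<odot>\<^bsub>free_vs X\<^esub> f = (\<lambda>x. a * f x)"
  by (auto simp: free_vs_def)

lemma free_vs_carrier:
  "f \<in> carrier (free_vs X) \<longleftrightarrow> finite {x. f x \<noteq> 0} \<and> {x. f x \<noteq> 0} \<subseteq> X"
  by (simp add: free_vs_def)

lemma free_vs_vs: "vs (free_vs X :: ('k::field, 'x \<Rightarrow> 'k) module)"
proof (rule vsI)
  fix f g :: "'x \<Rightarrow> 'k" and a
  assume f: "f \<in> carrier (free_vs X)"
  have "{x. a * f x \<noteq> 0} \<subseteq> {x. f x \<noteq> 0}" by auto
  then show "a \<odot>\<^bsub>free_vs X\<^esub> f \<in> carrier (free_vs X)"
    using f by (auto simp: free_vs_carrier intro: finite_subset)
  assume g: "g \<in> carrier (free_vs X)"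
  have "{x. f x + g x \<noteq> 0} \<subseteq> {x. f x \<noteq> 0} \<union> {x. g x \<noteq> 0}" by auto
  then show "f \<oplus>\<^bsub>free_vs X\<^esub> g \<in> carrier (free_vs X)"
    using f g by (auto simp: free_vs_carrier intro: finite_subset)
qed (auto simp: free_vs_carrier algebra_simps)

lemma single_carrier [simp]: "x \<in> X \<Longrightarrow> single x \<in> carrier (free_vs X)"
  by (simp add: free_vs_carrier single_def)

text \<open>
  An element of finite support is a sum of multiples of \<^const>\<open>single\<close>: remove one point of the
  support at a time.
\<close>

lemma free_vs_subset:
  assumes W: "subsp W (free_vs X)" and "\<And>x. x \<in> X \<Longrightarrow> single x \<in> W"
  shows "carrier (free_vs X) \<subseteq> W"
proof -
  have "finite S \<Longrightarrow> S \<subseteq> X \<Longrightarrow> {x. f x \<noteq> 0} \<subseteq> S \<Longrightarrow> f \<in> W" for S f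
  proof (induction S arbitrary: f rule: finite_induct)
    case empty
    then have "f = (\<lambda>_. 0)" by auto
    then show ?case using subsp_zero[OF W] by simp
  next
    case (insert s S)
    have "f(s := 0) \<in> W" using insert by (intro insert.IH) auto
    moreover have "f s \<odot>\<^bsub>free_vs X\<^esub> single s \<in> W" using assms insert by (intro subsp_smult[OF W]) auto
    ultimately have "f(s := 0) \<oplus>\<^bsub>free_vs X\<^esub> f s \<odot>\<^bsub>free_vs X\<^esub> single s \<in> W" by (rule subsp_add[OF W])
    also have "f(s := 0) \<oplus>\<^bsub>free_vs X\<^esub> f s \<odot>\<^bsub>free_vs X\<^esub> single s = f" by (auto simp: single_def)
    finally show ?case .
  qed
  then show ?thesis by (auto simp: free_vs_carrier)
qed

definition free_ext :: "('k::field, 'w, 'n) module_scheme \<Rightarrow> ('x \<Rightarrow> 'w) \<Rightarrow> ('x \<Rightarrow> 'k) \<Rightarrow> 'w" where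
  "free_ext N g f = finsum N (\<lambda>x. f x \<odot>\<^bsub>N\<^esub> g x) {x. f x \<noteq> 0}"

lemma
  fixes X :: "'x set" and N :: "('k::field, 'w, 'n) module_scheme"
  assumes N: "vs N" and g: "\<And>x. x \<in> X \<Longrightarrow> g x \<in> carrier N"
  shows free_ext_lin: "free_ext N g \<in> lin (free_vs X) N"
    and free_ext_single: "x \<in> X \<Longrightarrow> free_ext N g (single x) = g x"
proof -
  have eq: "free_ext N g f = finsum N (\<lambda>x. f x \<odot>\<^bsub>N\<^esub> g x) S"
    if "finite S" "S \<subseteq> X" "{x. f x \<noteq> 0} \<subseteq> S" for f S
    unfolding free_ext_def
  proof (rule finsum_mono_neutral_vs[OF N that(1,3)])
    fix i assume "i \<in> S - {x. f x \<noteq> 0}"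
    then have "i \<in> X" "f i = 0" using that by auto
    then show "f i \<odot>\<^bsub>N\<^esub> g i = \<zero>\<^bsub>N\<^esub>" using g N by simp
  next
    fix i assume "i \<in> S"
    then show "f i \<odot>\<^bsub>N\<^esub> g i \<in> carrier N" using g N that by auto
  qed
  show "free_ext N g \<in> lin (free_vs X) N"
  proof (rule linI)
    fix f h :: "'x \<Rightarrow> 'k" and a assume f: "f \<in> carrier (free_vs X)"
    let ?S = "{x. f x \<noteq> 0}"
    have S: "finite ?S" "?S \<subseteq> X" using f by (auto simp: free_vs_carrier)
    then have cl: "f x \<odot>\<^bsub>N\<^esub> g x \<in> carrier N" if "x \<in> ?S" for x using that g N by auto
    then show "free_ext N g f \<in> carrier N" unfolding free_ext_def by (intro finsum_closed_vs[OF N])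
    have "free_ext N g (a \<odot>\<^bsub>free_vs X\<^esub> f) = finsum N (\<lambda>x. (a * f x) \<odot>\<^bsub>N\<^esub> g x) ?S"
      using eq[OF S, of "a \<odot>\<^bsub>free_vs X\<^esub> f"] by auto
    also have "\<dots> = finsum N (\<lambda>x. a \<odot>\<^bsub>N\<^esub> (f x \<odot>\<^bsub>N\<^esub> g x)) ?S"
      using cl S g N by (intro finsum_cong_vs[OF N]) (auto simp: vs_smult_assoc)
    also have "\<dots> = a \<odot>\<^bsub>N\<^esub> free_ext N g f"
      unfolding free_ext_def using lin_finsum[OF lin_scalar[OF N], of ?S "\<lambda>x. f x \<odot>\<^bsub>N\<^esub> g x" a] cl S N
      by simp
    finally show "free_ext N g (a \<odot>\<^bsub>free_vs X\<^esub> f) = a \<odot>\<^bsub>N\<^esub> free_ext N g f" .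
    assume h: "h \<in> carrier (free_vs X)"
    let ?T = "?S \<union> {x. h x \<noteq> 0}"
    have T: "finite ?T" "?T \<subseteq> X" using f h by (auto simp: free_vs_carrier)
    have gT: "g x \<in> carrier N" if "x \<in> ?T" for x using that T g by blast
    have "free_ext N g (f \<oplus>\<^bsub>free_vs X\<^esub> h) = finsum N (\<lambda>x. (f x + h x) \<odot>\<^bsub>N\<^esub> g x) ?T"
      using eq[OF T, of "f \<oplus>\<^bsub>free_vs X\<^esub> h"] by fastforce
    also have "\<dots> = finsum N (\<lambda>x. f x \<odot>\<^bsub>N\<^esub> g x \<oplus>\<^bsub>N\<^esub> h x \<odot>\<^bsub>N\<^esub> g x) ?T"
      by (rule finsum_cong_vs[OF N refl]) (use gT N in \<open>simp_all add: vs_l_distr\<close>)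
    also have "\<dots> = finsum N (\<lambda>x. f x \<odot>\<^bsub>N\<^esub> g x) ?T \<oplus>\<^bsub>N\<^esub> finsum N (\<lambda>x. h x \<odot>\<^bsub>N\<^esub> g x) ?T"
      by (rule finsum_add_vs[OF N]) (use gT N in simp_all)
    also have "\<dots> = free_ext N g f \<oplus>\<^bsub>N\<^esub> free_ext N g h"
      using eq[OF T, of f] eq[OF T, of h] by auto
    finally show "free_ext N g (f \<oplus>\<^bsub>free_vs X\<^esub> h) = free_ext N g f \<oplus>\<^bsub>N\<^esub> free_ext N g h" .
  qed
  show "free_ext N g (single x) = g x" if x: "x \<in> X"
  proof -
    have "free_ext N g (single x) = finsum N (\<lambda>y. single x y \<odot>\<^bsub>N\<^esub> g y) {x}"
      using x by (intro eq) (auto simp: single_def)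
    also have "\<dots> = g x"
      using x g N finsum_insert_vs[OF N, of "{}" x "\<lambda>y. single x y \<odot>\<^bsub>N\<^esub> g y"]
      by (simp add: finsum_empty_vs[OF N] single_def)
    finally show ?thesis .
  qed
qed

lemma quotient_subgroup:
  assumes "subsp N M"
  shows "abelian_subgroup N M"
proof -
  note M = subsp_vs[OF assms]
  interpret M: vectorspace class_ring M by (rule M)
  have neg: "\<ominus>\<^bsub>M\<^esub> x \<in> N" if "x \<in> N" for x
  proof -
    have x: "x \<in> carrier M" using that subsp_subset[OF assms] by blast
    then have "(-1) \<odot>\<^bsub>M\<^esub> x \<oplus>\<^bsub>M\<^esub> x = \<zero>\<^bsub>M\<^esub>"
      using vs_neg[OF M x] vs_comm[OF M x vs_smult[OF M x, of "-1"]] by metis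
    then have "\<ominus>\<^bsub>M\<^esub> x = (-1) \<odot>\<^bsub>M\<^esub> x"
      by (rule M.M.minus_equality[OF _ x vs_smult[OF M x]])
    then show ?thesis using subsp_smult[OF assms that, of "-1"] by metis
  qed
  have "subgroup N (add_monoid M)"
    using neg subsp_subset[OF assms] subsp_zero[OF assms] subsp_add[OF assms]
    by (unfold_locales) (auto simp: a_inv_def)
  then show ?thesis
    by (rule abelian_subgroupI3[OF additive_subgroup.intro vs_group[OF M]])
qed

context
  fixes M :: "('k::field, 'v, 'm) module_scheme" and N
  assumes sub: "subsp N M"
begin

interpretation abelian_subgroup N M by (rule quotient_subgroup[OF sub])

lemma quotient_carrier: "carrier (quotient_vs M N) = (\<lambda>x. N +>\<^bsub>M\<^esub> x) ` carrier M"
  by (auto simp: quotient_vs_def A_RCOSETS_def')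

lemma coset_add:
  "\<lbrakk>x \<in> carrier M; y \<in> carrier M\<rbrakk>
    \<Longrightarrow> (N +>\<^bsub>M\<^esub> x) \<oplus>\<^bsub>quotient_vs M N\<^esub> (N +>\<^bsub>M\<^esub> y) = N +>\<^bsub>M\<^esub> (x \<oplus>\<^bsub>M\<^esub> y)"
  by (simp add: quotient_vs_def a_rcos_sum)

lemma coset_eqI:
  assumes "x \<in> carrier M" "y \<in> N"
  shows "N +>\<^bsub>M\<^esub> (y \<oplus>\<^bsub>M\<^esub> x) = N +>\<^bsub>M\<^esub> x"
proof (rule a_repr_independence[symmetric])
  show "y \<oplus>\<^bsub>M\<^esub> x \<in> N +>\<^bsub>M\<^esub> x" using assms by (auto simp: a_r_coset_def')
  show "subgroup N (add_monoid M)" by (rule a_subgroup)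
qed (use assms in auto)

lemma coset_smult:
  assumes "x \<in> carrier M"
  shows "a \<odot>\<^bsub>quotient_vs M N\<^esub> (N +>\<^bsub>M\<^esub> x) = N +>\<^bsub>M\<^esub> (a \<odot>\<^bsub>M\<^esub> x)"
proof -
  note M = subsp_vs[OF sub]
  have "N +>\<^bsub>M\<^esub> (a \<odot>\<^bsub>M\<^esub> y) = N +>\<^bsub>M\<^esub> (a \<odot>\<^bsub>M\<^esub> x)" if y: "y \<in> N +>\<^bsub>M\<^esub> x" for y
  proof -
    obtain n where n: "n \<in> N" "y = n \<oplus>\<^bsub>M\<^esub> x" using y by (auto simp: a_r_coset_def')
    then have "n \<in> carrier M" using subsp_subset[OF sub] by blast
    then show ?thesis using n assms M sub by (simp add: vs_r_distr coset_eqI subsp_smult)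
  qed
  moreover have "x \<in> N +>\<^bsub>M\<^esub> x" using assms by (rule a_rcos_self)
  ultimately have "(\<Union>y\<in>N +>\<^bsub>M\<^esub> x. N +>\<^bsub>M\<^esub> (a \<odot>\<^bsub>M\<^esub> y)) = N +>\<^bsub>M\<^esub> (a \<odot>\<^bsub>M\<^esub> x)" by blast
  then show ?thesis by (simp only: quotient_vs_def module.simps)
qed

lemma coset_zero: "\<zero>\<^bsub>quotient_vs M N\<^esub> = N +>\<^bsub>M\<^esub> \<zero>\<^bsub>M\<^esub>"
proof -
  have "n \<oplus>\<^bsub>M\<^esub> \<zero>\<^bsub>M\<^esub> = n" if "n \<in> N" for n
    using that subsp_subset[OF sub] by (intro vs_r_zero subsp_vs[OF sub]) blast
  then have "N +>\<^bsub>M\<^esub> \<zero>\<^bsub>M\<^esub> = N" unfolding a_r_coset_def' by simp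
  then show ?thesis by (simp add: quotient_vs_def)
qed

lemma quotient_vs_vs: "vs (quotient_vs M N)"
proof -
  let ?Q = "quotient_vs M N" and ?q = "\<lambda>x. N +>\<^bsub>M\<^esub> x"
  note M = subsp_vs[OF sub]
  note c = coset_add coset_smult coset_zero
  show ?thesis
  proof (rule vsI; (unfold quotient_carrier)?; (elim imageE)?; hypsubst?)
    fix x y z a b assume x: "x \<in> carrier M"
    show "(a + b) \<odot>\<^bsub>?Q\<^esub> ?q x
        = a \<odot>\<^bsub>?Q\<^esub> ?q x \<oplus>\<^bsub>?Q\<^esub> b \<odot>\<^bsub>?Q\<^esub> ?q x"
      using x M by (simp add: c vs_l_distr)
    show "a \<odot>\<^bsub>?Q\<^esub> ?q x \<in> ?q ` carrier M"
      using x M by (simp add: c)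
    show "?q x \<oplus>\<^bsub>?Q\<^esub> \<zero>\<^bsub>?Q\<^esub> = ?q x"
      using x M by (simp add: c)
    show "0 \<odot>\<^bsub>?Q\<^esub> ?q x = \<zero>\<^bsub>?Q\<^esub>"
      using x M by (simp add: c)
    show "1 \<odot>\<^bsub>?Q\<^esub> ?q x = ?q x"
      using x M by (simp add: c)
    show "(a * b) \<odot>\<^bsub>?Q\<^esub> ?q x
        = a \<odot>\<^bsub>?Q\<^esub> (b \<odot>\<^bsub>?Q\<^esub> ?q x)"
      using x M by (simp add: c vs_smult_assoc)
    assume y: "y \<in> carrier M"
    show "?q x \<oplus>\<^bsub>?Q\<^esub> ?q y \<in> ?q ` carrier M"
      using x y M by (simp add: c)
    show "?q x \<oplus>\<^bsub>?Q\<^esub> ?q y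
        = ?q y \<oplus>\<^bsub>?Q\<^esub> ?q x"
      using x y M by (simp add: c vs_comm[OF M x y])
    show "a \<odot>\<^bsub>?Q\<^esub> (?q x \<oplus>\<^bsub>?Q\<^esub> ?q y)
        = a \<odot>\<^bsub>?Q\<^esub> ?q x \<oplus>\<^bsub>?Q\<^esub> a \<odot>\<^bsub>?Q\<^esub> ?q y"
      using x y M by (simp add: c vs_r_distr)
    assume z: "z \<in> carrier M"
    show "?q x \<oplus>\<^bsub>?Q\<^esub> ?q y \<oplus>\<^bsub>?Q\<^esub> ?q z
        = ?q x \<oplus>\<^bsub>?Q\<^esub> (?q y \<oplus>\<^bsub>?Q\<^esub> ?q z)"
      using x y z M by (simp add: c vs_assoc)
  next
    show "\<zero>\<^bsub>?Q\<^esub> \<in> ?q ` carrier M"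
      using M by (simp add: c)
  qed
qed

lemma coset_lin: "(\<lambda>x. N +>\<^bsub>M\<^esub> x) \<in> lin M (quotient_vs M N)"
  by (rule linI) (use subsp_vs[OF sub] in \<open>simp_all add: quotient_carrier coset_add coset_smult\<close>)

lemma coset_null: "x \<in> N \<Longrightarrow> N +>\<^bsub>M\<^esub> x = \<zero>\<^bsub>quotient_vs M N\<^esub>"
proof -
  assume x: "x \<in> N"
  note M = subsp_vs[OF sub]
  have "x \<oplus>\<^bsub>M\<^esub> \<zero>\<^bsub>M\<^esub> = x" using x subsp_subset[OF sub] by (intro vs_r_zero[OF M]) blast
  then show ?thesis using coset_eqI[OF vs_zero[OF M] x] coset_zero by metis
qed

text \<open>
  The lift takes the value of \<open>f\<close> at a chosen representative of the coset; two representatives differ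
  by an element of \<open>N\<close>, which \<open>f\<close> annihilates.
\<close>

lemma quotient_lift:
  assumes f: "f \<in> lin M P" and "vs P" and null: "\<And>x. x \<in> N \<Longrightarrow> f x = \<zero>\<^bsub>P\<^esub>"
  obtains h where "h \<in> linear_maps (quotient_vs M N) P" "\<And>x. x \<in> carrier M \<Longrightarrow> h (N +>\<^bsub>M\<^esub> x) = f x"
proof -
  note M = subsp_vs[OF sub]
  define h where "h = restrict (\<lambda>Y. f (SOME y. y \<in> Y)) (carrier (quotient_vs M N))"
  have h: "h (N +>\<^bsub>M\<^esub> x) = f x" if x: "x \<in> carrier M" for x
  proof -
    have "f y = f x" if "y \<in> N +>\<^bsub>M\<^esub> x" for y
    proof -
      obtain n where n: "n \<in> N" "y = n \<oplus>\<^bsub>M\<^esub> x" using \<open>y \<in> N +>\<^bsub>M\<^esub> x\<close> by (auto simp: a_r_coset_def')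
      then have "n \<in> carrier M" using subsp_subset[OF sub] by blast
      then show ?thesis using n null lin_add[OF f _ x] lin_closed[OF f x] \<open>vs P\<close> by simp
    qed
    moreover have "x \<in> N +>\<^bsub>M\<^esub> x" using x by (rule a_rcos_self)
    ultimately have "f (SOME y. y \<in> N +>\<^bsub>M\<^esub> x) = f x" by (metis someI)
    moreover have "N +>\<^bsub>M\<^esub> x \<in> carrier (quotient_vs M N)"
      unfolding quotient_carrier using x by blast
    ultimately show ?thesis by (simp only: h_def restrict_apply if_True)
  qed
  moreover have "h \<in> linear_maps (quotient_vs M N) P"
    unfolding linear_maps_iff
  proof
    show "h \<in> lin (quotient_vs M N) P"
      by (rule linI) (use f M in \<open>auto simp: quotient_carrier coset_add coset_smult h lin_closed lin_add lin_smult\<close>)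
  qed (simp add: h_def)
  ultimately show ?thesis using that by blast
qed

end

text \<open>
  Both kinds of tensor products, of a list of spaces over one field and of a space with an extension
  field, are free spaces modulo the span of some relations.  Their universal properties are instances
  of the one proved here.
\<close>

abbreviation presented_vs :: "'x set \<Rightarrow> ('x \<Rightarrow> 'k::field) set \<Rightarrow> ('k, ('x \<Rightarrow> 'k) set) module" where
  "presented_vs X R \<equiv> quotient_vs (free_vs X) (vspan (free_vs X) R)"

abbreviation generator :: "'x set \<Rightarrow> ('x \<Rightarrow> 'k::field) set \<Rightarrow> 'x \<Rightarrow> ('x \<Rightarrow> 'k) set" where
  "generator X R x \<equiv> vspan (free_vs X) R +>\<^bsub>free_vs X\<^esub> single x"

context
  fixes X :: "'x set" and R :: "('x \<Rightarrow> 'k::field) set"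
  assumes R: "R \<subseteq> carrier (free_vs X)"
begin

lemma presented_vs_vs: "vs (presented_vs X R)"
  by (intro quotient_vs_vs subsp_span free_vs_vs R)

lemma generator_closed: "x \<in> X \<Longrightarrow> generator X R x \<in> carrier (presented_vs X R)"
  using quotient_carrier[OF subsp_span[OF free_vs_vs R]] by auto

lemma relation_null:
  assumes "r \<in> R"
  shows "vspan (free_vs X) R +>\<^bsub>free_vs X\<^esub> r = \<zero>\<^bsub>presented_vs X R\<^esub>"
  using span_base[OF free_vs_vs R] assms by (intro coset_null subsp_span free_vs_vs R) auto

lemma presented_vs_span: "vspan (presented_vs X R) (generator X R ` X) = carrier (presented_vs X R)"
proof
  let ?q = "\<lambda>x. vspan (free_vs X) R +>\<^bsub>free_vs X\<^esub> x"
  have sub: "subsp (vspan (free_vs X) R) (free_vs X)" by (rule subsp_span[OF free_vs_vs R])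
  have gens: "generator X R ` X \<subseteq> carrier (presented_vs X R)" using generator_closed by blast
  show "vspan (presented_vs X R) (generator X R ` X) \<subseteq> carrier (presented_vs X R)"
    by (rule span_closed[OF presented_vs_vs gens])
  let ?W = "{f \<in> carrier (free_vs X). ?q f \<in> vspan (presented_vs X R) (generator X R ` X)}"
  have "carrier (free_vs X) \<subseteq> ?W"
  proof (rule free_vs_subset)
    show "subsp ?W (free_vs X)"
      by (intro subsp_vimage[OF coset_lin[OF sub] free_vs_vs] subsp_span presented_vs_vs gens)
    show "\<And>x. x \<in> X \<Longrightarrow> single x \<in> ?W" using span_base[OF presented_vs_vs gens] by auto
  qed
  then show "carrier (presented_vs X R) \<subseteq> vspan (presented_vs X R) (generator X R ` X)"
    using quotient_carrier[OF sub] by auto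
qed

lemma presented_vs_unique:
  assumes "h \<in> linear_maps (presented_vs X R) P" "h' \<in> linear_maps (presented_vs X R) P" "vs P"
    "\<And>x. x \<in> X \<Longrightarrow> h (generator X R x) = h' (generator X R x)"
  shows "h = h'"
proof (rule extensionalityI)
  show "h \<in> extensional (carrier (presented_vs X R))" "h' \<in> extensional (carrier (presented_vs X R))"
    using assms(1,2) unfolding linear_maps_iff by blast+
  have lin: "h \<in> lin (presented_vs X R) P" "h' \<in> lin (presented_vs X R) P"
    using assms(1,2) unfolding linear_maps_iff by blast+
  have gens: "generator X R ` X \<subseteq> carrier (presented_vs X R)" using generator_closed by blast
  fix x assume "x \<in> carrier (presented_vs X R)"
  then have "x \<in> vspan (presented_vs X R) (generator X R ` X)" unfolding presented_vs_span .
  moreover have "h y = h' y" if "y \<in> generator X R ` X" for y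
    using that by (rule imageE) (simp only: assms(4))
  ultimately show "h x = h' x" by (rule lin_eq_on_span[OF lin presented_vs_vs \<open>vs P\<close> gens, rotated])
qed

lemma presented_vs_ext:
  assumes P: "vs P" and g: "\<And>x. x \<in> X \<Longrightarrow> g x \<in> carrier P"
    and "\<And>r. r \<in> R \<Longrightarrow> free_ext P g r = \<zero>\<^bsub>P\<^esub>"
  shows "\<exists>!h. h \<in> linear_maps (presented_vs X R) P \<and> (\<forall>x\<in>X. h (generator X R x) = g x)"
proof -
  have sub: "subsp (vspan (free_vs X) R) (free_vs X)" by (rule subsp_span[OF free_vs_vs R])
  have ext: "free_ext P g \<in> lin (free_vs X) P" by (rule free_ext_lin[OF P g])
  have "free_ext P g x = \<zero>\<^bsub>P\<^esub>" if "x \<in> vspan (free_vs X) R" for x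
    using assms(3) that by (rule lin_eq_on_span[OF ext lin_const_zero[OF P] free_vs_vs P R])
  from quotient_lift[OF sub ext P this]
  obtain h where h: "h \<in> linear_maps (presented_vs X R) P"
    "\<And>x. x \<in> carrier (free_vs X) \<Longrightarrow> h (vspan (free_vs X) R +>\<^bsub>free_vs X\<^esub> x) = free_ext P g x" by blast
  have hg: "h (generator X R x) = g x" if "x \<in> X" for x
    using free_ext_single[where X = X, OF P g that] h(2)[OF single_carrier[OF that]] by simp
  show ?thesis
  proof (rule ex1I[of _ h])
    show "h \<in> linear_maps (presented_vs X R) P \<and> (\<forall>x\<in>X. h (generator X R x) = g x)"
      using h(1) hg by blast
    fix h' assume "h' \<in> linear_maps (presented_vs X R) P \<and> (\<forall>x\<in>X. h' (generator X R x) = g x)"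
    then show "h' = h" using h(1) hg by (intro presented_vs_unique[OF _ _ P]) auto
  qed
qed

end

section \<open>Tensor products and multilinear maps\<close>

lemma listset_iff: "xs \<in> listset As \<longleftrightarrow> length xs = length As \<and> (\<forall>i<length As. xs ! i \<in> As ! i)"
proof (induction As arbitrary: xs)
  case (Cons A As)
  show ?case
    by (cases xs) (auto simp: set_Cons_def Cons.IH nth_Cons less_Suc_eq_0_disj split: nat.split)
qed auto

definition tuples :: "('k::field, 'v, 'm) module_scheme list \<Rightarrow> 'v list set" where
  "tuples Ms = listset (map carrier Ms)"

lemma tuples_iff: "xs \<in> tuples Ms \<longleftrightarrow> length xs = length Ms \<and> (\<forall>i<length Ms. xs ! i \<in> carrier (Ms ! i))"
  by (auto simp: tuples_def listset_iff)

lemma tuples_update: "\<lbrakk>xs \<in> tuples Ms; i < length Ms; x \<in> carrier (Ms ! i)\<rbrakk> \<Longrightarrow> xs[i := x] \<in> tuples Ms"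
  by (auto simp: tuples_iff nth_list_update)

lemma tuples_nth: "\<lbrakk>xs \<in> tuples Ms; i < length Ms\<rbrakk> \<Longrightarrow> xs ! i \<in> carrier (Ms ! i)"
  by (auto simp: tuples_iff)

text \<open>
  Linearity in each argument is stated for list updates.  This is the form of the relations that
  define the tensor product, and it turns each slot into an ordinary linear map, so that composites
  of multilinear maps are treated by composing linear maps.
\<close>

definition multilin ::
  "('k::field, 'v, 'm) module_scheme list \<Rightarrow> ('k, 'w, 'n) module_scheme \<Rightarrow> ('v list \<Rightarrow> 'w) \<Rightarrow> bool" where
  "multilin Ms N m \<longleftrightarrow>
     (\<forall>xs\<in>tuples Ms. m xs \<in> carrier N \<and> (\<forall>i<length Ms. (\<lambda>x. m (xs[i := x])) \<in> lin (Ms ! i) N))"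

lemma multilinI:
  assumes "\<And>xs. xs \<in> tuples Ms \<Longrightarrow> m xs \<in> carrier N"
    and "\<And>xs i. \<lbrakk>xs \<in> tuples Ms; i < length Ms\<rbrakk> \<Longrightarrow> (\<lambda>x. m (xs[i := x])) \<in> lin (Ms ! i) N"
  shows "multilin Ms N m"
  using assms by (simp add: multilin_def)

lemma
  assumes "multilin Ms N m" "xs \<in> tuples Ms"
  shows multilin_closed: "m xs \<in> carrier N"
    and multilin_slot: "i < length Ms \<Longrightarrow> (\<lambda>x. m (xs[i := x])) \<in> lin (Ms ! i) N"
  using assms by (simp_all add: multilin_def)

lemma multilin_comp_lin:
  assumes "multilin Ms N m" "f \<in> lin N P"
  shows "multilin Ms P (\<lambda>xs. f (m xs))"
  using assms by (intro multilinI) (auto intro: lin_comp multilin_slot lin_closed multilin_closed)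

lemma multilin_cong:
  assumes "multilin Ms N m" "\<And>xs. xs \<in> tuples Ms \<Longrightarrow> m xs = m' xs" "\<And>M. M \<in> set Ms \<Longrightarrow> vs M"
  shows "multilin Ms N m'"
proof (rule multilinI)
  fix xs i assume xs: "xs \<in> tuples Ms"
  show "m' xs \<in> carrier N" using multilin_closed[OF assms(1) xs] assms(2)[OF xs] by simp
  assume i: "i < length Ms"
  show "(\<lambda>x. m' (xs[i := x])) \<in> lin (Ms ! i) N"
    by (rule lin_cong[OF multilin_slot[OF assms(1) xs i]])
      (simp_all add: xs i assms(2,3) tuples_update)
qed

lemma multilin_sum:
  assumes "vs N" "finite I" "\<And>j. j \<in> I \<Longrightarrow> multilin Ms N (m j)"
  shows "multilin Ms N (\<lambda>xs. finsum N (\<lambda>j. m j xs) I)"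
proof (rule multilinI)
  fix xs i assume xs: "xs \<in> tuples Ms"
  show "finsum N (\<lambda>j. m j xs) I \<in> carrier N"
    using assms xs by (intro finsum_closed_vs) (auto intro: multilin_closed)
  assume "i < length Ms"
  then show "(\<lambda>x. finsum N (\<lambda>j. m j (xs[i := x])) I) \<in> lin (Ms ! i) N"
    using assms xs by (intro lin_sum) (auto intro: multilin_slot)
qed

lemma multilin_precomp:
  assumes m: "multilin Ns N m" and len: "length Ns = length Ms"
    and f: "\<And>i. i < length Ms \<Longrightarrow> f i \<in> lin (Ms ! i) (Ns ! i)"
  shows "multilin Ms N (\<lambda>xs. m (map (\<lambda>i. f i (xs ! i)) [0..<length Ms]))"
proof (rule multilinI)
  fix xs i assume xs: "xs \<in> tuples Ms"
  let ?ys = "map (\<lambda>i. f i (xs ! i)) [0..<length Ms]"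
  have ys: "?ys \<in> tuples Ns"
    using xs lin_closed[OF f] len by (auto simp: tuples_iff)
  then show "m ?ys \<in> carrier N" by (rule multilin_closed[OF m])
  assume i: "i < length Ms"
  have eq: "map (\<lambda>j. f j (xs[i := x] ! j)) [0..<length Ms] = ?ys[i := f i x]" for x
    using xs i by (intro nth_equalityI) (auto simp: tuples_iff nth_list_update)
  show "(\<lambda>x. m (map (\<lambda>j. f j (xs[i := x] ! j)) [0..<length Ms])) \<in> lin (Ms ! i) N"
    unfolding eq using i len by (intro lin_comp[OF f[OF i] multilin_slot[OF m ys]]) simp
qed

text \<open>
  A statement that defines a subspace in each argument only has to be checked on tuples of elements
  of spanning sets: replace the arguments one after the other.
\<close>

lemma slotwise_span_induct:
  assumes vs: "\<And>i. i < length Ms \<Longrightarrow> vs (Ms ! i)"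
    and Ss: "length Ss = length Ms" "\<And>i. i < length Ms \<Longrightarrow> Ss ! i \<subseteq> carrier (Ms ! i)"
    and sub: "\<And>xs i. \<lbrakk>xs \<in> tuples Ms; i < length Ms\<rbrakk> \<Longrightarrow> subsp {x \<in> carrier (Ms ! i). Q (xs[i := x])} (Ms ! i)"
    and base: "\<And>xs. xs \<in> listset Ss \<Longrightarrow> Q xs"
    and xs: "xs \<in> listset (map2 vspan Ms Ss)"
  shows "Q xs"
proof -
  have "Q ys" if "j \<le> length Ms" "length ys = length Ms"
    "\<And>i. i < length Ms \<Longrightarrow> ys ! i \<in> (if i < j then vspan (Ms ! i) (Ss ! i) else Ss ! i)" for j ys
    using that
  proof (induction j arbitrary: ys)
    case 0
    then show ?case using Ss by (intro base) (auto simp: listset_iff)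
  next
    case (Suc j)
    have j: "j < length Ms" using Suc.prems by simp
    have "ys ! i \<in> carrier (Ms ! i)" if "i < length Ms" for i
      using Suc.prems(3)[OF that] span_closed[OF vs Ss(2), of i] Ss(2)[of i] that
      by (auto split: if_splits)
    then have "ys \<in> tuples Ms" using Suc.prems by (simp add: tuples_iff)
    have "Q (ys[j := x])" if "x \<in> Ss ! j" for x
    proof (rule Suc.IH)
      fix i assume "i < length Ms"
      with Suc.prems(3)[OF this] Suc.prems(2) that j
      show "ys[j := x] ! i \<in> (if i < j then vspan (Ms ! i) (Ss ! i) else Ss ! i)"
        by (cases "i = j") (auto simp: less_Suc_eq)
    qed (use Suc.prems in auto)
    then have "vspan (Ms ! j) (Ss ! j) \<subseteq> {x \<in> carrier (Ms ! j). Q (ys[j := x])}"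
      using \<open>ys \<in> tuples Ms\<close> j Ss by (intro span_least vs sub) auto
    moreover have "ys ! j \<in> vspan (Ms ! j) (Ss ! j)" using Suc.prems(3)[OF j] by simp
    ultimately have "Q (ys[j := ys ! j])" by blast
    then show ?case by simp
  qed
  from this[of "length Ms" xs] show ?thesis using xs Ss by (auto simp: listset_iff)
qed

lemma multilin_span_subset:
  assumes m: "multilin Ms N m" and vs: "\<And>M. M \<in> set Ms \<Longrightarrow> vs M" and W: "subsp W N"
    and Ss: "length Ss = length Ms" "\<And>i. i < length Ms \<Longrightarrow> Ss ! i \<subseteq> carrier (Ms ! i)"
    and base: "\<And>xs. xs \<in> listset Ss \<Longrightarrow> m xs \<in> W"
    and xs: "xs \<in> listset (map2 vspan Ms Ss)"
  shows "m xs \<in> W"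
proof (rule slotwise_span_induct[where Q = "\<lambda>xs. m xs \<in> W", OF _ Ss _ base xs])
  show "subsp {x \<in> carrier (Ms ! i). m (xs[i := x]) \<in> W} (Ms ! i)"
    if "xs \<in> tuples Ms" "i < length Ms" for xs i
    using that vs by (intro subsp_vimage[OF multilin_slot[OF m] _ W]) auto
qed (use vs in auto)

lemma multilin_eq_on_span:
  assumes m: "multilin Ms N m" "multilin Ms N m'" and vs: "\<And>M. M \<in> set Ms \<Longrightarrow> vs M" "vs N"
    and Ss: "length Ss = length Ms" "\<And>i. i < length Ms \<Longrightarrow> Ss ! i \<subseteq> carrier (Ms ! i)"
    and base: "\<And>xs. xs \<in> listset Ss \<Longrightarrow> m xs = m' xs"
    and span: "\<And>i. i < length Ms \<Longrightarrow> carrier (Ms ! i) \<subseteq> vspan (Ms ! i) (Ss ! i)"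
    and xs: "xs \<in> tuples Ms"
  shows "m xs = m' xs"
proof (rule slotwise_span_induct[where Q = "\<lambda>xs. m xs = m' xs", OF _ Ss _ base])
  show "subsp {x \<in> carrier (Ms ! i). m (xs[i := x]) = m' (xs[i := x])} (Ms ! i)"
    if "xs \<in> tuples Ms" "i < length Ms" for xs i
    using that vs by (intro subsp_eq[OF multilin_slot[OF m(1)] multilin_slot[OF m(2)]]) auto
  have "xs ! i \<in> vspan (Ms ! i) (Ss ! i)" if "i < length Ms" for i
    using span[OF that] tuples_nth[OF xs that] by blast
  then show "xs \<in> listset (map2 vspan Ms Ss)" using xs Ss by (auto simp: listset_iff tuples_iff)
qed (use vs in auto)

text \<open>
  The relations are elements of the free space; that a linear map annihilates one of them is an
  equation between its values at the generators.
\<close>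

lemma lin_free_additive:
  assumes F: "F \<in> lin (free_vs X) N" "vs N" and "a \<in> X" "b \<in> X" "c \<in> X"
  shows "(\<lambda>z. single a z - single b z - single c z) \<in> carrier (free_vs X)"
    and "F (\<lambda>z. single a z - single b z - single c z) = \<zero>\<^bsub>N\<^esub>
          \<longleftrightarrow> F (single a) = F (single b) \<oplus>\<^bsub>N\<^esub> F (single c)"
proof -
  let ?F = "free_vs X" and ?s = "single b \<oplus>\<^bsub>free_vs X\<^esub> single c"
  have eq: "(\<lambda>z. single a z - single b z - single c z) = single a \<oplus>\<^bsub>?F\<^esub> (-1) \<odot>\<^bsub>?F\<^esub> ?s"
    by (simp add: algebra_simps)
  have s: "single a \<in> carrier ?F" "?s \<in> carrier ?F" "single b \<in> carrier ?F" "single c \<in> carrier ?F"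
    using assms by (auto simp del: free_vs_simps intro: vs_add free_vs_vs)
  show "(\<lambda>z. single a z - single b z - single c z) \<in> carrier (free_vs X)"
    unfolding eq using s by (intro vs_add vs_smult free_vs_vs)
  have cl: "F (single a) \<in> carrier N" "F (single b) \<oplus>\<^bsub>N\<^esub> F (single c) \<in> carrier N"
    using s lin_closed[OF F(1)] vs_add[OF F(2)] by blast+
  have "F (\<lambda>z. single a z - single b z - single c z)
      = F (single a) \<oplus>\<^bsub>N\<^esub> (-1) \<odot>\<^bsub>N\<^esub> (F (single b) \<oplus>\<^bsub>N\<^esub> F (single c))"
    unfolding eq lin_add[OF F(1) s(1) vs_smult[OF free_vs_vs s(2)]] lin_smult[OF F(1) s(2)]
      lin_add[OF F(1) s(3,4)] ..
  then show "F (\<lambda>z. single a z - single b z - single c z) = \<zero>\<^bsub>N\<^esub>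
          \<longleftrightarrow> F (single a) = F (single b) \<oplus>\<^bsub>N\<^esub> F (single c)"
    using vs_diff_zero[OF F(2) cl] vs_neg[OF F(2) cl(2)] by metis
qed

lemma lin_free_homogeneous:
  assumes F: "F \<in> lin (free_vs X) N" "vs N" and "a \<in> X" "b \<in> X"
  shows "(\<lambda>z. single a z - k * single b z) \<in> carrier (free_vs X)"
    and "F (\<lambda>z. single a z - k * single b z) = \<zero>\<^bsub>N\<^esub> \<longleftrightarrow> F (single a) = k \<odot>\<^bsub>N\<^esub> F (single b)"
proof -
  let ?F = "free_vs X" and ?s = "k \<odot>\<^bsub>free_vs X\<^esub> single b"
  have eq: "(\<lambda>z. single a z - k * single b z) = single a \<oplus>\<^bsub>?F\<^esub> (-1) \<odot>\<^bsub>?F\<^esub> ?s"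
    by (simp add: algebra_simps)
  have s: "single a \<in> carrier ?F" "?s \<in> carrier ?F" "single b \<in> carrier ?F"
    using assms by (auto simp del: free_vs_simps intro: vs_smult free_vs_vs)
  show "(\<lambda>z. single a z - k * single b z) \<in> carrier (free_vs X)"
    unfolding eq using s by (intro vs_add vs_smult free_vs_vs)
  have cl: "F (single a) \<in> carrier N" "k \<odot>\<^bsub>N\<^esub> F (single b) \<in> carrier N"
    using s lin_closed[OF F(1)] vs_smult[OF F(2)] by blast+
  have "F (\<lambda>z. single a z - k * single b z) = F (single a) \<oplus>\<^bsub>N\<^esub> (-1) \<odot>\<^bsub>N\<^esub> (k \<odot>\<^bsub>N\<^esub> F (single b))"
    unfolding eq lin_add[OF F(1) s(1) vs_smult[OF free_vs_vs s(2)]] lin_smult[OF F(1) s(2)]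
      lin_smult[OF F(1) s(3)] ..
  then show "F (\<lambda>z. single a z - k * single b z) = \<zero>\<^bsub>N\<^esub> \<longleftrightarrow> F (single a) = k \<odot>\<^bsub>N\<^esub> F (single b)"
    using vs_diff_zero[OF F(2) cl] vs_neg[OF F(2) cl(2)] by metis
qed

context
  fixes Ms :: "('k::field, 'v, 'm) module_scheme list"
  assumes vs: "\<And>M. M \<in> set Ms \<Longrightarrow> vs M"
begin

lemma tensor_relations_closed: "tensor_relations Ms \<subseteq> carrier (free_vs (tuples Ms))"
proof
  fix r assume "r \<in> tensor_relations Ms"
  then consider xs i x y where "r = (\<lambda>z. single (xs[i := x \<oplus>\<^bsub>Ms!i\<^esub> y]) z - single (xs[i := x]) z - single (xs[i := y]) z)"
      "xs \<in> tuples Ms" "i < length Ms" "x \<in> carrier (Ms!i)" "y \<in> carrier (Ms!i)"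
    | xs i a x where "r = (\<lambda>z. single (xs[i := a \<odot>\<^bsub>Ms!i\<^esub> x]) z - a * single (xs[i := x]) z)"
      "xs \<in> tuples Ms" "i < length Ms" "x \<in> carrier (Ms!i)"
    unfolding tensor_relations_def[folded tuples_def] by blast
  then show "r \<in> carrier (free_vs (tuples Ms))"
  proof cases
    case 1
    with vs show ?thesis
      unfolding 1(1) by (intro lin_free_additive(1)[OF lin_id free_vs_vs] tuples_update vs_add) auto
  next
    case 2
    with vs show ?thesis
      unfolding 2(1) by (intro lin_free_homogeneous(1)[OF lin_id free_vs_vs] tuples_update vs_smult) auto
  qed
qed

lemma tensor_presented: "tensor Ms = presented_vs (tuples Ms) (tensor_relations Ms)"
  by (simp only: tensor_def tensor_kernel_def tuples_def)

lemma pure_tensor_generator: "pure_tensor Ms = generator (tuples Ms) (tensor_relations Ms)"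
  by (rule ext) (simp only: pure_tensor_def tensor_kernel_def tuples_def)

text \<open>
  For the coset map \<open>F\<close> the left side holds, so that \<^const>\<open>pure_tensor\<close> is multilinear.  For the linear
  extension \<open>F\<close> of a multilinear map the right side holds, so that \<open>F\<close> descends to the tensor product.
\<close>

lemma null_relations_iff_multilin:
  assumes F: "F \<in> lin (free_vs (tuples Ms)) N" and N: "vs N"
  shows "(\<forall>r\<in>tensor_relations Ms. F r = \<zero>\<^bsub>N\<^esub>) \<longleftrightarrow> multilin Ms N (\<lambda>xs. F (single xs))"
proof
  assume null: "\<forall>r\<in>tensor_relations Ms. F r = \<zero>\<^bsub>N\<^esub>"
  show "multilin Ms N (\<lambda>xs. F (single xs))"
  proof (rule multilinI)
    fix xs i assume xs: "xs \<in> tuples Ms"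
    then show "F (single xs) \<in> carrier N" by (intro lin_closed[OF F] single_carrier)
    assume i: "i < length Ms"
    note up = tuples_update[OF xs i]
    have M: "vs (Ms ! i)" using vs i by simp
    show "(\<lambda>x. F (single (xs[i := x]))) \<in> lin (Ms ! i) N"
    proof (rule linI)
      fix x y a assume x: "x \<in> carrier (Ms ! i)"
      show "F (single (xs[i := x])) \<in> carrier N" using up[OF x] by (intro lin_closed[OF F] single_carrier)
      have "(\<lambda>z. single (xs[i := a \<odot>\<^bsub>Ms!i\<^esub> x]) z - a * single (xs[i := x]) z) \<in> tensor_relations Ms"
        using xs i x unfolding tensor_relations_def[folded tuples_def] by blast
      with null show "F (single (xs[i := a \<odot>\<^bsub>Ms!i\<^esub> x])) = a \<odot>\<^bsub>N\<^esub> F (single (xs[i := x]))"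
        using lin_free_homogeneous(2)[OF F N up[OF vs_smult[OF M x]] up[OF x]] by blast
      assume y: "y \<in> carrier (Ms ! i)"
      have "(\<lambda>z. single (xs[i := x \<oplus>\<^bsub>Ms!i\<^esub> y]) z - single (xs[i := x]) z - single (xs[i := y]) z)
          \<in> tensor_relations Ms"
        using xs i x y unfolding tensor_relations_def[folded tuples_def] by blast
      with null show "F (single (xs[i := x \<oplus>\<^bsub>Ms!i\<^esub> y]))
          = F (single (xs[i := x])) \<oplus>\<^bsub>N\<^esub> F (single (xs[i := y]))"
        using lin_free_additive(2)[OF F N up[OF vs_add[OF M x y]] up[OF x] up[OF y]] by blast
    qed
  qed
next
  assume m: "multilin Ms N (\<lambda>xs. F (single xs))"
  show "\<forall>r\<in>tensor_relations Ms. F r = \<zero>\<^bsub>N\<^esub>"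
  proof
    fix r assume "r \<in> tensor_relations Ms"
    then consider xs i x y where "r = (\<lambda>z. single (xs[i := x \<oplus>\<^bsub>Ms!i\<^esub> y]) z - single (xs[i := x]) z - single (xs[i := y]) z)"
        "xs \<in> tuples Ms" "i < length Ms" "x \<in> carrier (Ms!i)" "y \<in> carrier (Ms!i)"
      | xs i a x where "r = (\<lambda>z. single (xs[i := a \<odot>\<^bsub>Ms!i\<^esub> x]) z - a * single (xs[i := x]) z)"
        "xs \<in> tuples Ms" "i < length Ms" "x \<in> carrier (Ms!i)"
      unfolding tensor_relations_def[folded tuples_def] by blast
    then show "F r = \<zero>\<^bsub>N\<^esub>"
    proof cases
      case 1
      have M: "vs (Ms ! i)" using vs 1 by simp
      note up = tuples_update[OF 1(2,3)]
      show ?thesis unfolding 1(1)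
        using lin_free_additive(2)[OF F N up[OF vs_add[OF M 1(4,5)]] up[OF 1(4)] up[OF 1(5)]]
          lin_add[OF multilin_slot[OF m 1(2,3)] 1(4,5)] by blast
    next
      case 2
      have M: "vs (Ms ! i)" using vs 2 by simp
      note up = tuples_update[OF 2(2,3)]
      show ?thesis unfolding 2(1)
        using lin_free_homogeneous(2)[OF F N up[OF vs_smult[OF M 2(4)]] up[OF 2(4)]]
          lin_smult[OF multilin_slot[OF m 2(2,3)] 2(4)] by blast
    qed
  qed
qed

lemma tensor_vs: "vs (tensor Ms)"
  unfolding tensor_presented by (rule presented_vs_vs[OF tensor_relations_closed])

lemma pure_tensor_multilin: "multilin Ms (tensor Ms) (pure_tensor Ms)"
proof -
  have "subsp (vspan (free_vs (tuples Ms)) (tensor_relations Ms)) (free_vs (tuples Ms))"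
    by (rule subsp_span[OF free_vs_vs tensor_relations_closed])
  from null_relations_iff_multilin[OF coset_lin[OF this] quotient_vs_vs[OF this]]
  show ?thesis
    unfolding tensor_presented pure_tensor_generator
    using relation_null[OF tensor_relations_closed] by blast
qed

lemma pure_tensor_closed: "xs \<in> tuples Ms \<Longrightarrow> pure_tensor Ms xs \<in> carrier (tensor Ms)"
  by (rule multilin_closed[OF pure_tensor_multilin])

lemma multilin_pure_tensor: "f \<in> lin (tensor Ms) N \<Longrightarrow> multilin Ms N (\<lambda>xs. f (pure_tensor Ms xs))"
  by (rule multilin_comp_lin[OF pure_tensor_multilin])

lemma tensor_maps_eqI:
  assumes "f \<in> linear_maps (tensor Ms) N" "g \<in> linear_maps (tensor Ms) N" "vs N"
    "\<And>xs. xs \<in> tuples Ms \<Longrightarrow> f (pure_tensor Ms xs) = g (pure_tensor Ms xs)"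
  shows "f = g"
  using assms unfolding tensor_presented pure_tensor_generator
  by (rule presented_vs_unique[OF tensor_relations_closed])

lemma
  assumes m: "multilin Ms N m" and N: "vs N"
  shows tensor_map_linear: "tensor_map Ms N m \<in> linear_maps (tensor Ms) N"
    and tensor_map_pure: "xs \<in> tuples Ms \<Longrightarrow> tensor_map Ms N m (pure_tensor Ms xs) = m xs"
proof -
  have ex: "\<exists>!h. h \<in> linear_maps (tensor Ms) N \<and> (\<forall>xs\<in>tuples Ms. h (pure_tensor Ms xs) = m xs)"
    unfolding tensor_presented pure_tensor_generator
  proof (rule presented_vs_ext[OF tensor_relations_closed N])
    show cl: "\<And>xs. xs \<in> tuples Ms \<Longrightarrow> m xs \<in> carrier N" by (rule multilin_closed[OF m])
    have "multilin Ms N (\<lambda>xs. free_ext N m (single xs))"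
      using free_ext_single[where X = "tuples Ms", OF N cl]
      by (intro multilin_cong[OF m _ vs]) simp_all
    moreover have "free_ext N m \<in> lin (free_vs (tuples Ms)) N" using cl by (rule free_ext_lin[OF N])
    ultimately show "\<And>r. r \<in> tensor_relations Ms \<Longrightarrow> free_ext N m r = \<zero>\<^bsub>N\<^esub>"
      using null_relations_iff_multilin[OF _ N] by blast
  qed
  from theI'[OF this] show "tensor_map Ms N m \<in> linear_maps (tensor Ms) N"
    "xs \<in> tuples Ms \<Longrightarrow> tensor_map Ms N m (pure_tensor Ms xs) = m xs"
    unfolding tensor_map_def tuples_def by blast+
qed

end

section \<open>The operad structure of multilinear maps\<close>

lemma blocks_concat: "blocks (map length xss) (concat xss) = xss"
  by (induction xss) auto

lemma tuples_concat:
  assumes "xs \<in> tuples (concat Mss)"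
  obtains xss where "xs = concat xss" "map length xss = map length Mss"
    "\<And>i. i < length Mss \<Longrightarrow> xss ! i \<in> tuples (Mss ! i)"
proof -
  have "\<exists>xss. xs = concat xss \<and> list_all2 (\<lambda>ys Ms. ys \<in> tuples Ms) xss Mss"
    using assms
  proof (induction Mss arbitrary: xs)
    case (Cons Ms Mss)
    let ?n = "length Ms"
    have len: "length xs = ?n + length (concat Mss)" using Cons.prems by (simp add: tuples_iff)
    have "take ?n xs \<in> tuples Ms"
      unfolding tuples_iff
    proof (intro conjI allI impI)
      fix i assume "i < ?n"
      then show "take ?n xs ! i \<in> carrier (Ms ! i)"
        using tuples_nth[OF Cons.prems, of i] by (simp add: nth_append)
    qed (use len in simp)
    moreover have "drop ?n xs \<in> tuples (concat Mss)"
      unfolding tuples_iff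
    proof (intro conjI allI impI)
      fix i assume "i < length (concat Mss)"
      then show "drop ?n xs ! i \<in> carrier (concat Mss ! i)"
        using tuples_nth[OF Cons.prems, of "?n + i"] len by (simp add: nth_append)
    qed (use len in simp)
    with Cons.IH obtain xss where "drop ?n xs = concat xss" "list_all2 (\<lambda>ys Ms. ys \<in> tuples Ms) xss Mss"
      by blast
    ultimately have "xs = concat (take ?n xs # xss) \<and> list_all2 (\<lambda>ys Ms. ys \<in> tuples Ms) (take ?n xs # xss) (Ms # Mss)"
      by (metis append_take_drop_id concat.simps(2) list_all2_Cons)
    then show ?case by blast
  qed (auto simp: tuples_iff)
  then obtain xss where xss: "xs = concat xss" "list_all2 (\<lambda>ys Ms. ys \<in> tuples Ms) xss Mss" by blast
  show ?thesis
  proof (rule that[OF xss(1)])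
    show "map length xss = map length Mss"
      using xss(2) by (intro nth_equalityI) (auto simp: list_all2_conv_all_nth tuples_iff)
    show "\<And>i. i < length Mss \<Longrightarrow> xss ! i \<in> tuples (Mss ! i)"
      using xss(2) by (auto simp: list_all2_conv_all_nth)
  qed
qed

lemma concat_in_tuples:
  assumes "length xss = length Mss" "\<And>i. i < length Mss \<Longrightarrow> xss ! i \<in> tuples (Mss ! i)"
  shows "concat xss \<in> tuples (concat Mss)"
  using assms
proof (induction xss Mss rule: list_induct2)
  case (Cons ys xss Ms Mss)
  have "concat xss \<in> tuples (concat Mss)" using Cons.prems by (intro Cons.IH) force
  moreover have "ys \<in> tuples Ms" using Cons.prems[of 0] by simp
  ultimately show ?case by (auto simp: tuples_iff nth_append)
qed (auto simp: tuples_iff)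

text \<open>
  An update of a concatenation takes place inside one block.  The second list has the same shape: it
  will be the list of the spaces that contain the entries, and its entry at the same place is the
  domain of the slot.
\<close>

lemma concat_update:
  assumes "map length xss = map length yss" "i < length (concat xss)"
  shows "\<exists>a b. a < length xss \<and> b < length (xss ! a) \<and> concat yss ! i = yss ! a ! b \<and>
    (\<forall>x. (concat xss)[i := x] = concat (xss[a := (xss ! a)[b := x]]))"
proof -
  have "length xss = length yss" using assms(1) map_eq_imp_length_eq by blast
  then show ?thesis using assms
  proof (induction xss yss arbitrary: i rule: list_induct2)
    case (Cons xs xss ys yss)
    show ?case
    proof (cases "i < length xs")
      case True
      with Cons.prems show ?thesis
        by (intro exI[of _ 0] exI[of _ i]) (auto simp: nth_append list_update_append)
    next
      case False
      with Cons.prems Cons.IH[of "i - length xs"] obtain a b where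
        "a < length xss" "b < length (xss ! a)" "concat yss ! (i - length xs) = yss ! a ! b"
        "\<forall>x. (concat xss)[i - length xs := x] = concat (xss[a := (xss ! a)[b := x]])"
        by fastforce
      with False Cons.prems show ?thesis
        by (intro exI[of _ "Suc a"] exI[of _ b]) (auto simp: nth_append list_update_append)
    qed
  qed auto
qed

text \<open>
  An entry of the concatenated list occurs in one block only, say the \<open>a\<close>-th one.  As a function of this
  entry the composite is a slot of \<open>f a\<close> followed by the \<open>a\<close>-th slot of \<open>m\<close>.
\<close>

lemma multilin_compose:
  assumes m: "multilin Ns P m" and len: "length Mss = length Ns"
    and f: "\<And>i. i < length Ns \<Longrightarrow> multilin (Mss ! i) (Ns ! i) (f i)"
  shows "multilin (concat Mss) P
    (\<lambda>xs. m (map (\<lambda>i. f i (blocks (map length Mss) xs ! i)) [0..<length Ns]))"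
proof (rule multilinI)
  fix xs i assume "xs \<in> tuples (concat Mss)"
  then obtain xss where xs: "xs = concat xss" and lens: "map length xss = map length Mss"
    and xss: "\<And>i. i < length Mss \<Longrightarrow> xss ! i \<in> tuples (Mss ! i)" by (rule tuples_concat) blast
  let ?ys = "map (\<lambda>i. f i (xss ! i)) [0..<length Ns]"
  have lenx: "length xss = length Ns" using lens len map_eq_imp_length_eq by metis
  have bl: "blocks (map length Mss) xs = xss" unfolding xs lens[symmetric] by (rule blocks_concat)
  have ys: "?ys \<in> tuples Ns"
    using multilin_closed[OF f] xss len by (auto simp: tuples_iff)
  show "m (map (\<lambda>i. f i (blocks (map length Mss) xs ! i)) [0..<length Ns]) \<in> carrier P"
    unfolding bl by (rule multilin_closed[OF m ys])
  assume "i < length (concat Mss)"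
  then have "i < length (concat xss)" using lens by (simp add: length_concat)
  from concat_update[OF lens this] obtain a b where
    a: "a < length xss" "b < length (xss ! a)" "concat Mss ! i = Mss ! a ! b"
    and up: "\<And>x. (concat xss)[i := x] = concat (xss[a := (xss ! a)[b := x]])" by blast
  have lena: "length (xss ! a) = length (Mss ! a)" using xss[of a] a len lenx by (simp add: tuples_iff)
  have "map length (xss[a := (xss ! a)[b := x]]) = map length xss" for x
    using a(1) by (intro nth_equalityI) (auto simp: nth_list_update)
  then have bl': "blocks (map length Mss) (xs[i := x]) = xss[a := (xss ! a)[b := x]]" for x
    unfolding xs up by (metis blocks_concat lens)
  have eq: "map (\<lambda>j. f j (blocks (map length Mss) (xs[i := x]) ! j)) [0..<length Ns]
      = ?ys[a := f a ((xss ! a)[b := x])]" for x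
    unfolding bl' using a lenx by (intro nth_equalityI) (auto simp: nth_list_update)
  have "(\<lambda>x. f a ((xss ! a)[b := x])) \<in> lin (concat Mss ! i) (Ns ! a)"
    unfolding a(3) using a len lenx lena xss by (intro multilin_slot[OF f]) auto
  moreover have "(\<lambda>y. m (?ys[a := y])) \<in> lin (Ns ! a) P"
    using a lenx by (intro multilin_slot[OF m ys]) simp
  ultimately show "(\<lambda>x. m (map (\<lambda>j. f j (blocks (map length Mss) (xs[i := x]) ! j)) [0..<length Ns]))
      \<in> lin (concat Mss ! i) P"
    unfolding eq by (rule lin_comp)
qed

text \<open>
  Slot \<open>i\<close> of the permuted map is slot \<open>\<sigma> i\<close> of \<open>m\<close>.
\<close>

lemma multilin_permute:
  assumes m: "multilin Ms N m" and \<sigma>: "\<sigma> permutes {..<length Ms}"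
  shows "multilin (permute_list \<sigma> Ms) N (\<lambda>xs. m (permute_list (inv_into UNIV \<sigma>) xs))"
proof (rule multilinI)
  fix xs i assume xs: "xs \<in> tuples (permute_list \<sigma> Ms)"
  have inv: "inv_into UNIV \<sigma> permutes {..<length Ms}" using \<sigma> by (rule permutes_inv)
  have len: "length xs = length Ms" using xs by (simp add: tuples_iff)
  have lt: "inv_into UNIV \<sigma> j < length Ms" if "j < length Ms" for j
    using permutes_in_image[OF inv, of j] that by simp
  have "xs ! inv_into UNIV \<sigma> j \<in> carrier (Ms ! j)" if "j < length Ms" for j
    using tuples_nth[OF xs, of "inv_into UNIV \<sigma> j"] lt[OF that] that \<sigma>
    by (simp add: permute_list_nth permutes_inverses)
  then have ys: "permute_list (inv_into UNIV \<sigma>) xs \<in> tuples Ms"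
    using len inv by (simp add: tuples_iff permute_list_nth)
  then show "m (permute_list (inv_into UNIV \<sigma>) xs) \<in> carrier N" by (rule multilin_closed[OF m])
  assume i: "i < length (permute_list \<sigma> Ms)"
  then have \<sigma>i: "\<sigma> i < length Ms" using permutes_in_image[OF \<sigma>, of i] by simp
  have "permute_list (inv_into UNIV \<sigma>) (xs[i := x]) = (permute_list (inv_into UNIV \<sigma>) xs)[\<sigma> i := x]" for x
  proof (rule nth_equalityI)
    fix j assume "j < length (permute_list (inv_into UNIV \<sigma>) (xs[i := x]))"
    then have j: "j < length Ms" using len by simp
    have "inv_into UNIV \<sigma> j = i \<longleftrightarrow> j = \<sigma> i" using permutes_inverses[OF \<sigma>] by metis
    then show "permute_list (inv_into UNIV \<sigma>) (xs[i := x]) ! j = (permute_list (inv_into UNIV \<sigma>) xs)[\<sigma> i := x] ! j"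
      using j lt[OF j] len inv i by (auto simp: permute_list_nth nth_list_update)
  qed simp
  moreover have "permute_list \<sigma> Ms ! i = Ms ! \<sigma> i" using i \<sigma> by (simp add: permute_list_nth)
  ultimately show "(\<lambda>x. m (permute_list (inv_into UNIV \<sigma>) (xs[i := x]))) \<in> lin (permute_list \<sigma> Ms ! i) N"
    using multilin_slot[OF m ys \<sigma>i] by simp
qed

lemma
  assumes M: "vs M"
  shows multi_id_linear: "multi_id M \<in> linear_maps (tensor [M]) M"
    and multi_id_pure: "x \<in> carrier M \<Longrightarrow> multi_id M (pure_tensor [M] [x]) = x"
proof -
  have m: "multilin [M] M hd"
  proof (rule multilinI)
    fix xs i assume xs: "xs \<in> tuples [M]"
    then obtain x where x: "xs = [x]" "x \<in> carrier M" by (auto simp: tuples_def set_Cons_def)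
    then show "hd xs \<in> carrier M" by simp
    assume "i < length [M]"
    with x show "(\<lambda>x. hd (xs[i := x])) \<in> lin ([M] ! i) M" by (simp add: lin_id)
  qed
  show "multi_id M \<in> linear_maps (tensor [M]) M"
    unfolding multi_id_def using M m by (intro tensor_map_linear) auto
  show "multi_id M (pure_tensor [M] [x]) = x" if "x \<in> carrier M"
  proof -
    have "[x] \<in> tuples [M]" using that by (simp add: tuples_iff)
    with tensor_map_pure[of "[M]", OF _ m M this] M show ?thesis by (simp add: multi_id_def)
  qed
qed

text \<open>
  Every tuple for the concatenated spaces is a concatenation (\<open>tuples_concat\<close>), and on concatenations
  composites are evaluated without \<^const>\<open>blocks\<close>.
\<close>

lemma
  assumes vs: "\<And>Ms M. \<lbrakk>Ms \<in> set Mss; M \<in> set Ms\<rbrakk> \<Longrightarrow> vs M" "\<And>N. N \<in> set Ns \<Longrightarrow> vs N" "vs P"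
    and len: "length Mss = length Ns"
    and g: "g \<in> lin (tensor Ns) P"
    and fs: "\<And>i. i < length Ns \<Longrightarrow> fs ! i \<in> lin (tensor (Mss ! i)) (Ns ! i)"
  shows multi_comp_linear: "multi_comp Mss Ns P g fs \<in> linear_maps (tensor (concat Mss)) P"
    and multi_comp_pure:
      "\<lbrakk>length xss = length Ns; \<And>i. i < length Ns \<Longrightarrow> xss ! i \<in> tuples (Mss ! i)\<rbrakk>
        \<Longrightarrow> multi_comp Mss Ns P g fs (pure_tensor (concat Mss) (concat xss)) =
            g (pure_tensor Ns (map (\<lambda>i. (fs ! i) (pure_tensor (Mss ! i) (xss ! i))) [0..<length Ns]))"
proof -
  have vs': "vs M" if "M \<in> set (concat Mss)" for M using that vs(1) by auto
  have "multilin (Mss ! i) (Ns ! i) (\<lambda>xs. (fs ! i) (pure_tensor (Mss ! i) xs))" if "i < length Ns" for i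
    using fs[OF that] that len by (intro multilin_pure_tensor vs(1)[of "Mss ! i"]) auto
  from multilin_compose[OF multilin_pure_tensor[OF vs(2) g] len this]
  have m: "multilin (concat Mss) P (\<lambda>xs. g (pure_tensor Ns
          (map (\<lambda>i. (fs ! i) (pure_tensor (Mss ! i) (blocks (map length Mss) xs ! i))) [0..<length Ns])))" .
  show "multi_comp Mss Ns P g fs \<in> linear_maps (tensor (concat Mss)) P"
    unfolding multi_comp_def by (rule tensor_map_linear[OF vs' m vs(3)])
  assume xss: "length xss = length Ns" "\<And>i. i < length Ns \<Longrightarrow> xss ! i \<in> tuples (Mss ! i)"
  have "map length Mss = map length xss"
    using xss len by (intro nth_equalityI) (auto simp: tuples_iff)
  then have "blocks (map length Mss) (concat xss) = xss" by (simp add: blocks_concat)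
  moreover have "concat xss \<in> tuples (concat Mss)" using xss len by (intro concat_in_tuples) auto
  ultimately show "multi_comp Mss Ns P g fs (pure_tensor (concat Mss) (concat xss)) =
            g (pure_tensor Ns (map (\<lambda>i. (fs ! i) (pure_tensor (Mss ! i) (xss ! i))) [0..<length Ns]))"
    unfolding multi_comp_def using tensor_map_pure[OF vs' m vs(3)] by (simp only:)
qed

lemma
  assumes vs: "\<And>M. M \<in> set Ms \<Longrightarrow> vs M" "vs N" and \<sigma>: "\<sigma> permutes {..<length Ms}"
    and f: "f \<in> lin (tensor Ms) N"
  shows multi_act_linear: "multi_act Ms N \<sigma> f \<in> linear_maps (tensor (permute_list \<sigma> Ms)) N"
    and multi_act_pure: "xs \<in> tuples (permute_list \<sigma> Ms)
        \<Longrightarrow> multi_act Ms N \<sigma> f (pure_tensor (permute_list \<sigma> Ms) xs) =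
            f (pure_tensor Ms (permute_list (inv_into UNIV \<sigma>) xs))"
proof -
  have vs': "vs M" if "M \<in> set (permute_list \<sigma> Ms)" for M using that vs(1) \<sigma> by simp
  note m = multilin_permute[OF multilin_pure_tensor[OF vs(1) f] \<sigma>]
  show "multi_act Ms N \<sigma> f \<in> linear_maps (tensor (permute_list \<sigma> Ms)) N"
    unfolding multi_act_def by (rule tensor_map_linear[OF vs' m vs(2)])
  show "multi_act Ms N \<sigma> f (pure_tensor (permute_list \<sigma> Ms) xs) =
            f (pure_tensor Ms (permute_list (inv_into UNIV \<sigma>) xs))" if "xs \<in> tuples (permute_list \<sigma> Ms)"
    unfolding multi_act_def by (rule tensor_map_pure[OF vs' m vs(2) that])
qed

text \<open>
  The components of an isomorphism of algebras are unary operations, and its naturality is an equation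
  between composites with them.
\<close>

lemma multi_comp_unary_pure:
  assumes vs: "\<And>M. M \<in> set Ms \<Longrightarrow> vs M" "vs N" "vs P"
    and g: "g \<in> lin (tensor [N]) P" and f: "f \<in> lin (tensor Ms) N" and xs: "xs \<in> tuples Ms"
  shows "multi_comp [Ms] [N] P g [f] (pure_tensor Ms xs) = g (pure_tensor [N] [f (pure_tensor Ms xs)])"
  using multi_comp_pure[of "[Ms]" "[N]" P g "[f]" "[xs]"] assms by auto

lemma multi_comp_unary_linear:
  assumes "\<And>M. M \<in> set Ms \<Longrightarrow> vs M" "vs N" "vs P" "g \<in> lin (tensor [N]) P" "f \<in> lin (tensor Ms) N"
  shows "multi_comp [Ms] [N] P g [f] \<in> linear_maps (tensor Ms) P"
  using multi_comp_linear[of "[Ms]" "[N]" P g "[f]"] assms by auto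

lemma
  assumes vs: "\<And>c. c \<in> set cs \<Longrightarrow> vs (M c)" "\<And>c. c \<in> set cs \<Longrightarrow> vs (N c)" "vs P"
    and g: "g \<in> lin (tensor (map N cs)) P"
    and \<phi>: "\<And>c. c \<in> set cs \<Longrightarrow> \<phi> c \<in> lin (tensor [M c]) (N c)"
  shows multi_comp_unaries_linear: "multi_comp (map (\<lambda>c. [M c]) cs) (map N cs) P g (map \<phi> cs)
      \<in> linear_maps (tensor (map M cs)) P"
    and multi_comp_unaries: "xs \<in> tuples (map M cs) \<Longrightarrow>
      multi_comp (map (\<lambda>c. [M c]) cs) (map N cs) P g (map \<phi> cs) (pure_tensor (map M cs) xs)
      = g (pure_tensor (map N cs) (map2 (\<lambda>c x. \<phi> c (pure_tensor [M c] [x])) cs xs))"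
proof -
  have c: "concat (map (\<lambda>c. [M c]) cs) = map M cs" by (induction cs) auto
  have vsM: "\<And>Ms M'. \<lbrakk>Ms \<in> set (map (\<lambda>c. [M c]) cs); M' \<in> set Ms\<rbrakk> \<Longrightarrow> vs M'" using vs(1) by auto
  have vsN: "\<And>N'. N' \<in> set (map N cs) \<Longrightarrow> vs N'" using vs(2) by auto
  have \<phi>s: "map \<phi> cs ! i \<in> lin (tensor (map (\<lambda>c. [M c]) cs ! i)) (map N cs ! i)" if "i < length (map N cs)" for i
    using \<phi>[of "cs ! i"] that by simp
  have len: "length (map (\<lambda>c. [M c]) cs) = length (map N cs)" by simp
  show "multi_comp (map (\<lambda>c. [M c]) cs) (map N cs) P g (map \<phi> cs) \<in> linear_maps (tensor (map M cs)) P"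
    unfolding c[symmetric] by (rule multi_comp_linear[OF vsM vsN vs(3) len g \<phi>s]) assumption+
  assume xs: "xs \<in> tuples (map M cs)"
  then have xsi: "length xs = length cs" "\<And>i. i < length cs \<Longrightarrow> xs ! i \<in> carrier (M (cs ! i))"
    by (simp_all add: tuples_iff)
  have x: "concat (map (\<lambda>x. [x]) xs) = xs" by (induction xs) auto
  have lenx: "length (map (\<lambda>x. [x]) xs) = length (map N cs)" using xsi by simp
  have tup: "map (\<lambda>x. [x]) xs ! i \<in> tuples (map (\<lambda>c. [M c]) cs ! i)" if "i < length (map N cs)" for i
    using that xsi by (simp add: tuples_iff)
  have "multi_comp (map (\<lambda>c. [M c]) cs) (map N cs) P g (map \<phi> cs)
      (pure_tensor (concat (map (\<lambda>c. [M c]) cs)) (concat (map (\<lambda>x. [x]) xs)))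
    = g (pure_tensor (map N cs) (map (\<lambda>i. (map \<phi> cs ! i)
        (pure_tensor (map (\<lambda>c. [M c]) cs ! i) (map (\<lambda>x. [x]) xs ! i))) [0..<length (map N cs)]))"
    by (rule multi_comp_pure[OF vsM vsN vs(3) len g \<phi>s lenx tup]) assumption+
  also have "map (\<lambda>i. (map \<phi> cs ! i)
        (pure_tensor (map (\<lambda>c. [M c]) cs ! i) (map (\<lambda>x. [x]) xs ! i))) [0..<length (map N cs)]
      = map2 (\<lambda>c x. \<phi> c (pure_tensor [M c] [x])) cs xs"
    using xsi by (intro nth_equalityI) auto
  finally show "multi_comp (map (\<lambda>c. [M c]) cs) (map N cs) P g (map \<phi> cs) (pure_tensor (map M cs) xs)
      = g (pure_tensor (map N cs) (map2 (\<lambda>c x. \<phi> c (pure_tensor [M c] [x])) cs xs))"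
    unfolding c x .
qed

text \<open>
  The tensor product and the operations on multilinear maps only depend on the underlying modules, so
  they do not see a filtration or a grading.  Hence the operations of a filtered algebra may be used
  unchanged when gradings are put on its spaces, and compared with those of a graded algebra.
\<close>

lemma truncate_simps [simp]:
  "carrier (module.truncate M) = carrier M" "add (module.truncate M) = add M"
  "smult (module.truncate M) = smult M"
  by (simp_all add: module.truncate_def)

lemma truncate_map_eq:
  fixes Ms :: "('k::field, 'v, 'm) module_scheme list" and Ms' :: "('k, 'v, 'n) module_scheme list"
  assumes "map module.truncate Ms = map module.truncate Ms'"
  shows "length Ms = length Ms'" "map carrier Ms = map carrier Ms'"
    "i < length Ms \<Longrightarrow> add (Ms ! i) = add (Ms' ! i)" "i < length Ms \<Longrightarrow> smult (Ms ! i) = smult (Ms' ! i)"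
    "i < length Ms \<Longrightarrow> carrier (Ms ! i) = carrier (Ms' ! i)"
proof -
  show len: "length Ms = length Ms'" using assms map_eq_imp_length_eq by blast
  have "map carrier (map module.truncate Ms) = map carrier (map module.truncate Ms')"
    using assms by simp
  then show "map carrier Ms = map carrier Ms'" by (simp add: comp_def)
  have eq: "module.truncate (Ms ! i) = module.truncate (Ms' ! i)" if "i < length Ms" for i
    using assms len that nth_map by metis
  show "i < length Ms \<Longrightarrow> add (Ms ! i) = add (Ms' ! i)" "i < length Ms \<Longrightarrow> smult (Ms ! i) = smult (Ms' ! i)"
    "i < length Ms \<Longrightarrow> carrier (Ms ! i) = carrier (Ms' ! i)"
    using arg_cong[OF eq, of i add] arg_cong[OF eq, of i smult] arg_cong[OF eq, of i carrier] by simp_all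
qed

context
  fixes Ms :: "('k::field, 'v, 'm) module_scheme list" and Ms' :: "('k, 'v, 'n) module_scheme list"
  assumes eq: "map module.truncate Ms = map module.truncate Ms'"
begin

lemma tensor_relations_truncate: "tensor_relations Ms = tensor_relations Ms'"
  unfolding tensor_relations_def
  by (rule arg_cong2[where f = "(\<union>)"]; (intro Collect_cong ex_cong1)?)
    (use truncate_map_eq[OF eq] in auto)

lemma tensor_truncate: "tensor Ms = tensor Ms'"
  by (simp add: tensor_def tensor_kernel_def tensor_relations_truncate truncate_map_eq(2)[OF eq] tuples_def)

lemma pure_tensor_truncate: "pure_tensor Ms = pure_tensor Ms'"
  by (rule ext) (simp add: pure_tensor_def tensor_kernel_def tensor_relations_truncate truncate_map_eq(2)[OF eq] tuples_def)

end

lemma linear_maps_truncate: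
  assumes "module.truncate M = module.truncate M'" "module.truncate N = module.truncate N'"
  shows "linear_maps M N = linear_maps M' N'"
proof -
  have "carrier M = carrier M'" "add M = add M'" "smult M = smult M'"
    "carrier N = carrier N'" "add N = add N'" "smult N = smult N'"
    using assms by (metis truncate_simps)+
  then show ?thesis by (simp add: linear_maps_def LinearCombinations.module_hom_def)
qed

lemma tensor_map_truncate:
  assumes "map module.truncate Ms = map module.truncate Ms'" "module.truncate N = module.truncate N'"
  shows "tensor_map Ms N m = tensor_map Ms' N' m"
  unfolding tensor_map_def tensor_truncate[OF assms(1)] pure_tensor_truncate[OF assms(1)]
    truncate_map_eq(2)[OF assms(1)]
    linear_maps_truncate[OF refl[of "module.truncate (tensor Ms')"] assms(2)] ..

lemma multi_id_truncate:
  assumes "module.truncate M = module.truncate M'"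
  shows "multi_id M = multi_id M'"
  unfolding multi_id_def by (rule tensor_map_truncate) (use assms in simp_all)

lemma multi_act_truncate:
  assumes "map module.truncate Ms = map module.truncate Ms'" "module.truncate N = module.truncate N'"
    "\<sigma> permutes {..<length Ms}"
  shows "multi_act Ms N \<sigma> f = multi_act Ms' N' \<sigma> f"
proof -
  have "length Ms = length Ms'" using truncate_map_eq(1)[OF assms(1)] .
  then have "map module.truncate (permute_list \<sigma> Ms) = map module.truncate (permute_list \<sigma> Ms')"
    using assms by (simp flip: permute_list_map)
  from tensor_map_truncate[OF this assms(2)] show ?thesis
    by (simp add: multi_act_def pure_tensor_truncate[OF assms(1)])
qed

lemma multi_comp_truncate:
  assumes "map (map module.truncate) Mss = map (map module.truncate) Mss'"
    "map module.truncate Ns = map module.truncate Ns'" "module.truncate P = module.truncate P'"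
    "length Mss = length Ns"
  shows "multi_comp Mss Ns P g fs = multi_comp Mss' Ns' P' g fs"
proof -
  have len: "length Mss = length Mss'" using assms(1) map_eq_imp_length_eq by blast
  have eq: "map module.truncate (Mss ! i) = map module.truncate (Mss' ! i)" if "i < length Mss" for i
    using assms(1) len that nth_map by metis
  have "map length (map (map module.truncate) Mss) = map length (map (map module.truncate) Mss')"
    using assms(1) by simp
  then have lens: "map length Mss = map length Mss'" by (simp add: comp_def)
  have "map module.truncate (concat Mss) = map module.truncate (concat Mss')"
    using assms(1) by (simp add: map_concat)
  from tensor_map_truncate[OF this assms(3)]
  have "multi_comp Mss Ns P g fs = tensor_map (concat Mss') P' (\<lambda>xs. g (pure_tensor Ns
          (map (\<lambda>i. (fs ! i) (pure_tensor (Mss ! i) (blocks (map length Mss) xs ! i))) [0..<length Ns])))"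
    by (simp add: multi_comp_def)
  also have "(\<lambda>xs. map (\<lambda>i. (fs ! i) (pure_tensor (Mss ! i) (blocks (map length Mss) xs ! i))) [0..<length Ns])
      = (\<lambda>xs. map (\<lambda>i. (fs ! i) (pure_tensor (Mss' ! i) (blocks (map length Mss) xs ! i))) [0..<length Ns])"
    using pure_tensor_truncate[OF eq] assms(4) by (intro ext map_cong refl) auto
  finally show ?thesis
    by (simp add: multi_comp_def lens truncate_map_eq(1)[OF assms(2)] pure_tensor_truncate[OF assms(2)])
qed

section \<open>Leibniz sums\<close>

text \<open>
  The right-hand side of the Leibniz rule for the operation \<open>m\<close>, where \<open>D i\<close> is the derivation on the
  space that contains the \<open>i\<close>-th argument.
\<close>

definition leibniz ::
  "('k::field, 'w, 'n) module_scheme \<Rightarrow> ('v list \<Rightarrow> 'w) \<Rightarrow> (nat \<Rightarrow> 'v \<Rightarrow> 'v) \<Rightarrow> 'v list \<Rightarrow> 'w" where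
  "leibniz N m D xs = finsum N (\<lambda>i. m (xs[i := D i (xs ! i)])) {..<length xs}"

lemma multilin_at_slot:
  assumes m: "multilin Ms N m" and vs: "\<And>M. M \<in> set Ms \<Longrightarrow> vs M"
    and f: "f \<in> lin (Ms ! i) (Ms ! i)" and i: "i < length Ms"
  shows "multilin Ms N (\<lambda>xs. m (xs[i := f (xs ! i)]))"
proof -
  have "multilin Ms N (\<lambda>xs. m (map (\<lambda>j. (if j = i then f else (\<lambda>x. x)) (xs ! j)) [0..<length Ms]))"
    by (rule multilin_precomp[OF m refl]) (use f lin_id in auto)
  then show ?thesis
  proof (rule multilin_cong[OF _ _ vs])
    fix xs assume "xs \<in> tuples Ms"
    then have "map (\<lambda>j. (if j = i then f else (\<lambda>x. x)) (xs ! j)) [0..<length Ms] = xs[i := f (xs ! i)]"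
      using i by (intro nth_equalityI) (auto simp: tuples_iff nth_list_update)
    then show "m (map (\<lambda>j. (if j = i then f else (\<lambda>x. x)) (xs ! j)) [0..<length Ms]) = m (xs[i := f (xs ! i)])"
      by (rule arg_cong)
  qed
qed

lemma multilin_leibniz:
  assumes m: "multilin Ms N m" and vs: "\<And>M. M \<in> set Ms \<Longrightarrow> vs M" "vs N"
    and D: "\<And>i. i < length Ms \<Longrightarrow> D i \<in> lin (Ms ! i) (Ms ! i)"
  shows "multilin Ms N (leibniz N m D)"
proof -
  have "multilin Ms N (\<lambda>xs. finsum N (\<lambda>i. m (xs[i := D i (xs ! i)])) {..<length Ms})"
    by (intro multilin_sum multilin_at_slot m vs D) auto
  then show ?thesis by (rule multilin_cong) (auto simp: leibniz_def tuples_iff vs)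
qed

lemma finsum_smult_vs:
  assumes N: "vs N" and "finite I" and v: "v \<in> carrier N"
  shows "finsum N (\<lambda>i. a i \<odot>\<^bsub>N\<^esub> v) I = (\<Sum>i\<in>I. a i) \<odot>\<^bsub>N\<^esub> v"
  using \<open>finite I\<close>
proof (induction I rule: finite_induct)
  case empty
  then show ?case using N v by (simp add: finsum_empty_vs)
next
  case (insert j I)
  then show ?case using N v finsum_insert_vs[OF N insert.hyps, of "\<lambda>i. a i \<odot>\<^bsub>N\<^esub> v"]
    by (simp add: vs_l_distr)
qed

text \<open>
  On eigenvectors every summand is a multiple of \<open>m xs\<close>, and the eigenvalues add up.  This is why
  derivations produce gradings that are compatible with operations.
\<close>

lemma leibniz_eigen:
  assumes m: "multilin Ms N m" and N: "vs N" and xs: "xs \<in> tuples Ms"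
    and D: "\<And>i. i < length Ms \<Longrightarrow> D i (xs ! i) = a i \<odot>\<^bsub>Ms ! i\<^esub> (xs ! i)"
  shows "leibniz N m D xs = (\<Sum>i<length Ms. a i) \<odot>\<^bsub>N\<^esub> m xs"
proof -
  have eq: "m (xs[i := D i (xs ! i)]) = a i \<odot>\<^bsub>N\<^esub> m xs" if "i < length Ms" for i
    using lin_smult[OF multilin_slot[OF m xs that] tuples_nth[OF xs that]] D[OF that] by simp
  have mxs: "m xs \<in> carrier N" by (rule multilin_closed[OF m xs])
  have "leibniz N m D xs = finsum N (\<lambda>i. a i \<odot>\<^bsub>N\<^esub> m xs) {..<length Ms}"
    unfolding leibniz_def
    by (rule finsum_cong_vs[OF N]) (use xs eq mxs N in \<open>auto simp: tuples_iff\<close>)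
  also have "\<dots> = (\<Sum>i<length Ms. a i) \<odot>\<^bsub>N\<^esub> m xs"
    by (rule finsum_smult_vs[OF N finite_lessThan mxs])
  finally show ?thesis .
qed

section \<open>Gradings by eigenspaces\<close>

definition eigenspace ::
  "('k::field, 'v, 'm) module_scheme \<Rightarrow> ('v \<Rightarrow> 'v) \<Rightarrow> int \<Rightarrow> 'v set" where
  "eigenspace M D p = {x \<in> carrier M. D x = of_int p \<odot>\<^bsub>M\<^esub> x}"

text \<open>
  The operator preserves the increasing filtration \<open>W\<close> and acts on \<open>W p\<close> modulo \<open>W (p - 1)\<close> as
  multiplication by \<open>p\<close>.  The condition is affine linear in \<open>D\<close>.
\<close>

definition weight_operator ::
  "('k::field, 'v, 'm) module_scheme \<Rightarrow> (int \<Rightarrow> 'v set) \<Rightarrow> ('v \<Rightarrow> 'v) \<Rightarrow> bool" where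
  "weight_operator M W D \<longleftrightarrow> D \<in> lin M M \<and>
     (\<forall>p. \<forall>x\<in>W p. D x \<oplus>\<^bsub>M\<^esub> (- of_int p) \<odot>\<^bsub>M\<^esub> x \<in> W (p - 1))"

lemma subsp_eigenspace: "\<lbrakk>vs M; D \<in> lin M M\<rbrakk> \<Longrightarrow> subsp (eigenspace M D p) M"
  unfolding eigenspace_def by (rule subsp_eq[OF _ lin_scalar])

text \<open>
  Sums over different supports are added over the union of the supports, so finite sums of elements of
  the subspaces \<open>E p\<close> form a subspace.
\<close>

lemma span_homogeneous_sums:
  assumes M: "vs M" and E: "\<And>p::int. subsp (E p) M" and x: "x \<in> vspan M (\<Union>p. E p)"
  obtains u where "\<And>p. u p \<in> E p" "finite {p. u p \<noteq> \<zero>\<^bsub>M\<^esub>}"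
    "x = finsum M u {p. u p \<noteq> \<zero>\<^bsub>M\<^esub>}"
proof -
  define S where "S = {x. \<exists>u P. finite P \<and> (\<forall>p. u p \<in> E p) \<and> (\<forall>p. p \<notin> P \<longrightarrow> u p = \<zero>\<^bsub>M\<^esub>) \<and> x = finsum M u P}"
  have Ec: "y \<in> carrier M" if "y \<in> E p" for y p using subsp_subset[OF E] that by blast
  have ext: "finsum M u P = finsum M u Q"
    if "finite Q" "P \<subseteq> Q" "\<forall>p. u p \<in> E p" "\<forall>p. p \<notin> P \<longrightarrow> u p = \<zero>\<^bsub>M\<^esub>" for u P Q
    by (rule finsum_mono_neutral_vs[OF M that(1,2)]) (use that Ec in blast)+
  have "subsp S M"
  proof (rule subspI[OF M])
    have "finsum M u P \<in> carrier M" if "\<forall>p. u p \<in> E p" for u P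
      using that Ec by (intro finsum_closed_vs[OF M]) blast
    then show "S \<subseteq> carrier M" unfolding S_def by blast
    show "\<zero>\<^bsub>M\<^esub> \<in> S" unfolding S_def
      using subsp_zero[OF E]
      by (intro CollectI exI[of _ "\<lambda>_. \<zero>\<^bsub>M\<^esub>"] exI[of _ "{}"]) (auto simp: finsum_empty_vs[OF M])
    fix x y a assume "x \<in> S"
    then obtain u P where u: "finite P" "\<forall>p. u p \<in> E p" "\<forall>p. p \<notin> P \<longrightarrow> u p = \<zero>\<^bsub>M\<^esub>" "x = finsum M u P"
      unfolding S_def by blast
    have "a \<odot>\<^bsub>M\<^esub> x = finsum M (\<lambda>p. a \<odot>\<^bsub>M\<^esub> u p) P"
      unfolding u(4) by (rule lin_finsum[OF lin_scalar[OF M] M M u(1)]) (use Ec u in blast)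
    then show "a \<odot>\<^bsub>M\<^esub> x \<in> S" unfolding S_def
      using u subsp_smult[OF E] M
      by (intro CollectI exI[of _ "\<lambda>p. a \<odot>\<^bsub>M\<^esub> u p"] exI[of _ P]) auto
    assume "y \<in> S"
    then obtain w Q where w: "finite Q" "\<forall>p. w p \<in> E p" "\<forall>p. p \<notin> Q \<longrightarrow> w p = \<zero>\<^bsub>M\<^esub>" "y = finsum M w Q"
      unfolding S_def by blast
    have "x \<oplus>\<^bsub>M\<^esub> y = finsum M u (P \<union> Q) \<oplus>\<^bsub>M\<^esub> finsum M w (P \<union> Q)"
      unfolding u(4) w(4) using ext[of "P \<union> Q" P u] ext[of "P \<union> Q" Q w] u w by simp
    also have "\<dots> = finsum M (\<lambda>p. u p \<oplus>\<^bsub>M\<^esub> w p) (P \<union> Q)"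
      by (rule finsum_add_vs[OF M, symmetric]) (use Ec u w in blast)+
    finally show "x \<oplus>\<^bsub>M\<^esub> y \<in> S" unfolding S_def
      using u w subsp_add[OF E] M
      by (intro CollectI exI[of _ "\<lambda>p. u p \<oplus>\<^bsub>M\<^esub> w p"] exI[of _ "P \<union> Q"]) auto
  qed
  moreover have "E p \<subseteq> S" for p
  proof
    fix x assume x: "x \<in> E p"
    let ?u = "\<lambda>q. if q = p then x else \<zero>\<^bsub>M\<^esub>"
    have "finsum M ?u {p} = x"
      using finsum_insert_vs[OF M, of "{}" p ?u] Ec[OF x] M by (simp add: finsum_empty_vs)
    then show "x \<in> S" unfolding S_def
      using x subsp_zero[OF E] by (intro CollectI exI[of _ ?u] exI[of _ "{p}"]) auto
  qed
  moreover have "(\<Union>p. E p) \<subseteq> carrier M" using Ec by blast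
  ultimately have "x \<in> S" using span_least[OF M, of "\<Union>p. E p" S] x by blast
  then obtain u P where u: "finite P" "\<forall>p. u p \<in> E p" "\<forall>p. p \<notin> P \<longrightarrow> u p = \<zero>\<^bsub>M\<^esub>" "x = finsum M u P"
    unfolding S_def by blast
  have sub: "{p. u p \<noteq> \<zero>\<^bsub>M\<^esub>} \<subseteq> P" using u by blast
  show ?thesis
  proof (rule that[of u])
    show "finite {p. u p \<noteq> \<zero>\<^bsub>M\<^esub>}" using sub u(1) finite_subset by blast
    show "x = finsum M u {p. u p \<noteq> \<zero>\<^bsub>M\<^esub>}" using ext[OF u(1) sub u(2)] u(4) by simp
  qed (use u in blast)
qed

text \<open>
  Apply \<open>D - q\<close> to a vanishing sum: it kills the summand of index \<open>q\<close> and multiplies the others by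
  \<open>p - q\<close>, which is invertible because distinct integers stay distinct in the field.
\<close>

lemma eigenvectors_independent:
  fixes M :: "('k::field, 'v, 'm) module_scheme"
  assumes M: "vs M" and D: "D \<in> lin M M" and char: "\<And>n. of_int n = (0::'k) \<Longrightarrow> n = 0"
    and "finite P" and u: "\<And>p. p \<in> P \<Longrightarrow> u p \<in> eigenspace M D p" and sum: "finsum M u P = \<zero>\<^bsub>M\<^esub>"
    and "p \<in> P"
  shows "u p = \<zero>\<^bsub>M\<^esub>"
  using \<open>finite P\<close> u sum \<open>p \<in> P\<close>
proof (induction P arbitrary: u p rule: finite_induct)
  case (insert q P)
  have uc: "u p \<in> carrier M" "D (u p) = of_int p \<odot>\<^bsub>M\<^esub> u p" if "p \<in> insert q P" for p
    using insert.prems(1)[OF that] by (auto simp: eigenspace_def)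
  let ?T = "\<lambda>x. D x \<oplus>\<^bsub>M\<^esub> (- of_int q) \<odot>\<^bsub>M\<^esub> x"
  have T: "?T \<in> lin M M" using D M by (intro lin_plus lin_scalar)
  have Tu: "?T (u p) = of_int (p - q) \<odot>\<^bsub>M\<^esub> u p" if "p \<in> insert q P" for p
    using uc[OF that] vs_l_distr[OF M uc(1)[OF that], of "of_int p" "- of_int q"] by simp
  have sum': "u q \<oplus>\<^bsub>M\<^esub> finsum M u P = \<zero>\<^bsub>M\<^esub>"
    using insert.prems(2) finsum_insert_vs[OF M insert.hyps, of u] uc by simp
  have sumc: "finsum M u P \<in> carrier M" using uc by (intro finsum_closed_vs[OF M]) auto
  have "finsum M (\<lambda>p. of_int (p - q) \<odot>\<^bsub>M\<^esub> u p) P = finsum M (\<lambda>p. ?T (u p)) P"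
    using uc Tu M by (intro finsum_cong_vs[OF M]) auto
  also have "\<dots> = ?T (finsum M u P)"
    using uc by (intro lin_finsum[OF T M M insert.hyps(1), symmetric]) auto
  also have "\<dots> = ?T (u q) \<oplus>\<^bsub>M\<^esub> ?T (finsum M u P)"
    using Tu[of q] uc[of q] M lin_closed[OF T sumc] by simp
  also have "\<dots> = ?T (u q \<oplus>\<^bsub>M\<^esub> finsum M u P)"
    using lin_add[OF T uc(1) sumc, of q] by simp
  also have "\<dots> = \<zero>\<^bsub>M\<^esub>" unfolding sum' by (rule lin_zero[OF T M M])
  finally have zero: "finsum M (\<lambda>p. of_int (p - q) \<odot>\<^bsub>M\<^esub> u p) P = \<zero>\<^bsub>M\<^esub>" .
  have P0: "u p = \<zero>\<^bsub>M\<^esub>" if p: "p \<in> P" for p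
  proof -
    have "of_int (p - q) \<odot>\<^bsub>M\<^esub> u p = \<zero>\<^bsub>M\<^esub>"
    proof (rule insert.IH[OF _ zero p])
      show "of_int (p' - q) \<odot>\<^bsub>M\<^esub> u p' \<in> eigenspace M D p'" if "p' \<in> P" for p'
        using insert.prems(1) that by (intro subsp_smult[OF subsp_eigenspace[OF M D]]) auto
    qed
    moreover have "of_int (p - q) \<noteq> (0::'k)" using char[of "p - q"] p insert.hyps by auto
    moreover have "inverse (of_int (p - q)) \<odot>\<^bsub>M\<^esub> (of_int (p - q) \<odot>\<^bsub>M\<^esub> u p)
        = (inverse (of_int (p - q)) * of_int (p - q)) \<odot>\<^bsub>M\<^esub> u p"
      using uc(1) p by (intro vs_smult_assoc[OF M]) auto
    ultimately show ?thesis using M uc(1)[of p] p by (simp add: left_inverse)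
  qed
  have "finsum M u P = finsum M (\<lambda>_. \<zero>\<^bsub>M\<^esub>) P" using P0 M by (intro finsum_cong_vs[OF M]) auto
  also have "\<dots> = \<zero>\<^bsub>M\<^esub>"
    using lin_finsum[OF lin_const_zero[OF M] M M insert.hyps(1), of "\<lambda>_. \<zero>\<^bsub>M\<^esub>"] M by simp
  finally have "u q = \<zero>\<^bsub>M\<^esub>" using sum' uc(1)[of q] M by simp
  with P0 insert.prems show ?case by auto
qed auto

text \<open>
  An eigenvector with eigenvalue \<open>q\<close> that lies in \<open>W p\<close> for some \<open>p > q\<close> already lies in \<open>W (p - 1)\<close>, since
  \<open>D - p\<close> multiplies it by \<open>q - p\<close>; descending from the full space one reaches \<open>W q\<close>.  Conversely, by
  induction on the weight, an element \<open>x\<close> of \<open>W m\<close> is a sum of eigenvectors: \<open>D - m\<close> is invertible on the span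
  of the eigenspaces of index below \<open>m\<close>, which by induction contains \<open>(D - m) x\<close>, so \<open>x\<close> differs from an
  eigenvector for \<open>m\<close> by an element of this span.
\<close>

lemma filtration_eigenspaces:
  fixes M :: "('k::field, 'v, 'm) module_scheme"
  assumes M: "vs M" and W: "\<And>p. subsp (W p) M" and mono: "mono W"
    and bounds: "W a = {\<zero>\<^bsub>M\<^esub>}" "W b = carrier M" and D: "weight_operator M W D"
    and char: "\<And>n. of_int n = (0::'k) \<Longrightarrow> n = 0"
  shows "vspan M (\<Union>q\<in>{..m}. eigenspace M D q) = W m"
proof
  have Dlin: "D \<in> lin M M" and weight: "\<And>p x. x \<in> W p \<Longrightarrow> D x \<oplus>\<^bsub>M\<^esub> (- of_int p) \<odot>\<^bsub>M\<^esub> x \<in> W (p - 1)"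
    using D by (auto simp: weight_operator_def)
  let ?E = "eigenspace M D" and ?S = "\<lambda>m. vspan M (\<Union>q\<in>{..m}. eigenspace M D q)"
  let ?T = "\<lambda>m x. D x \<oplus>\<^bsub>M\<^esub> (- of_int m) \<odot>\<^bsub>M\<^esub> x"
  have T: "?T m \<in> lin M M" for m using Dlin M by (intro lin_plus lin_scalar)
  have Ec: "x \<in> carrier M" if "x \<in> ?E q" for x q using that by (simp add: eigenspace_def)
  have TE: "?T m x = of_int (q - m) \<odot>\<^bsub>M\<^esub> x" if "x \<in> ?E q" for m q x
    using that vs_l_distr[OF M Ec[OF that], of "of_int q" "- of_int m"] by (simp add: eigenspace_def)
  have Uc: "(\<Union>q\<in>{..m}. ?E q) \<subseteq> carrier M" for m using Ec by blast
  have S: "subsp (?S m) M" for m by (rule subsp_span[OF M Uc])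
  have inS: "x \<in> ?S m" if "x \<in> ?E q" "q \<le> m" for x q m
    using span_base[OF M Uc, of m] that by blast
  have Smono: "?S m \<subseteq> ?S m'" if "m \<le> m'" for m m'
    by (rule span_least[OF M Uc S]) (use inS that in force)
  have scale_inv: "inverse c \<odot>\<^bsub>M\<^esub> (c \<odot>\<^bsub>M\<^esub> x) = x" if "c \<noteq> 0" "x \<in> carrier M" for c x
    using that M by (simp add: vs_smult_assoc)
  have EW: "?E q \<subseteq> W q" for q
  proof
    fix x assume x: "x \<in> ?E q"
    have step: "x \<in> W (p - 1)" if "x \<in> W p" "q < p" for p
    proof -
      have "of_int (q - p) \<odot>\<^bsub>M\<^esub> x \<in> W (p - 1)" using weight[OF that(1)] TE[OF x, of p] by simp
      then have "inverse (of_int (q - p)) \<odot>\<^bsub>M\<^esub> (of_int (q - p) \<odot>\<^bsub>M\<^esub> x) \<in> W (p - 1)"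
        by (rule subsp_smult[OF W])
      then show ?thesis using scale_inv[OF _ Ec[OF x], of "of_int (q - p)"] char[of "q - p"] that(2)
        by (cases "of_int (q - p) = (0::'k)") (simp_all del: of_int_diff)
    qed
    have "x \<in> W (q + int n) \<Longrightarrow> x \<in> W q" for n
    proof (induction n)
      case (Suc n)
      then show ?case using step[of "q + int (Suc n)"] by (simp add: algebra_simps)
    qed simp
    moreover have "x \<in> W (q + int (nat (b - q)))"
      using bounds(2) Ec[OF x] monoD[OF mono, of b "q + int (nat (b - q))"] by auto
    ultimately show "x \<in> W q" by blast
  qed
  show "?S m \<subseteq> W m"
  proof (rule span_least[OF M Uc W])
    show "(\<Union>q\<in>{..m}. ?E q) \<subseteq> W m" using EW monoD[OF mono] by blast
  qed
  have invert: "\<exists>z\<in>?S (m - 1). ?T m z = y" if "y \<in> ?S (m - 1)" for m y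
  proof -
    have "?S (m - 1) \<subseteq> ?T m ` ?S (m - 1)"
    proof (rule span_least[OF M Uc])
      show "subsp (?T m ` ?S (m - 1)) M"
      proof (rule subspI[OF M])
        have "?S (m - 1) \<subseteq> carrier M" by (rule subsp_subset[OF S])
        then show "?T m ` ?S (m - 1) \<subseteq> carrier M" using lin_closed[OF T] by blast
        show "\<zero>\<^bsub>M\<^esub> \<in> ?T m ` ?S (m - 1)"
          by (rule image_eqI, rule lin_zero[OF T M M, symmetric], rule subsp_zero[OF S])
        fix x y a assume "x \<in> ?T m ` ?S (m - 1)"
        then obtain x' where x: "x = ?T m x'" "x' \<in> ?S (m - 1)" "x' \<in> carrier M"
          using subsp_subset[OF S] by blast
        show "a \<odot>\<^bsub>M\<^esub> x \<in> ?T m ` ?S (m - 1)"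
          unfolding x(1) by (rule image_eqI, rule lin_smult[OF T x(3), symmetric], rule subsp_smult[OF S x(2)])
        assume "y \<in> ?T m ` ?S (m - 1)"
        then obtain y' where y: "y = ?T m y'" "y' \<in> ?S (m - 1)" "y' \<in> carrier M"
          using subsp_subset[OF S] by blast
        show "x \<oplus>\<^bsub>M\<^esub> y \<in> ?T m ` ?S (m - 1)"
          unfolding x(1) y(1)
          by (rule image_eqI, rule lin_add[OF T x(3) y(3), symmetric], rule subsp_add[OF S x(2) y(2)])
      qed
      show "(\<Union>q\<in>{..m - 1}. ?E q) \<subseteq> ?T m ` ?S (m - 1)"
      proof
        fix x assume "x \<in> (\<Union>q\<in>{..m - 1}. ?E q)"
        then obtain q where q: "q \<le> m - 1" "x \<in> ?E q" by blast
        have c: "of_int (q - m) \<noteq> (0::'k)" using char[of "q - m"] q by auto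
        have z: "inverse (of_int (q - m)) \<odot>\<^bsub>M\<^esub> x \<in> ?E q"
          by (rule subsp_smult[OF subsp_eigenspace[OF M Dlin] q(2)])
        have "?T m (inverse (of_int (q - m)) \<odot>\<^bsub>M\<^esub> x) = x"
          unfolding TE[OF z] using c Ec[OF q(2)] M by (simp add: vs_smult_assoc)
        then show "x \<in> ?T m ` ?S (m - 1)" using inS[OF z q(1)] by (intro image_eqI) (rule sym)
      qed
    qed
    with that show ?thesis by blast
  qed
  have "W (a + int n) \<subseteq> ?S (a + int n)" for n
  proof (induction n)
    case 0
    then show ?case using bounds subsp_zero[OF S] by simp
  next
    case (Suc n)
    define m where "m = a + int (Suc n)"
    have IH: "W (m - 1) \<subseteq> ?S (m - 1)" using Suc by (simp add: m_def)
    show ?case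
      unfolding m_def[symmetric]
    proof
      fix x assume x: "x \<in> W m"
      then have xc: "x \<in> carrier M" using subsp_subset[OF W] by blast
      from weight[OF x] IH invert obtain z where z: "z \<in> ?S (m - 1)" "?T m z = ?T m x" by blast
      have zc: "z \<in> carrier M" using z subsp_subset[OF S] by blast
      \<comment> \<open>\<open>x - z\<close> is annihilated by \<open>D - m\<close>, and \<open>z\<close> has lower weight\<close>
      let ?y = "x \<oplus>\<^bsub>M\<^esub> (-1) \<odot>\<^bsub>M\<^esub> z"
      have yc: "?y \<in> carrier M" using xc zc M by simp
      have "?T m ?y = ?T m x \<oplus>\<^bsub>M\<^esub> (-1) \<odot>\<^bsub>M\<^esub> ?T m z"
        using lin_add[OF T[of m] xc vs_smult[OF M zc]] lin_smult[OF T[of m] zc, of "-1"] by simp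
      also have "\<dots> = \<zero>\<^bsub>M\<^esub>" unfolding z(2) by (rule vs_neg[OF M lin_closed[OF T xc]])
      finally have "D ?y \<oplus>\<^bsub>M\<^esub> (-1) \<odot>\<^bsub>M\<^esub> (of_int m \<odot>\<^bsub>M\<^esub> ?y) = \<zero>\<^bsub>M\<^esub>"
        using yc M by (simp add: vs_smult_assoc)
      then have "D ?y = of_int m \<odot>\<^bsub>M\<^esub> ?y"
        by (rule vs_diff_zero[OF M lin_closed[OF Dlin yc] vs_smult[OF M yc]])
      then have "?y \<in> ?S m" using yc inS[of ?y m m] by (simp add: eigenspace_def)
      moreover have "z \<in> ?S m" using z(1) Smono[of "m - 1" m] by auto
      ultimately have "?y \<oplus>\<^bsub>M\<^esub> z \<in> ?S m" by (rule subsp_add[OF S])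
      then show "x \<in> ?S m" using vs_diff_add[OF M xc zc] by simp
    qed
  qed
  from this[of "nat (m - a)"] show "W m \<subseteq> ?S m"
  proof (cases "a \<le> m")
    case False
    then have "W m \<subseteq> {\<zero>\<^bsub>M\<^esub>}" using bounds monoD[OF mono, of m a] by simp
    then show ?thesis using subsp_zero[OF S, of m] by blast
  qed simp
qed

section \<open>Operations of filtered and graded vector spaces\<close>

text \<open>
  The finite length of a filtration is left out, because \<^const>\<open>U_fil\<close> sends a graded space with
  infinitely many nonzero components to a filtration of infinite length.
\<close>

definition filtered_module :: "('k::field, 'v) filtered_data \<Rightarrow> bool" where
  "filtered_module A \<longleftrightarrow> vs A \<and> (\<forall>p. subsp (filt A p) A)"

lemma filtered_vs_module: "filtered_vs A \<Longrightarrow> filtered_module A"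
  by (simp add: filtered_vs_def filtered_module_def)

lemma FVect_simps [simp]:
  "colors FVect = {A. filtered_vs A}" "op_id FVect = multi_id" "op_comp FVect = multi_comp"
  "op_act FVect = multi_act"
  by (simp_all add: FVect_def)

lemma GrVect_simps [simp]:
  "colors GrVect = {A. graded_vs A}" "op_id GrVect = multi_id" "op_comp GrVect = multi_comp"
  "op_act GrVect = multi_act"
  by (simp_all add: GrVect_def)

lemma image_span_subset_iff:
  assumes "f \<in> lin M N" "vs M" "S \<subseteq> carrier M" "subsp W N"
  shows "f ` vspan M S \<subseteq> W \<longleftrightarrow> f ` S \<subseteq> W"
  using span_image_subset[OF assms] span_base[OF assms(2,3)] by blast

lemma listset_map2_iff:
  assumes "length is = length As"
  shows "xs \<in> listset (map2 F As is) \<longleftrightarrow> length xs = length As \<and> (\<forall>i<length As. xs ! i \<in> F (As ! i) (is ! i))"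
  using assms by (auto simp: listset_iff)

text \<open>
  The steps of the filtration and of the grading on a tensor product are both spans of pure tensors,
  of arguments whose weights satisfy a condition \<open>Q\<close>.
\<close>

lemma tensor_span_image_iff:
  assumes vs: "\<And>A. A \<in> set As \<Longrightarrow> vs A" and F: "\<And>A p. A \<in> set As \<Longrightarrow> F A p \<subseteq> carrier A"
    and f: "f \<in> lin (tensor As) B" and W: "subsp W B"
  shows "f ` vspan (tensor As) (\<Union>is\<in>{is. length is = length As \<and> Q is}. pure_tensor As ` listset (map2 F As is)) \<subseteq> W
    \<longleftrightarrow> (\<forall>is xs. length is = length As \<longrightarrow> Q is \<longrightarrow> length xs = length As \<longrightarrow>
      (\<forall>i<length As. xs ! i \<in> F (As ! i) (is ! i)) \<longrightarrow> f (pure_tensor As xs) \<in> W)"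
proof -
  let ?S = "\<Union>is\<in>{is. length is = length As \<and> Q is}. pure_tensor As ` listset (map2 F As is)"
  have "xs \<in> tuples As" if "length is = length As" "xs \<in> listset (map2 F As is)" for "is" xs
  proof -
    have "xs ! i \<in> carrier (As ! i)" if "i < length As" for i
      using \<open>xs \<in> _\<close> listset_map2_iff[OF \<open>length is = length As\<close>] F[OF nth_mem[OF that]] that by blast
    then show ?thesis using that by (simp add: tuples_iff listset_map2_iff)
  qed
  then have S: "?S \<subseteq> carrier (tensor As)" using pure_tensor_closed[OF vs] by blast
  have "f ` vspan (tensor As) ?S \<subseteq> W \<longleftrightarrow> f ` ?S \<subseteq> W"
    by (rule image_span_subset_iff[OF f tensor_vs[OF vs] S W])
  also have "\<dots> \<longleftrightarrow> (\<forall>is xs. length is = length As \<longrightarrow> Q is \<longrightarrow>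
      xs \<in> listset (map2 F As is) \<longrightarrow> f (pure_tensor As xs) \<in> W)" by blast
  also have "\<dots> \<longleftrightarrow> (\<forall>is xs. length is = length As \<longrightarrow> Q is \<longrightarrow> length xs = length As \<longrightarrow>
      (\<forall>i<length As. xs ! i \<in> F (As ! i) (is ! i)) \<longrightarrow> f (pure_tensor As xs) \<in> W)"
    by (intro iff_allI imp_cong[OF refl]) (simp add: listset_map2_iff imp_conjL)
  finally show ?thesis .
qed

lemma FVect_ops_iff:
  assumes As: "\<forall>A\<in>set As. filtered_module A" and B: "filtered_module B"
  shows "f \<in> ops FVect As B \<longleftrightarrow> f \<in> linear_maps (tensor As) B \<and>
    (\<forall>p is xs. length is = length As \<longrightarrow> sum_list is \<le> p \<longrightarrow> length xs = length As \<longrightarrow>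
      (\<forall>i<length As. xs ! i \<in> filt (As ! i) (is ! i)) \<longrightarrow> f (pure_tensor As xs) \<in> filt B p)"
proof -
  have vs: "\<And>A. A \<in> set As \<Longrightarrow> vs A" and W: "\<And>p. subsp (filt B p) B"
    and sub: "\<And>A p. A \<in> set As \<Longrightarrow> subsp (filt A p) A"
    using As B unfolding filtered_module_def by blast+
  have "f ` tensor_filt As p \<subseteq> filt B p \<longleftrightarrow>
    (\<forall>is xs. length is = length As \<longrightarrow> sum_list is \<le> p \<longrightarrow> length xs = length As \<longrightarrow>
      (\<forall>i<length As. xs ! i \<in> filt (As ! i) (is ! i)) \<longrightarrow> f (pure_tensor As xs) \<in> filt B p)"
    if f: "f \<in> lin (tensor As) B" for p
    unfolding tensor_filt_def by (rule tensor_span_image_iff[OF vs subsp_subset[OF sub] f W])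
  then show ?thesis unfolding FVect_def linear_maps_iff by simp blast
qed

lemma GrVect_ops_iff:
  assumes As: "\<forall>A\<in>set As. vs A \<and> (\<forall>p. subsp (grad A p) A)"
    and B: "vs B" "\<And>p. subsp (grad B p) B"
  shows "f \<in> ops GrVect As B \<longleftrightarrow> f \<in> linear_maps (tensor As) B \<and>
    (\<forall>is xs. length is = length As \<longrightarrow> length xs = length As \<longrightarrow>
      (\<forall>i<length As. xs ! i \<in> grad (As ! i) (is ! i)) \<longrightarrow> f (pure_tensor As xs) \<in> grad B (sum_list is))"
proof -
  have vs: "\<And>A. A \<in> set As \<Longrightarrow> vs A" and sub: "\<And>A p. A \<in> set As \<Longrightarrow> subsp (grad A p) A"
    using As by blast+
  have "f ` tensor_grad As p \<subseteq> grad B p \<longleftrightarrow>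
    (\<forall>is xs. length is = length As \<longrightarrow> sum_list is = p \<longrightarrow> length xs = length As \<longrightarrow>
      (\<forall>i<length As. xs ! i \<in> grad (As ! i) (is ! i)) \<longrightarrow> f (pure_tensor As xs) \<in> grad B p)"
    if f: "f \<in> lin (tensor As) B" for p
    unfolding tensor_grad_def by (rule tensor_span_image_iff[OF vs subsp_subset[OF sub] f B(2)])
  then show ?thesis unfolding GrVect_def linear_maps_iff by simp blast
qed

lemma FVect_unary:
  assumes "filtered_module A" "filtered_module B" "f \<in> ops FVect [A] B"
  shows "(\<lambda>x. f (pure_tensor [A] [x])) \<in> lin A B"
    and "x \<in> filt A p \<Longrightarrow> f (pure_tensor [A] [x]) \<in> filt B p"
proof -
  have "\<forall>A'\<in>set [A]. filtered_module A'" using assms(1) by simp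
  note iff = FVect_ops_iff[OF this assms(2)]
  note f = conjunct1[OF iffD1[OF iff assms(3)]] conjunct2[OF iffD1[OF iff assms(3)], rule_format]
  show "x \<in> filt A p \<Longrightarrow> f (pure_tensor [A] [x]) \<in> filt B p"
    by (rule f(2)[of "[p]"]) simp_all
  have A: "\<And>M. M \<in> set [A] \<Longrightarrow> vs M" using assms(1) by (simp add: filtered_module_def)
  have m: "multilin [A] B (\<lambda>xs. f (pure_tensor [A] xs))"
    using f(1) unfolding linear_maps_iff by (intro multilin_pure_tensor A) simp_all
  have "[\<zero>\<^bsub>A\<^esub>] \<in> tuples [A]" using A by (simp add: tuples_iff)
  from multilin_slot[OF m this, of 0] show "(\<lambda>x. f (pure_tensor [A] [x])) \<in> lin A B" by simp
qed

lemma multi_id_FVect: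
  assumes "filtered_vs A"
  shows "multi_id A \<in> ops FVect [A] A"
proof -
  have A: "vs A" "\<And>p. subsp (filt A p) A" "mono (filt A)"
    using assms by (simp_all add: filtered_vs_def)
  have "multi_id A (pure_tensor [A] xs) \<in> filt A p"
    if "length is = 1" "sum_list is \<le> p" "length xs = 1" "xs ! 0 \<in> filt A (is ! 0)" for p "is" xs
  proof -
    obtain x where x: "xs = [x]" using \<open>length xs = 1\<close> by (cases xs) simp_all
    moreover obtain q where q: "is = [q]" using \<open>length is = 1\<close> by (cases "is") simp_all
    ultimately have xq: "xs = [x]" "is = [q]" by simp_all
    have "q \<le> p" "x \<in> filt A q" using that(2,4) by (simp_all add: xq)
    then have "x \<in> filt A p" using monoD[OF A(3)] by blast
    moreover have "x \<in> carrier A" using \<open>x \<in> filt A q\<close> subsp_subset[OF A(2)] by blast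
    ultimately show ?thesis unfolding xq multi_id_pure[OF A(1) \<open>x \<in> carrier A\<close>] by blast
  qed
  moreover have fA: "filtered_module A" using assms by (rule filtered_vs_module)
  then have fs: "\<forall>B\<in>set [A]. filtered_module B" by simp
  ultimately show ?thesis
    unfolding FVect_ops_iff[OF fs fA] using multi_id_linear[OF A(1)] by simp
qed

section \<open>Graded spaces and the Euler operator\<close>

lemma finsum_support:
  assumes M: "vs M" and "finite P" "{p. u p \<noteq> \<zero>\<^bsub>M\<^esub>} \<subseteq> P" "\<And>p. u p \<in> carrier M"
  shows "finsum M u {p. u p \<noteq> \<zero>\<^bsub>M\<^esub>} = finsum M u P"
  by (rule finsum_mono_neutral_vs[OF M assms(2,3)]) (use assms in auto)

lemma subsp_finsum:
  assumes "subsp W M" "finite P" "\<And>p. p \<in> P \<Longrightarrow> u p \<in> W"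
  shows "finsum M u P \<in> W"
  using assms(2,3)
proof (induction P rule: finite_induct)
  case empty
  then show ?case using subsp_vs[OF assms(1)] subsp_zero[OF assms(1)] by (simp add: finsum_empty_vs)
next
  case (insert p P)
  have "\<And>i. i \<in> insert p P \<Longrightarrow> u i \<in> carrier M" using insert.prems subsp_subset[OF assms(1)] by blast
  then show ?case
    using insert finsum_insert_vs[OF subsp_vs[OF assms(1)] insert.hyps, of u] subsp_add[OF assms(1)]
    by simp
qed

context
  fixes A :: "('k::field, 'v) graded_data"
  assumes A: "graded_vs A"
begin

lemma graded_vs_vs: "vs A" and graded_vs_subsp: "subsp (grad A p) A"
  using A by (auto simp: graded_vs_def)

lemma graded_vs_span: "carrier A \<subseteq> vspan A (\<Union>p. grad A p)"
proof
  fix x assume "x \<in> carrier A"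
  then obtain u where u: "\<forall>p. u p \<in> grad A p" "finite {p. u p \<noteq> \<zero>\<^bsub>A\<^esub>}"
    "x = finsum A u {p. u p \<noteq> \<zero>\<^bsub>A\<^esub>}" using A unfolding graded_vs_def by blast
  have sub: "(\<Union>p. grad A p) \<subseteq> carrier A" using subsp_subset[OF graded_vs_subsp] by blast
  show "x \<in> vspan A (\<Union>p. grad A p)"
    unfolding u(3) using u span_base[OF graded_vs_vs sub]
    by (intro subsp_finsum[OF subsp_span[OF graded_vs_vs sub]]) auto
qed

text \<open>
  The operator multiplies the component of degree \<open>p\<close> by \<open>p\<close>.  By uniqueness the components of a sum are the
  sums of the components; additivity follows after writing all sums over one finite set of degrees.
\<close>

lemma euler_operator:
  obtains D where "D \<in> lin A A" "\<And>p x. x \<in> grad A p \<Longrightarrow> D x = of_int p \<odot>\<^bsub>A\<^esub> x"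
proof -
  note vs = graded_vs_vs and sub = graded_vs_subsp
  have gc: "x \<in> carrier A" if "x \<in> grad A p" for x p using subsp_subset[OF sub] that by blast
  define dec where "dec x u \<longleftrightarrow> (\<forall>p. u p \<in> grad A p) \<and> finite {p. u p \<noteq> \<zero>\<^bsub>A\<^esub>} \<and>
        x = finsum A u {p. u p \<noteq> \<zero>\<^bsub>A\<^esub>}" for x u
  have ex1: "\<exists>!u. dec x u" if "x \<in> carrier A" for x using A that unfolding graded_vs_def dec_def by blast
  define U where "U x = (THE u. dec x u)" for x
  have U: "dec x (U x)" if "x \<in> carrier A" for x unfolding U_def by (rule theI'[OF ex1[OF that]])
  have Ueq: "U x = u" if "x \<in> carrier A" "dec x u" for x u using ex1 U that by blast
  have decI: "dec (finsum A u P) u" if "finite P" "\<And>p. u p \<in> grad A p" "\<And>p. p \<notin> P \<Longrightarrow> u p = \<zero>\<^bsub>A\<^esub>" for u P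
  proof -
    have sub: "{p. u p \<noteq> \<zero>\<^bsub>A\<^esub>} \<subseteq> P" using that by blast
    show ?thesis unfolding dec_def
      using finsum_support[OF vs that(1) sub gc[OF that(2)]] that finite_subset[OF sub] by simp
  qed
  define D where "D x = finsum A (\<lambda>p. of_int p \<odot>\<^bsub>A\<^esub> U x p) {p. U x p \<noteq> \<zero>\<^bsub>A\<^esub>}" for x
  have Ug: "U x p \<in> grad A p" "U x p \<in> carrier A" "finite {p. U x p \<noteq> \<zero>\<^bsub>A\<^esub>}" if "x \<in> carrier A" for x p
    using U[OF that] gc unfolding dec_def by blast+
  \<comment> \<open>the sums may be taken over any finite set of degrees that contains the support\<close>
  have Dext: "D x = finsum A (\<lambda>p. of_int p \<odot>\<^bsub>A\<^esub> U x p) P" "x = finsum A (U x) P"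
    if x: "x \<in> carrier A" and P: "finite P" "{p. U x p \<noteq> \<zero>\<^bsub>A\<^esub>} \<subseteq> P" for x P
  proof -
    show "D x = finsum A (\<lambda>p. of_int p \<odot>\<^bsub>A\<^esub> U x p) P"
      unfolding D_def by (rule finsum_mono_neutral_vs[OF vs P]) (use Ug[OF x] vs in auto)
    show "x = finsum A (U x) P"
      using U[OF x] finsum_support[OF vs P Ug(2)[OF x]] unfolding dec_def by simp
  qed
  have "D \<in> lin A A"
  proof (rule linI)
    fix x y a assume x: "x \<in> carrier A"
    let ?P = "{p. U x p \<noteq> \<zero>\<^bsub>A\<^esub>}"
    note finP = Ug(3)[OF x]
    show "D x \<in> carrier A" unfolding D_def using Ug[OF x] vs by (intro finsum_closed_vs[OF vs]) auto
    have "a \<odot>\<^bsub>A\<^esub> x = finsum A (\<lambda>p. a \<odot>\<^bsub>A\<^esub> U x p) ?P"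
      using lin_finsum[OF lin_scalar[OF vs] vs vs finP, of "U x" a] Ug(2)[OF x] Dext(2)[OF x finP order_refl]
      by simp
    then have Ua: "U (a \<odot>\<^bsub>A\<^esub> x) = (\<lambda>p. a \<odot>\<^bsub>A\<^esub> U x p)"
      using decI[OF finP, of "\<lambda>p. a \<odot>\<^bsub>A\<^esub> U x p"] subsp_smult[OF sub Ug(1)[OF x]] vs
      by (intro Ueq[OF vs_smult[OF vs x]]) auto
    have "{p. U (a \<odot>\<^bsub>A\<^esub> x) p \<noteq> \<zero>\<^bsub>A\<^esub>} \<subseteq> ?P" unfolding Ua using vs by auto
    from Dext(1)[OF vs_smult[OF vs x] finP this]
    have "D (a \<odot>\<^bsub>A\<^esub> x) = finsum A (\<lambda>p. of_int p \<odot>\<^bsub>A\<^esub> (a \<odot>\<^bsub>A\<^esub> U x p)) ?P" unfolding Ua .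
    also have "\<dots> = finsum A (\<lambda>p. a \<odot>\<^bsub>A\<^esub> (of_int p \<odot>\<^bsub>A\<^esub> U x p)) ?P"
      using Ug[OF x] vs by (intro finsum_cong_vs[OF vs refl]) (simp_all add: vs_smult_assoc mult.commute)
    also have "\<dots> = a \<odot>\<^bsub>A\<^esub> D x"
      unfolding D_def
      by (rule lin_finsum[OF lin_scalar[OF vs] vs vs finP, symmetric]) (use Ug[OF x] vs in auto)
    finally show "D (a \<odot>\<^bsub>A\<^esub> x) = a \<odot>\<^bsub>A\<^esub> D x" .
    assume y: "y \<in> carrier A"
    let ?Q = "?P \<union> {p. U y p \<noteq> \<zero>\<^bsub>A\<^esub>}"
    have Q: "finite ?Q" "?P \<subseteq> ?Q" "{p. U y p \<noteq> \<zero>\<^bsub>A\<^esub>} \<subseteq> ?Q" using finP Ug(3)[OF y] by auto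
    have "x \<oplus>\<^bsub>A\<^esub> y = finsum A (U x) ?Q \<oplus>\<^bsub>A\<^esub> finsum A (U y) ?Q"
      using Dext(2)[OF x Q(1,2)] Dext(2)[OF y Q(1,3)] by (rule arg_cong2)
    also have "\<dots> = finsum A (\<lambda>p. U x p \<oplus>\<^bsub>A\<^esub> U y p) ?Q"
      by (rule finsum_add_vs[OF vs, symmetric]) (rule Ug(2)[OF x] Ug(2)[OF y])+
    finally have sum: "x \<oplus>\<^bsub>A\<^esub> y = finsum A (\<lambda>p. U x p \<oplus>\<^bsub>A\<^esub> U y p) ?Q" .
    have "dec (x \<oplus>\<^bsub>A\<^esub> y) (\<lambda>p. U x p \<oplus>\<^bsub>A\<^esub> U y p)"
      unfolding sum by (rule decI[OF Q(1)]) (use subsp_add[OF sub Ug(1)[OF x] Ug(1)[OF y]] vs in auto)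
    then have Uxy: "U (x \<oplus>\<^bsub>A\<^esub> y) = (\<lambda>p. U x p \<oplus>\<^bsub>A\<^esub> U y p)"
      by (rule Ueq[OF vs_add[OF vs x y]])
    have "{p. U (x \<oplus>\<^bsub>A\<^esub> y) p \<noteq> \<zero>\<^bsub>A\<^esub>} \<subseteq> ?Q" unfolding Uxy using vs by auto
    from Dext(1)[OF vs_add[OF vs x y] Q(1) this]
    have "D (x \<oplus>\<^bsub>A\<^esub> y) = finsum A (\<lambda>p. of_int p \<odot>\<^bsub>A\<^esub> (U x p \<oplus>\<^bsub>A\<^esub> U y p)) ?Q" unfolding Uxy .
    also have "\<dots> = finsum A (\<lambda>p. of_int p \<odot>\<^bsub>A\<^esub> U x p \<oplus>\<^bsub>A\<^esub> of_int p \<odot>\<^bsub>A\<^esub> U y p) ?Q"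
      using Ug[OF x] Ug[OF y] vs by (intro finsum_cong_vs[OF vs refl]) (simp_all add: vs_r_distr)
    also have "\<dots> = D x \<oplus>\<^bsub>A\<^esub> D y"
      unfolding Dext(1)[OF x Q(1,2)] Dext(1)[OF y Q(1,3)]
      by (rule finsum_add_vs[OF vs]) (rule vs_smult[OF vs Ug(2)[OF x]] vs_smult[OF vs Ug(2)[OF y]])+
    finally show "D (x \<oplus>\<^bsub>A\<^esub> y) = D x \<oplus>\<^bsub>A\<^esub> D y" .
  qed
  moreover have "D x = of_int p \<odot>\<^bsub>A\<^esub> x" if x: "x \<in> grad A p" for p x
  proof -
    let ?u = "\<lambda>q. if q = p then x else \<zero>\<^bsub>A\<^esub>"
    have single: "finsum A v {p} = v p" if "v p \<in> carrier A" for v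
      using finsum_insert_vs[OF vs, of "{}" p v] that vs by (simp add: finsum_empty_vs)
    have "dec (finsum A ?u {p}) ?u" by (rule decI) (use x subsp_zero[OF sub] in auto)
    then have "dec x ?u" using single[of ?u] gc[OF x] by simp
    then have Ux: "U x = ?u" by (rule Ueq[OF gc[OF x]])
    have "{q. U x q \<noteq> \<zero>\<^bsub>A\<^esub>} \<subseteq> {p}" unfolding Ux by auto
    from Dext(1)[OF gc[OF x] _ this]
    have "D x = finsum A (\<lambda>q. of_int q \<odot>\<^bsub>A\<^esub> U x q) {p}" by simp
    also have "\<dots> = of_int p \<odot>\<^bsub>A\<^esub> U x p"
      by (rule single) (use Ux gc[OF x] vs in simp)
    finally show ?thesis unfolding Ux by simp
  qed
  ultimately show ?thesis by (rule that)
qed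

end

text \<open>
  Two decompositions of an element differ by a decomposition of zero.
\<close>

lemma graded_vsI:
  assumes vs: "vs A" and sub: "\<And>p. subsp (grad A p) A"
    and span: "carrier A \<subseteq> vspan A (\<Union>p. grad A p)"
    and indep: "\<And>P u p. \<lbrakk>finite P; \<And>p. p \<in> P \<Longrightarrow> u p \<in> grad A p; finsum A u P = \<zero>\<^bsub>A\<^esub>; p \<in> P\<rbrakk> \<Longrightarrow> u p = \<zero>\<^bsub>A\<^esub>"
  shows "graded_vs A"
proof -
  have gc: "x \<in> carrier A" if "x \<in> grad A p" for x p using subsp_subset[OF sub] that by blast
  have "\<exists>!u. (\<forall>p. u p \<in> grad A p) \<and> finite {p. u p \<noteq> \<zero>\<^bsub>A\<^esub>} \<and> x = finsum A u {p. u p \<noteq> \<zero>\<^bsub>A\<^esub>}"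
    if x: "x \<in> carrier A" for x
  proof (rule ex_ex1I)
    from x span have "x \<in> vspan A (\<Union>p. grad A p)" by blast
    from span_homogeneous_sums[of A "grad A", OF vs sub this]
    obtain u where "\<And>p. u p \<in> grad A p" "finite {p. u p \<noteq> \<zero>\<^bsub>A\<^esub>}" "x = finsum A u {p. u p \<noteq> \<zero>\<^bsub>A\<^esub>}"
      by blast
    then show "\<exists>u. (\<forall>p. u p \<in> grad A p) \<and> finite {p. u p \<noteq> \<zero>\<^bsub>A\<^esub>} \<and> x = finsum A u {p. u p \<noteq> \<zero>\<^bsub>A\<^esub>}"
      by (intro exI[of _ u] conjI allI)
    fix u w
    assume u: "(\<forall>p. u p \<in> grad A p) \<and> finite {p. u p \<noteq> \<zero>\<^bsub>A\<^esub>} \<and> x = finsum A u {p. u p \<noteq> \<zero>\<^bsub>A\<^esub>}"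
      and w: "(\<forall>p. w p \<in> grad A p) \<and> finite {p. w p \<noteq> \<zero>\<^bsub>A\<^esub>} \<and> x = finsum A w {p. w p \<noteq> \<zero>\<^bsub>A\<^esub>}"
    let ?Q = "{p. u p \<noteq> \<zero>\<^bsub>A\<^esub>} \<union> {p. w p \<noteq> \<zero>\<^bsub>A\<^esub>}"
    have Q: "finite ?Q" using u w by simp
    have uc: "u p \<in> carrier A" "w p \<in> carrier A" for p using u w gc by blast+
    let ?v = "\<lambda>p. u p \<oplus>\<^bsub>A\<^esub> (-1) \<odot>\<^bsub>A\<^esub> w p"
    have "finsum A ?v ?Q = finsum A u ?Q \<oplus>\<^bsub>A\<^esub> finsum A (\<lambda>p. (-1) \<odot>\<^bsub>A\<^esub> w p) ?Q"
      by (rule finsum_add_vs[OF vs]) (use uc vs in auto)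
    also have "finsum A (\<lambda>p. (-1) \<odot>\<^bsub>A\<^esub> w p) ?Q = (-1) \<odot>\<^bsub>A\<^esub> finsum A w ?Q"
      using lin_finsum[OF lin_scalar[OF vs] vs vs Q, of w "-1"] uc(2) by simp
    also have "finsum A u ?Q = x" using u finsum_support[where u = u, OF vs Q _ uc(1)] by (metis Un_upper1)
    also have "finsum A w ?Q = x" using w finsum_support[where u = w, OF vs Q _ uc(2)] by (metis Un_upper2)
    also have "x \<oplus>\<^bsub>A\<^esub> (-1) \<odot>\<^bsub>A\<^esub> x = \<zero>\<^bsub>A\<^esub>" by (rule vs_neg[OF vs x])
    finally have sum: "finsum A ?v ?Q = \<zero>\<^bsub>A\<^esub>" .
    have "?v p \<in> grad A p" for p using u w by (intro subsp_add[OF sub] subsp_smult[OF sub]) auto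
    then have v0: "?v p = \<zero>\<^bsub>A\<^esub>" if "p \<in> ?Q" for p by (rule indep[where u = ?v, OF Q _ sum that])
    show "u = w"
    proof
      fix p
      show "u p = w p"
      proof (cases "p \<in> ?Q")
        case True
        show ?thesis by (rule vs_diff_zero[OF vs uc v0[OF True]])
      qed simp
    qed
  qed
  note ex = this
  show ?thesis unfolding graded_vs_def by (intro conjI allI ballI vs sub ex)
qed

section \<open>Weight derivations and splittings\<close>

lemma truncateD:
  assumes "module.truncate M = module.truncate M'"
  shows "carrier M = carrier M'" "add M = add M'" "smult M = smult M'" "zero M = zero M'"
proof -
  show "carrier M = carrier M'" "add M = add M'" "smult M = smult M'"
    using assms by (metis truncate_simps)+
  show "zero M = zero M'" using arg_cong[OF assms, of zero] by (simp add: module.truncate_def)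
qed

lemma vs_truncate:
  assumes "module.truncate M = module.truncate M'" "vs M"
  shows "vs M'"
  by (rule vsI; (unfold truncateD[OF assms(1), symmetric])?)
    (use assms(2) in \<open>simp_all add: vs_ac vs_l_distr vs_r_distr vs_smult_assoc\<close>)

lemma subsp_truncate:
  assumes "module.truncate M = module.truncate M'" "subsp W M"
  shows "subsp W M'"
proof (rule subspI[OF vs_truncate[OF assms(1) subsp_vs[OF assms(2)]]])
  note eq = truncateD[OF assms(1), symmetric]
  show "W \<subseteq> carrier M'" "\<zero>\<^bsub>M'\<^esub> \<in> W"
    unfolding eq using subsp_subset[OF assms(2)] subsp_zero[OF assms(2)] .
  show "\<And>x y. \<lbrakk>x \<in> W; y \<in> W\<rbrakk> \<Longrightarrow> x \<oplus>\<^bsub>M'\<^esub> y \<in> W" unfolding eq by (rule subsp_add[OF assms(2)])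
  show "\<And>a x. x \<in> W \<Longrightarrow> a \<odot>\<^bsub>M'\<^esub> x \<in> W" unfolding eq by (rule subsp_smult[OF assms(2)])
qed

lemma lin_truncate:
  assumes "module.truncate M = module.truncate M'" "module.truncate N = module.truncate N'"
  shows "lin M N = lin M' N'"
  unfolding LinearCombinations.module_hom_def truncateD[OF assms(1)] truncateD[OF assms(2)] ..

lemma tensor_maps_truncate:
  assumes "map module.truncate Ms = map module.truncate Ms'" "module.truncate N = module.truncate N'"
  shows "linear_maps (tensor Ms) N = linear_maps (tensor Ms') N'"
  unfolding tensor_truncate[OF assms(1)] by (rule linear_maps_truncate[OF refl assms(2)])

definition operation ::
  "('c, 'o, ('k::field, 'v, 'm) module_scheme, ('v list \<Rightarrow> 'k) set \<Rightarrow> 'v) operad_map_data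
    \<Rightarrow> 'c list \<Rightarrow> 'c \<Rightarrow> 'o \<Rightarrow> 'v list \<Rightarrow> 'v" where
  "operation V cs d f xs = on_op V cs d f (pure_tensor (map (on_color V) cs) xs)"

text \<open>
  A derivation of the algebra that acts as multiplication by \<open>p\<close> on the part of weight \<open>p\<close> of the
  associated graded.  It is the infinitesimal form of the action of the multiplicative group that a
  splitting defines, and it replaces splittings by solutions of affine linear equations.  For an
  operation without inputs the Leibniz sum is empty, so that its value has eigenvalue \<open>0\<close>, the weight of
  the unit.
\<close>

definition weight_derivation ::
  "('c, 'o) operad_data
    \<Rightarrow> ('c, 'o, ('k::field, 'v) filtered_data, ('v list \<Rightarrow> 'k) set \<Rightarrow> 'v) operad_map_data
    \<Rightarrow> ('c \<Rightarrow> 'v \<Rightarrow> 'v) \<Rightarrow> bool" where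
  "weight_derivation C V D \<longleftrightarrow>
    (\<forall>c\<in>colors C. weight_operator (on_color V c) (filt (on_color V c)) (D c)) \<and>
    (\<forall>cs\<in>lists (colors C). \<forall>d\<in>colors C. \<forall>f\<in>ops C cs d. \<forall>xs\<in>tuples (map (on_color V) cs).
      D d (operation V cs d f xs) = leibniz (on_color V d) (operation V cs d f) (\<lambda>i. D (cs ! i)) xs)"

text \<open>
  The underlying module stays the same, so that \<^const>\<open>U_fil\<close> gives back the original filtered space
  itself and not only an isomorphic one.
\<close>

definition eigen_grading :: "('k::field, 'v) filtered_data \<Rightarrow> ('v \<Rightarrow> 'v) \<Rightarrow> ('k, 'v) graded_data" where
  "eigen_grading A D =
     \<lparr>carrier = carrier A, mult = mult A, one = one A, zero = zero A, add = add A, smult = smult A,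
      grad = eigenspace A D\<rparr>"

lemma truncate_eigen_grading: "module.truncate (eigen_grading A D) = module.truncate A"
  by (simp add: eigen_grading_def module.truncate_def)

lemma grad_eigen_grading: "grad (eigen_grading A D) = eigenspace A D"
  by (simp add: eigen_grading_def)

context
  fixes A :: "('k::field, 'v) filtered_data" and D
  assumes A: "filtered_vs A" and D: "weight_operator A (filt A) D"
    and char: "\<And>n. of_int n = (0::'k) \<Longrightarrow> n = 0"
begin

lemma eigen_grading_filt: "vspan (eigen_grading A D) (\<Union>q\<in>{..m}. eigenspace A D q) = filt A m"
proof -
  let ?E = "eigen_grading A D"
  note tr = truncate_eigen_grading[of A D]
  note eq = truncateD[OF tr]
  have vs: "vs ?E" using A by (intro vs_truncate[OF tr[symmetric]]) (simp add: filtered_vs_def)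
  have W: "subsp (filt A p) ?E" for p
    using A by (intro subsp_truncate[OF tr[symmetric]]) (simp add: filtered_vs_def)
  obtain a b where ab: "filt A a = {\<zero>\<^bsub>?E\<^esub>}" "filt A b = carrier ?E"
    using A unfolding filtered_vs_def eq by blast
  have D': "weight_operator ?E (filt A) D"
    using D unfolding weight_operator_def lin_truncate[OF tr tr] eq .
  have E: "eigenspace ?E D = eigenspace A D" unfolding eigenspace_def eq ..
  have "mono (filt A)" using A by (simp add: filtered_vs_def)
  from filtration_eigenspaces[OF vs W this ab D' char] show ?thesis unfolding E .
qed

lemma graded_eigen_grading: "graded_vs (eigen_grading A D)"
proof (rule graded_vsI)
  let ?E = "eigen_grading A D"
  note tr = truncate_eigen_grading[of A D]
  note eq = truncateD[OF tr]
  have D': "D \<in> lin A A" using D by (simp add: weight_operator_def)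
  have vsA: "vs A" using A by (simp add: filtered_vs_def)
  show vs: "vs ?E" by (rule vs_truncate[OF tr[symmetric] vsA])
  show sub: "subsp (grad ?E p) ?E" for p
    unfolding grad_eigen_grading by (rule subsp_truncate[OF tr[symmetric] subsp_eigenspace[OF vsA D']])
  have E: "eigenspace ?E D = eigenspace A D" unfolding eigenspace_def eq ..
  obtain b where b: "filt A b = carrier ?E" using A unfolding filtered_vs_def eq by blast
  have c: "(\<Union>p. grad ?E p) \<subseteq> carrier ?E" using subsp_subset[OF sub] by blast
  have "carrier ?E = vspan ?E (\<Union>q\<in>{..b}. grad ?E q)"
    unfolding grad_eigen_grading eigen_grading_filt b ..
  also have "\<dots> \<subseteq> vspan ?E (\<Union>p. grad ?E p)"
    by (rule span_least[OF vs _ subsp_span[OF vs c]]) (use c span_base[OF vs c] in blast)+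
  finally show "carrier ?E \<subseteq> vspan ?E (\<Union>p. grad ?E p)" .
  fix P u p
  assume "finite P" "\<And>p. p \<in> P \<Longrightarrow> u p \<in> grad ?E p" "finsum ?E u P = \<zero>\<^bsub>?E\<^esub>" "p \<in> P"
  moreover have "D \<in> lin ?E ?E" using D' unfolding lin_truncate[OF tr tr] .
  ultimately show "u p = \<zero>\<^bsub>?E\<^esub>"
    using char unfolding grad_eigen_grading E[symmetric]
    by (intro eigenvectors_independent[OF vs, where D = D and u = u and P = P]) blast+
qed

lemma U_fil_eigen_grading: "on_color U_fil (eigen_grading A D) = A"
proof (rule filtered_data.equality)
  have "filt (on_color U_fil (eigen_grading A D)) m = filt A m" for m
    using eigen_grading_filt[of m] by (simp add: U_fil_def grad_eigen_grading)
  then show "filt (on_color U_fil (eigen_grading A D)) = filt A" ..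
qed (simp_all add: U_fil_def eigen_grading_def)

end

lemma U_fil_on_op [simp]: "on_op U_fil As B f = f"
  by (simp add: U_fil_def)

lemma truncate_U_fil: "module.truncate (on_color U_fil A) = module.truncate A"
  by (simp add: U_fil_def module.truncate_def)

text \<open>
  Grade every space by the eigenspaces of the derivation.  The filtration of this grading is the given
  one, and an operation is graded because by the Leibniz rule it adds eigenvalues.  Hence the algebra
  itself, with these gradings, is a lift along \<^const>\<open>U_fil\<close>, and the isomorphism consists of identities.
\<close>

theorem derivation_imp_splitting:
  fixes V :: "('c, 'o, ('k::field, 'v) filtered_data, ('v list \<Rightarrow> 'k) set \<Rightarrow> 'v) operad_map_data"
  assumes V: "operad_map C FVect V" and D: "weight_derivation C V D"
    and char: "\<And>n. of_int n = (0::'k) \<Longrightarrow> n = 0"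
  shows "lax_splitting C V"
proof -
  interpret V: operad_map C FVect V by (rule V)
  define G where "G = \<lparr>on_color = \<lambda>c. eigen_grading (on_color V c) (D c), on_op = on_op V\<rparr>"
  have Gc: "on_color G c = eigen_grading (on_color V c) (D c)" and Go: "on_op G = on_op V" for c
    by (simp_all add: G_def)
  have tr: "module.truncate (on_color G c) = module.truncate (on_color V c)" for c
    unfolding Gc by (rule truncate_eigen_grading)
  have trs: "map module.truncate (map (on_color G) cs) = map module.truncate (map (on_color V) cs)" for cs
    using tr by simp
  have fV: "filtered_vs (on_color V c)" if "c \<in> colors C" for c using V.on_color_closed[OF that] by simp
  have vV: "vs (on_color V c)" if "c \<in> colors C" for c using fV[OF that] by (simp add: filtered_vs_def)
  have W: "weight_operator (on_color V c) (filt (on_color V c)) (D c)" if "c \<in> colors C" for c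
    using D that unfolding weight_derivation_def by blast
  have Dlin: "D c \<in> lin (on_color V c) (on_color V c)" if "c \<in> colors C" for c
    using W[OF that] by (simp add: weight_operator_def)
  have gG: "graded_vs (on_color G c)" if "c \<in> colors C" for c
    unfolding Gc using char by (rule graded_eigen_grading[OF fV[OF that] W[OF that]])
  have UG: "on_color (U_fil \<circ>\<^sub>o G) c = on_color V c" if "c \<in> colors C" for c
    unfolding operad_map_comp_def using U_fil_eigen_grading[OF fV[OF that] W[OF that] char]
    by (simp add: Gc)
  have Flin: "on_op V cs d f \<in> linear_maps (tensor (map (on_color V) cs)) (on_color V d)"
    if "cs \<in> lists (colors C)" "d \<in> colors C" "f \<in> ops C cs d" for cs d f
    using V.on_op_closed[OF that] by (simp add: FVect_def)
  have vVs: "\<And>M. M \<in> set (map (on_color V) cs) \<Longrightarrow> vs M" if "cs \<in> lists (colors C)" for cs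
    using that vV by auto
  have "operad_map C GrVect G"
  proof
    show "on_color G c \<in> colors GrVect" if "c \<in> colors C" for c using gG[OF that] by simp
    show "on_op G [c] c (op_id C c) = op_id GrVect (on_color G c)" if "c \<in> colors C" for c
      using V.on_op_id[OF that] multi_id_truncate[OF tr[of c]] by (simp add: Go)
    show "on_op G cs d f \<in> ops GrVect (map (on_color G) cs) (on_color G d)"
      if cs: "cs \<in> lists (colors C)" and d: "d \<in> colors C" and f: "f \<in> ops C cs d" for cs d f
    proof -
      have gs: "\<forall>A\<in>set (map (on_color G) cs). vs A \<and> (\<forall>p. subsp (grad A p) A)"
      proof
        fix A assume "A \<in> set (map (on_color G) cs)"
        then obtain c where "A = on_color G c" "c \<in> colors C" using cs by auto
        then have "graded_vs A" using gG by blast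
        then show "vs A \<and> (\<forall>p. subsp (grad A p) A)" using graded_vs_vs graded_vs_subsp by blast
      qed
      note F = Flin[OF cs d f]
      have m: "multilin (map (on_color V) cs) (on_color V d) (operation V cs d f)"
        unfolding operation_def using F vVs[OF cs] by (intro multilin_pure_tensor) (simp_all add: linear_maps_iff)
      have "on_op V cs d f (pure_tensor (map (on_color V) cs) xs) \<in> grad (on_color G d) (sum_list is)"
        if len: "length is = length (map (on_color G) cs)" "length xs = length (map (on_color G) cs)"
          and xs: "\<forall>i<length (map (on_color G) cs). xs ! i \<in> grad (map (on_color G) cs ! i) (is ! i)" for "is" xs
      proof -
        have xsi: "xs ! i \<in> carrier (on_color V (cs ! i))"
          "D (cs ! i) (xs ! i) = of_int (is ! i) \<odot>\<^bsub>on_color V (cs ! i)\<^esub> xs ! i" if "i < length cs" for i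
          using xs that by (simp_all add: Gc grad_eigen_grading eigenspace_def)
        have tup: "xs \<in> tuples (map (on_color V) cs)" using len xsi by (simp add: tuples_iff)
        have "D d (operation V cs d f xs)
            = leibniz (on_color V d) (operation V cs d f) (\<lambda>i. D (cs ! i)) xs"
          using D cs d f tup unfolding weight_derivation_def by blast
        also have "\<dots> = (\<Sum>i<length (map (on_color V) cs). of_int (is ! i)) \<odot>\<^bsub>on_color V d\<^esub> operation V cs d f xs"
          by (rule leibniz_eigen[OF m vV[OF d] tup]) (use xsi in simp)
        also have "(\<Sum>i<length (map (on_color V) cs). of_int (is ! i)) = (of_int (sum_list is) :: 'k)"
          using len by (simp add: sum_list_sum_nth atLeast0LessThan)
        finally show ?thesis
          using multilin_closed[OF m tup] by (simp add: Gc grad_eigen_grading eigenspace_def operation_def)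
      qed
      then show ?thesis
        using GrVect_ops_iff[OF gs graded_vs_vs[OF gG[OF d]] graded_vs_subsp[OF gG[OF d]]] F
        unfolding tensor_maps_truncate[OF trs tr] pure_tensor_truncate[OF trs] Go by blast
    qed
    show "on_op G (concat css) d (op_comp C css cs d g fs) =
            op_comp GrVect (map (map (on_color G)) css) (map (on_color G) cs) (on_color G d)
              (on_op G cs d g) (map (\<lambda>i. on_op G (css ! i) (cs ! i) (fs ! i)) [0..<length cs])"
      if "d \<in> colors C" "g \<in> ops C cs d" "op_family C css cs fs" for d g css cs fs
    proof -
      have "length css = length cs" using that by (simp add: op_family_def)
      then have "multi_comp (map (map (on_color G)) css) (map (on_color G) cs) (on_color G d) h hs
        = multi_comp (map (map (on_color V)) css) (map (on_color V) cs) (on_color V d) h hs" for h hs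
        using tr by (intro multi_comp_truncate) (simp_all add: comp_def)
      then show ?thesis using V.on_op_comp[OF that] by (simp add: Go)
    qed
    show "on_op G (permute_list \<sigma> cs) d (op_act C cs d \<sigma> f) =
            op_act GrVect (map (on_color G) cs) (on_color G d) \<sigma> (on_op G cs d f)"
      if "cs \<in> lists (colors C)" "d \<in> colors C" "f \<in> ops C cs d" "\<sigma> permutes {..<length cs}" for cs d f \<sigma>
    proof -
      have "\<sigma> permutes {..<length (map (on_color G) cs)}" using that(4) by simp
      from multi_act_truncate[OF trs tr this] show ?thesis using V.on_op_act[OF that] by (simp add: Go)
    qed
  qed
  moreover have "operad_map_iso C FVect V (U_fil \<circ>\<^sub>o G)"
    unfolding operad_map_iso_def
  proof (intro exI[of _ "\<lambda>c. multi_id (on_color V c)"] conjI ballI)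
    fix c assume c: "c \<in> colors C"
    let ?A = "on_color V c"
    note A = vV[OF c]
    have id: "multi_id ?A \<in> linear_maps (tensor [?A]) ?A" by (rule multi_id_linear[OF A])
    show I: "multi_id ?A \<in> ops FVect [?A] (on_color (U_fil \<circ>\<^sub>o G) c)"
      unfolding UG[OF c] by (rule multi_id_FVect[OF fV[OF c]])
    have vA: "\<And>M. M \<in> set [?A] \<Longrightarrow> vs M" using A by simp
    have id': "multi_id ?A \<in> lin (tensor [?A]) ?A" using id by (simp add: linear_maps_iff)
    have "multi_comp [[?A]] [?A] ?A (multi_id ?A) [multi_id ?A] = multi_id ?A"
    proof (rule tensor_maps_eqI[OF vA _ id A])
      show "multi_comp [[?A]] [?A] ?A (multi_id ?A) [multi_id ?A] \<in> linear_maps (tensor [?A]) ?A"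
        by (rule multi_comp_unary_linear[OF vA A A id' id'])
      fix xs assume xs: "xs \<in> tuples [?A]"
      then obtain x where x: "xs = [x]" "x \<in> carrier ?A" by (auto simp: tuples_def set_Cons_def)
      show "multi_comp [[?A]] [?A] ?A (multi_id ?A) [multi_id ?A] (pure_tensor [?A] xs)
          = multi_id ?A (pure_tensor [?A] xs)"
        using multi_comp_unary_pure[OF vA A A id' id' xs] multi_id_pure[OF A x(2)] by (simp add: x(1))
    qed assumption
    then show "\<exists>\<psi>\<in>ops FVect [on_color (U_fil \<circ>\<^sub>o G) c] ?A.
            op_comp FVect [[?A]] [on_color (U_fil \<circ>\<^sub>o G) c] ?A \<psi> [multi_id ?A] = op_id FVect ?A \<and>
            op_comp FVect [[on_color (U_fil \<circ>\<^sub>o G) c]] [?A] (on_color (U_fil \<circ>\<^sub>o G) c) (multi_id ?A) [\<psi>] =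
              op_id FVect (on_color (U_fil \<circ>\<^sub>o G) c)"
      using I unfolding UG[OF c] by (intro bexI[of _ "multi_id ?A"]) simp_all
  next
    fix cs d f assume cs: "cs \<in> lists (colors C)" and d: "d \<in> colors C" and f: "f \<in> ops C cs d"
    let ?As = "map (on_color V) cs" and ?B = "on_color V d" and ?F = "on_op V cs d f"
    note F = Flin[OF cs d f] and vA = vVs[OF cs]
    have F': "?F \<in> lin (tensor ?As) ?B" using F by (simp add: linear_maps_iff)
    have cc: "c \<in> colors C" if "c \<in> set cs" for c using cs that by auto
    have eqs: "map (on_color (U_fil \<circ>\<^sub>o G)) cs = ?As" using cc UG by simp
    have eqf: "on_op (U_fil \<circ>\<^sub>o G) cs d f = ?F" by (simp add: operad_map_comp_def Go)
    have idB: "multi_id ?B \<in> lin (tensor [?B]) ?B"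
      using multi_id_linear[OF vV[OF d]] by (simp add: linear_maps_iff)
    have ids: "multi_id (on_color V c) \<in> lin (tensor [on_color V c]) (on_color V c)" if "c \<in> set cs" for c
      using multi_id_linear[OF vV[OF cc[OF that]]] by (simp add: linear_maps_iff)
    have vcs: "vs (on_color V c)" if "c \<in> set cs" for c by (rule vV[OF cc[OF that]])
    have "multi_comp [?As] [?B] ?B (multi_id ?B) [?F] =
         multi_comp (map (\<lambda>c. [on_color V c]) cs) ?As ?B ?F (map (\<lambda>c. multi_id (on_color V c)) cs)"
    proof (rule tensor_maps_eqI[OF vA _ _ vV[OF d]])
      show "multi_comp [?As] [?B] ?B (multi_id ?B) [?F] \<in> linear_maps (tensor ?As) ?B"
        by (rule multi_comp_unary_linear[OF vA vV[OF d] vV[OF d] idB F'])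
      show "multi_comp (map (\<lambda>c. [on_color V c]) cs) ?As ?B ?F (map (\<lambda>c. multi_id (on_color V c)) cs)
          \<in> linear_maps (tensor ?As) ?B"
        by (rule multi_comp_unaries_linear[OF vcs vcs vV[OF d] F' ids])
      fix xs assume xs: "xs \<in> tuples ?As"
      have "map2 (\<lambda>c x. multi_id (on_color V c) (pure_tensor [on_color V c] [x])) cs xs = xs"
        using xs multi_id_pure[OF vcs] by (intro nth_equalityI) (auto simp: tuples_iff)
      moreover have "?F (pure_tensor ?As xs) \<in> carrier ?B"
        using lin_closed[OF F' pure_tensor_closed[OF vA xs]] by simp
      ultimately show "multi_comp [?As] [?B] ?B (multi_id ?B) [?F] (pure_tensor ?As xs)
        = multi_comp (map (\<lambda>c. [on_color V c]) cs) ?As ?B ?F (map (\<lambda>c. multi_id (on_color V c)) cs) (pure_tensor ?As xs)"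
        using multi_comp_unary_pure[OF vA vV[OF d] vV[OF d] idB F' xs]
          multi_comp_unaries[OF vcs vcs vV[OF d] F' ids xs] multi_id_pure[OF vV[OF d]] by simp
    qed assumption
    moreover have "map (\<lambda>c. [on_color V c]) cs = map (\<lambda>c. [on_color V c]) cs" ..
    ultimately show "op_comp FVect [map (on_color V) cs] [on_color V d] (on_color (U_fil \<circ>\<^sub>o G) d)
          (multi_id (on_color V d)) [on_op V cs d f] =
         op_comp FVect (map (\<lambda>c. [on_color V c]) cs) (map (on_color (U_fil \<circ>\<^sub>o G)) cs) (on_color (U_fil \<circ>\<^sub>o G) d)
           (on_op (U_fil \<circ>\<^sub>o G) cs d f) (map (\<lambda>c. multi_id (on_color V c)) cs)"
      unfolding eqs eqf UG[OF d] by simp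
  qed
  ultimately show ?thesis unfolding lax_splitting_def by blast
qed

text \<open>
  Both sides are multilinear, and on homogeneous arguments both multiply the value of the operation by
  the sum of the degrees.
\<close>

lemma graded_leibniz:
  fixes As :: "('k::field, 'v) graded_data list"
  assumes As: "\<And>A. A \<in> set As \<Longrightarrow> graded_vs A" and B: "graded_vs B" and f: "f \<in> ops GrVect As B"
    and D: "\<And>i. i < length As \<Longrightarrow> D i \<in> lin (As ! i) (As ! i)"
      "\<And>i p x. \<lbrakk>i < length As; x \<in> grad (As ! i) p\<rbrakk> \<Longrightarrow> D i x = of_int p \<odot>\<^bsub>As ! i\<^esub> x"
    and DB: "DB \<in> lin B B" "\<And>p x. x \<in> grad B p \<Longrightarrow> DB x = of_int p \<odot>\<^bsub>B\<^esub> x"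
    and xs: "xs \<in> tuples As"
  shows "DB (f (pure_tensor As xs)) = leibniz B (\<lambda>xs. f (pure_tensor As xs)) D xs"
proof -
  have vA: "\<And>A. A \<in> set As \<Longrightarrow> vs A" using As graded_vs_vs by blast
  note vB = graded_vs_vs[OF B]
  have gs: "\<forall>A\<in>set As. vs A \<and> (\<forall>p. subsp (grad A p) A)" using As graded_vs_vs graded_vs_subsp by blast
  note iff = GrVect_ops_iff[OF gs vB graded_vs_subsp[OF B]]
  note f' = conjunct1[OF iffD1[OF iff f]] conjunct2[OF iffD1[OF iff f], rule_format]
  have m: "multilin As B (\<lambda>xs. f (pure_tensor As xs))"
    using f'(1) by (intro multilin_pure_tensor vA) (simp_all add: linear_maps_iff)
  have sub: "(\<Union>p. grad (As ! i) p) \<subseteq> carrier (As ! i)" if "i < length As" for i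
    using subsp_subset[OF graded_vs_subsp[OF As[OF nth_mem[OF that]]]] by blast
  show ?thesis
  proof (rule multilin_eq_on_span[where Ss = "map (\<lambda>A. \<Union>p. grad A p) As", OF _ _ vA vB _ _ _ _ xs])
    show "multilin As B (\<lambda>xs. DB (f (pure_tensor As xs)))" by (rule multilin_comp_lin[OF m DB(1)])
    show "multilin As B (leibniz B (\<lambda>xs. f (pure_tensor As xs)) D)"
      by (rule multilin_leibniz[OF m vA vB D(1)])
    show "map (\<lambda>A. \<Union>p. grad A p) As ! i \<subseteq> carrier (As ! i)" if "i < length As" for i
      using sub[OF that] that by simp
    show "carrier (As ! i) \<subseteq> vspan (As ! i) (map (\<lambda>A. \<Union>p. grad A p) As ! i)" if "i < length As" for i
      using graded_vs_span[OF As[OF nth_mem[OF that]]] that by simp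
    fix ys assume "ys \<in> listset (map (\<lambda>A. \<Union>p. grad A p) As)"
    then have len: "length ys = length As" and "\<forall>i<length As. \<exists>p. ys ! i \<in> grad (As ! i) p"
      by (auto simp: listset_iff)
    then obtain q where q: "\<forall>i<length As. ys ! i \<in> grad (As ! i) (q i)" by metis
    let ?is = "map q [0..<length As]"
    have "ys \<in> tuples As" using len q sub unfolding tuples_iff by blast
    have "f (pure_tensor As ys) \<in> grad B (sum_list ?is)" by (rule f'(2)) (use len q in simp_all)
    from DB(2)[OF this]
    have "DB (f (pure_tensor As ys)) = of_int (sum_list ?is) \<odot>\<^bsub>B\<^esub> f (pure_tensor As ys)" .
    also have "(of_int (sum_list ?is) :: 'k) = (\<Sum>i<length As. of_int (q i))"
      by (simp add: sum_list_sum_nth atLeast0LessThan)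
    also have "(\<Sum>i<length As. of_int (q i)) \<odot>\<^bsub>B\<^esub> f (pure_tensor As ys)
        = leibniz B (\<lambda>xs. f (pure_tensor As xs)) D ys"
      by (rule leibniz_eigen[OF m vB \<open>ys \<in> tuples As\<close>, symmetric]) (use D(2) q in simp)
    finally show "DB (f (pure_tensor As ys)) = leibniz B (\<lambda>xs. f (pure_tensor As xs)) D ys" .
  qed simp_all
qed

text \<open>
  Transport the Euler operators of the graded algebra along the isomorphism \<open>\<phi>\<close> with inverse \<open>\<psi>\<close>.  They
  satisfy the weight condition on homogeneous generators, since \<open>of_int (q - p)\<close> vanishes for \<open>q = p\<close>, and
  the Leibniz rule carries over because \<open>\<phi>\<close> commutes with the operations.
\<close>

theorem splitting_imp_derivation:
  fixes V :: "('c, 'o, ('k::field, 'v) filtered_data, ('v list \<Rightarrow> 'k) set \<Rightarrow> 'v) operad_map_data"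
  assumes V: "operad_map C FVect V" and split: "lax_splitting C V"
  obtains D where "weight_derivation C V D"
proof -
  interpret V: operad_map C FVect V by (rule V)
  obtain G where G: "operad_map C GrVect G" and iso: "operad_map_iso C FVect V (U_fil \<circ>\<^sub>o G)"
    using split unfolding lax_splitting_def by blast
  interpret G: operad_map C GrVect G by (rule G)
  let ?A = "on_color V" and ?B = "on_color (U_fil \<circ>\<^sub>o G)" and ?G = "on_color G"
  from iso obtain \<phi> where
    \<phi>: "\<And>c. c \<in> colors C \<Longrightarrow> \<phi> c \<in> ops FVect [?A c] (?B c)"
    and inv: "\<And>c. c \<in> colors C \<Longrightarrow> \<exists>\<psi>\<in>ops FVect [?B c] (?A c).
            op_comp FVect [[?A c]] [?B c] (?A c) \<psi> [\<phi> c] = op_id FVect (?A c) \<and>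
            op_comp FVect [[?B c]] [?A c] (?B c) (\<phi> c) [\<psi>] = op_id FVect (?B c)"
    and nat: "\<And>cs d f. \<lbrakk>cs \<in> lists (colors C); d \<in> colors C; f \<in> ops C cs d\<rbrakk> \<Longrightarrow>
         op_comp FVect [map ?A cs] [?A d] (?B d) (\<phi> d) [on_op V cs d f] =
         op_comp FVect (map (\<lambda>c. [?A c]) cs) (map ?B cs) (?B d)
           (on_op (U_fil \<circ>\<^sub>o G) cs d f) (map \<phi> cs)"
    unfolding operad_map_iso_def by blast
  from inv obtain \<psi> where \<psi>: "\<And>c. c \<in> colors C \<Longrightarrow> \<psi> c \<in> ops FVect [?B c] (?A c)"
    and \<psi>\<phi>: "\<And>c. c \<in> colors C \<Longrightarrow> multi_comp [[?A c]] [?B c] (?A c) (\<psi> c) [\<phi> c] = multi_id (?A c)"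
    and \<phi>\<psi>: "\<And>c. c \<in> colors C \<Longrightarrow> multi_comp [[?B c]] [?A c] (?B c) (\<phi> c) [\<psi> c] = multi_id (?B c)"
    unfolding FVect_simps by metis
  have tr: "module.truncate (?B c) = module.truncate (?G c)" for c
    unfolding operad_map_comp_def using truncate_U_fil by simp
  note eq = truncateD[OF tr]
  have opG: "on_op (U_fil \<circ>\<^sub>o G) cs d f = on_op G cs d f" for cs d f
    by (simp add: operad_map_comp_def)
  have fA: "filtered_module (?A c)" and vA: "vs (?A c)" if "c \<in> colors C" for c
    using V.on_color_closed[OF that] filtered_vs_module[of "?A c"] by (simp_all add: filtered_vs_def)
  have gG: "graded_vs (?G c)" if "c \<in> colors C" for c using G.on_color_closed[OF that] by simp
  have gsub: "(\<Union>q\<in>{..m}. grad (?G c) q) \<subseteq> carrier (?G c)" if "c \<in> colors C" for c m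
    using subsp_subset[OF graded_vs_subsp[OF gG[OF that]]] by blast
  have vB: "vs (?B c)" if "c \<in> colors C" for c
    by (rule vs_truncate[OF tr[symmetric] graded_vs_vs[OF gG[OF that]]])
  have filtB: "filt (?B c) m = vspan (?G c) (\<Union>q\<in>{..m}. grad (?G c) q)" for c m
    by (simp add: operad_map_comp_def U_fil_def)
  have fB: "filtered_module (?B c)" if "c \<in> colors C" for c
    unfolding filtered_module_def filtB
    using vB[OF that] subsp_truncate[OF tr[symmetric] subsp_span[OF graded_vs_vs[OF gG[OF that]] gsub[OF that]]]
    by blast
  define ph where "ph c x = \<phi> c (pure_tensor [?A c] [x])" for c x
  define ps where "ps c x = \<psi> c (pure_tensor [?B c] [x])" for c x
  have ph: "ph c \<in> lin (?A c) (?B c)" and ps: "ps c \<in> lin (?B c) (?A c)" if "c \<in> colors C" for c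
    unfolding ph_def ps_def using FVect_unary(1)[OF fA[OF that] fB[OF that] \<phi>[OF that]]
      FVect_unary(1)[OF fB[OF that] fA[OF that] \<psi>[OF that]] .
  have phG: "ph c \<in> lin (?A c) (?G c)" and psG: "ps c \<in> lin (?G c) (?A c)" if "c \<in> colors C" for c
    using ph[OF that] ps[OF that]
    unfolding lin_truncate[OF refl[of "module.truncate (?A c)"] tr[of c]]
      lin_truncate[OF tr[of c] refl[of "module.truncate (?A c)"]] .
  have \<phi>lin: "\<phi> c \<in> lin (tensor [?A c]) (?B c)" and \<psi>lin: "\<psi> c \<in> lin (tensor [?B c]) (?A c)"
    if "c \<in> colors C" for c
    using \<phi>[OF that] \<psi>[OF that] by (simp_all add: FVect_def linear_maps_iff)
  have ps_ph: "ps c (ph c x) = x" if c: "c \<in> colors C" and x: "x \<in> carrier (?A c)" for c x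
  proof -
    have "\<And>M. M \<in> set [?A c] \<Longrightarrow> vs M" and "[x] \<in> tuples [?A c]"
      using vA[OF c] x by (simp_all add: tuples_iff)
    from multi_comp_unary_pure[OF this(1) vB[OF c] vA[OF c] \<psi>lin[OF c] \<phi>lin[OF c] this(2)]
    show ?thesis unfolding \<psi>\<phi>[OF c] ps_def ph_def using multi_id_pure[OF vA[OF c] x] by simp
  qed
  have ph_ps: "ph c (ps c y) = y" if c: "c \<in> colors C" and y: "y \<in> carrier (?G c)" for c y
  proof -
    have y': "y \<in> carrier (?B c)" using y unfolding eq .
    have "\<And>M. M \<in> set [?B c] \<Longrightarrow> vs M" and "[y] \<in> tuples [?B c]"
      using vB[OF c] y' by (simp_all add: tuples_iff)
    from multi_comp_unary_pure[OF this(1) vA[OF c] vB[OF c] \<phi>lin[OF c] \<psi>lin[OF c] this(2)]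
    show ?thesis unfolding \<phi>\<psi>[OF c] ps_def ph_def using multi_id_pure[OF vB[OF c] y'] by simp
  qed
  have "\<exists>E. E \<in> lin (?G c) (?G c) \<and> (\<forall>p. \<forall>x\<in>grad (?G c) p. E x = of_int p \<odot>\<^bsub>?G c\<^esub> x)"
    if "c \<in> colors C" for c
    using euler_operator[OF gG[OF that]] by metis
  then obtain E where E: "\<And>c. c \<in> colors C \<Longrightarrow> E c \<in> lin (?G c) (?G c)"
    "\<And>c p x. \<lbrakk>c \<in> colors C; x \<in> grad (?G c) p\<rbrakk> \<Longrightarrow> E c x = of_int p \<odot>\<^bsub>?G c\<^esub> x"
    by metis
  define D where "D c x = ps c (E c (ph c x))" for c x
  have D: "D c \<in> lin (?A c) (?A c)" if "c \<in> colors C" for c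
    unfolding D_def by (rule lin_comp[OF lin_comp[OF phG[OF that] E(1)[OF that]] psG[OF that]])
  have "weight_derivation C V D"
    unfolding weight_derivation_def
  proof (intro conjI ballI)
    fix c assume c: "c \<in> colors C"
    note vG = graded_vs_vs[OF gG[OF c]] and sub = graded_vs_subsp[OF gG[OF c]]
    show "weight_operator (?A c) (filt (?A c)) (D c)"
      unfolding weight_operator_def
    proof (intro conjI allI ballI)
      show "D c \<in> lin (?A c) (?A c)" by (rule D[OF c])
      fix p x assume x: "x \<in> filt (?A c) p"
      then have xc: "x \<in> carrier (?A c)"
        using fA[OF c] subsp_subset[of "filt (?A c) p" "?A c"] unfolding filtered_module_def by blast
      let ?y = "ph c x" and ?T = "\<lambda>y. E c y \<oplus>\<^bsub>?G c\<^esub> (- of_int p) \<odot>\<^bsub>?G c\<^esub> y"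
      have T: "?T \<in> lin (?G c) (?G c)" by (rule lin_plus[OF E(1)[OF c] lin_scalar[OF vG] vG])
      have "?T ` vspan (?G c) (\<Union>q\<in>{..p}. grad (?G c) q) \<subseteq> vspan (?G c) (\<Union>q\<in>{..p-1}. grad (?G c) q)"
      proof (rule span_image_subset[OF T vG gsub[OF c] subsp_span[OF vG gsub[OF c]]])
        show "?T ` (\<Union>q\<in>{..p}. grad (?G c) q) \<subseteq> vspan (?G c) (\<Union>q\<in>{..p-1}. grad (?G c) q)"
        proof
          fix z assume "z \<in> ?T ` (\<Union>q\<in>{..p}. grad (?G c) q)"
          then obtain q y where y: "y \<in> grad (?G c) q" "q \<le> p" "z = ?T y" by blast
          have yc: "y \<in> carrier (?G c)" using y(1) subsp_subset[OF sub] by blast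
          have z: "z = of_int (q - p) \<odot>\<^bsub>?G c\<^esub> y"
            unfolding y(3) E(2)[OF c y(1)] vs_l_distr[OF vG yc, symmetric] by simp
          show "z \<in> vspan (?G c) (\<Union>q\<in>{..p-1}. grad (?G c) q)"
          proof (cases "q = p")
            case True
            then have "z = \<zero>\<^bsub>?G c\<^esub>" unfolding z using vs_smult_l_null[OF vG yc] by simp
            then show ?thesis using subsp_zero[OF subsp_span[OF vG gsub[OF c]]] by simp
          next
            case False
            then have "z \<in> grad (?G c) q" "q \<le> p - 1" unfolding z using subsp_smult[OF sub y(1)] y(2) by auto
            then show ?thesis using span_base[OF vG gsub[OF c]] by blast
          qed
        qed
      qed
      moreover have "?y \<in> filt (?B c) p"
        unfolding ph_def by (rule FVect_unary(2)[OF fA[OF c] fB[OF c] \<phi>[OF c] x])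
      ultimately have "?T ?y \<in> filt (?B c) (p - 1)" unfolding filtB by blast
      then have "ps c (?T ?y) \<in> filt (?A c) (p - 1)"
        unfolding ps_def by (rule FVect_unary(2)[OF fB[OF c] fA[OF c] \<psi>[OF c]])
      moreover have yc: "?y \<in> carrier (?G c)" by (rule lin_closed[OF phG[OF c] xc])
      have "ps c (?T ?y) = D c x \<oplus>\<^bsub>?A c\<^esub> (- of_int p) \<odot>\<^bsub>?A c\<^esub> x"
        unfolding lin_add[OF psG[OF c] lin_closed[OF E(1)[OF c] yc] vs_smult[OF vG yc]]
          lin_smult[OF psG[OF c] yc] ps_ph[OF c xc] D_def ..
      ultimately show "D c x \<oplus>\<^bsub>?A c\<^esub> (- of_int p) \<odot>\<^bsub>?A c\<^esub> x \<in> filt (?A c) (p - 1)" by simp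
    qed
  next
    fix cs d f xs
    assume cs: "cs \<in> lists (colors C)" and d: "d \<in> colors C" and f: "f \<in> ops C cs d"
      and xs: "xs \<in> tuples (map ?A cs)"
    have cc: "c \<in> colors C" if "c \<in> set cs" for c using cs that by auto
    have ci: "cs ! i \<in> colors C" if "i < length cs" for i using cc that by simp
    let ?g = "operation G cs d f"
    have trs: "map module.truncate (map ?B cs) = map module.truncate (map ?G cs)" using tr by simp
    have vAs: "\<And>M. M \<in> set (map ?A cs) \<Longrightarrow> vs M" using cc vA by auto
    have vcs: "vs (?A c)" "vs (?B c)" "\<phi> c \<in> lin (tensor [?A c]) (?B c)" if "c \<in> set cs" for c
      using vA vB \<phi>lin cc[OF that] by blast+
    have F: "on_op V cs d f \<in> lin (tensor (map ?A cs)) (?A d)"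
      using V.on_op_closed[OF cs d f] by (simp add: FVect_def linear_maps_iff)
    have Gf: "on_op G cs d f \<in> ops GrVect (map ?G cs) (?G d)" by (rule G.on_op_closed[OF cs d f])
    then have Glin: "on_op G cs d f \<in> linear_maps (tensor (map ?B cs)) (?B d)"
      unfolding tensor_maps_truncate[OF trs tr] by (simp add: GrVect_def)
    then have Glin': "on_op G cs d f \<in> lin (tensor (map ?B cs)) (?B d)" by (simp add: linear_maps_iff)
    have Fm: "multilin (map ?A cs) (?A d) (operation V cs d f)"
      unfolding operation_def by (rule multilin_pure_tensor[OF vAs F])
    have natural: "ph d (operation V cs d f zs) = ?g (map2 ph cs zs)" if zs: "zs \<in> tuples (map ?A cs)" for zs
    proof -
      have "multi_comp [map ?A cs] [?A d] (?B d) (\<phi> d) [on_op V cs d f] (pure_tensor (map ?A cs) zs)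
          = multi_comp (map (\<lambda>c. [?A c]) cs) (map ?B cs) (?B d) (on_op G cs d f) (map \<phi> cs) (pure_tensor (map ?A cs) zs)"
        using nat[OF cs d f] by (simp add: opG)
      also have "multi_comp [map ?A cs] [?A d] (?B d) (\<phi> d) [on_op V cs d f] (pure_tensor (map ?A cs) zs)
          = ph d (operation V cs d f zs)"
        unfolding ph_def operation_def
        by (rule multi_comp_unary_pure[OF vAs vA[OF d] vB[OF d] \<phi>lin[OF d] F zs])
      also have "multi_comp (map (\<lambda>c. [?A c]) cs) (map ?B cs) (?B d) (on_op G cs d f) (map \<phi> cs)
          (pure_tensor (map ?A cs) zs) = ?g (map2 ph cs zs)"
        unfolding ph_def operation_def pure_tensor_truncate[OF trs, symmetric]
        by (rule multi_comp_unaries[OF vcs(1,2) vB[OF d] Glin' vcs(3) zs])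
      finally show ?thesis .
    qed
    have len: "length xs = length cs" and xi: "\<And>i. i < length cs \<Longrightarrow> xs ! i \<in> carrier (?A (cs ! i))"
      using xs by (simp_all add: tuples_iff)
    let ?ys = "map2 ph cs xs"
    have ys: "?ys \<in> tuples (map ?G cs)"
      using len lin_closed[OF phG[OF ci] xi] by (simp add: tuples_iff)
    have gG': "\<And>A. A \<in> set (map ?G cs) \<Longrightarrow> graded_vs A" using cc gG by auto
    have E': "E (cs ! i) \<in> lin (map ?G cs ! i) (map ?G cs ! i)" if "i < length (map ?G cs)" for i
      using E(1)[OF ci] that by simp
    have E'': "E (cs ! i) x = of_int p \<odot>\<^bsub>map ?G cs ! i\<^esub> x"
      if "i < length (map ?G cs)" "x \<in> grad (map ?G cs ! i) p" for i x p
      using E(2)[OF ci] that by simp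
    have leib: "E d (?g ?ys) = leibniz (?G d) ?g (\<lambda>i. E (cs ! i)) ?ys"
      unfolding operation_def
      by (rule graded_leibniz[where D = "\<lambda>i. E (cs ! i)", OF gG' gG[OF d] Gf E' E'' E(1)[OF d] E(2)[OF d] ys])
    have mg: "multilin (map ?G cs) (?G d) ?g"
      unfolding operation_def
      by (rule multilin_pure_tensor) (use gG' graded_vs_vs Gf in \<open>auto simp: GrVect_def linear_maps_iff\<close>)
    \<comment> \<open>\<open>ph (D x) = E (ph x)\<close>, since \<open>ph\<close> and \<open>ps\<close> are inverse to each other\<close>
    have summand: "ps d (?g (?ys[i := E (cs ! i) (?ys ! i)])) = operation V cs d f (xs[i := D (cs ! i) (xs ! i)])"
      if i: "i < length cs" for i
    proof -
      have Dx: "D (cs ! i) (xs ! i) \<in> carrier (?A (cs ! i))" by (rule lin_closed[OF D[OF ci[OF i]] xi[OF i]])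
      have up: "xs[i := D (cs ! i) (xs ! i)] \<in> tuples (map ?A cs)"
        by (rule tuples_update[OF xs]) (use i Dx in simp_all)
      have Ey: "E (cs ! i) (?ys ! i) \<in> carrier (?G (cs ! i))"
        using lin_closed[OF E(1)[OF ci[OF i]] lin_closed[OF phG[OF ci[OF i]] xi[OF i]]] i len by simp
      have "ph (cs ! i) (D (cs ! i) (xs ! i)) = E (cs ! i) (?ys ! i)"
        using ph_ps[OF ci[OF i] Ey] i len by (simp add: D_def)
      then have "map2 ph cs (xs[i := D (cs ! i) (xs ! i)]) = ?ys[i := E (cs ! i) (?ys ! i)]"
        using i len by (intro nth_equalityI) (auto simp: nth_list_update)
      with natural[OF up] show ?thesis
        using ps_ph[OF d multilin_closed[OF Fm up]] by simp
    qed
    have "D d (operation V cs d f xs) = ps d (leibniz (?G d) ?g (\<lambda>i. E (cs ! i)) ?ys)"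
      unfolding D_def natural[OF xs] leib ..
    also have "\<dots> = finsum (?A d) (\<lambda>i. ps d (?g (?ys[i := E (cs ! i) (?ys ! i)]))) {..<length ?ys}"
      unfolding leibniz_def
    proof (rule lin_finsum[OF psG[OF d] graded_vs_vs[OF gG[OF d]] vA[OF d] finite_lessThan])
      fix i assume "i \<in> {..<length ?ys}"
      then have i: "i < length (map ?G cs)" using len by simp
      show "?g (?ys[i := E (cs ! i) (?ys ! i)]) \<in> carrier (?G d)"
        by (rule multilin_closed[OF mg tuples_update[OF ys i lin_closed[OF E'[OF i] tuples_nth[OF ys i]]]])
    qed
    also have "\<dots> = leibniz (?A d) (operation V cs d f) (\<lambda>i. D (cs ! i)) xs"
      unfolding leibniz_def
    proof (rule finsum_cong_vs[OF vA[OF d]])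
      show "{..<length ?ys} = {..<length xs}" using len by simp
      fix i assume "i \<in> {..<length xs}"
      then have i: "i < length cs" using len by simp
      show "ps d (?g (?ys[i := E (cs ! i) (?ys ! i)])) = operation V cs d f (xs[i := D (cs ! i) (xs ! i)])"
        by (rule summand[OF i])
      have "xs[i := D (cs ! i) (xs ! i)] \<in> tuples (map ?A cs)"
        by (rule tuples_update[OF xs]) (use i lin_closed[OF D[OF ci[OF i]] xi[OF i]] in simp_all)
      then show "operation V cs d f (xs[i := D (cs ! i) (xs ! i)]) \<in> carrier (?A d)"
        by (rule multilin_closed[OF Fm])
    qed
    finally show "D d (operation V cs d f xs)
        = leibniz (?A d) (operation V cs d f) (\<lambda>i. D (cs ! i)) xs" .
  qed
  then show ?thesis by (rule that)
qed

section \<open>Extension of scalars\<close>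

text \<open>
  Extend the single vector \<open>1\<close> to a basis of the extension field over the base field.
\<close>

lemma functional_retraction:
  fixes \<iota> :: "'k::field \<Rightarrow> 'l::field"
  assumes "field_hom \<iota>"
  obtains r where "\<And>x y. r (x + y) = r x + r y" "\<And>a y. r (\<iota> a * y) = a * r y" "r 1 = (1::'k)"
proof -
  interpret \<iota>: field_hom \<iota> by fact
  interpret vp: vector_space_pair "\<lambda>a y. \<iota> a * y" "(*) :: 'k \<Rightarrow> 'k \<Rightarrow> 'k"
    by unfold_locales (simp_all add: algebra_simps \<iota>.hom_add \<iota>.hom_mult)
  have "vp.vs1.independent {1}" by simp
  from vp.linear_independent_extend[OF this, of "\<lambda>_. 1"]
  obtain g where g: "Vector_Spaces.linear (\<lambda>a y. \<iota> a * y) (*) g" "g 1 = 1" by auto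
  show ?thesis
    using that[of g] g(2) vp.linear_add[OF g(1)] vp.linear_scale[OF g(1)] by blast
qed

lemma field_as_vs_simps [simp]:
  "carrier (field_as_vs \<iota>) = UNIV" "x \<oplus>\<^bsub>field_as_vs \<iota>\<^esub> y = x + y" "\<zero>\<^bsub>field_as_vs \<iota>\<^esub> = 0"
  "a \<odot>\<^bsub>field_as_vs \<iota>\<^esub> x = \<iota> a * x"
  by (simp_all add: field_as_vs_def)

definition bilin ::
  "('k::field \<Rightarrow> 'l::field) \<Rightarrow> ('k, 'v, 'm) module_scheme \<Rightarrow> ('k, 'w, 'n) module_scheme \<Rightarrow> ('v \<Rightarrow> 'l \<Rightarrow> 'w) \<Rightarrow> bool" where
  "bilin \<iota> A N b \<longleftrightarrow>
    (\<forall>x\<in>carrier A. \<forall>y. b x y \<in> carrier N) \<and>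
    (\<forall>x\<in>carrier A. \<forall>x'\<in>carrier A. \<forall>y. b (x \<oplus>\<^bsub>A\<^esub> x') y = b x y \<oplus>\<^bsub>N\<^esub> b x' y) \<and>
    (\<forall>x\<in>carrier A. \<forall>y y'. b x (y + y') = b x y \<oplus>\<^bsub>N\<^esub> b x y') \<and>
    (\<forall>a. \<forall>x\<in>carrier A. \<forall>y. b (a \<odot>\<^bsub>A\<^esub> x) y = a \<odot>\<^bsub>N\<^esub> b x y) \<and>
    (\<forall>a. \<forall>x\<in>carrier A. \<forall>y. b x (\<iota> a * y) = a \<odot>\<^bsub>N\<^esub> b x y)"

lemma
  assumes "bilin \<iota> A N b" "x \<in> carrier A"
  shows bilin_closed: "b x y \<in> carrier N"
    and bilin_add_left: "x' \<in> carrier A \<Longrightarrow> b (x \<oplus>\<^bsub>A\<^esub> x') y = b x y \<oplus>\<^bsub>N\<^esub> b x' y"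
    and bilin_add_right: "b x (y + y') = b x y \<oplus>\<^bsub>N\<^esub> b x y'"
    and bilin_smult_left: "b (a \<odot>\<^bsub>A\<^esub> x) y = a \<odot>\<^bsub>N\<^esub> b x y"
    and bilin_smult_right: "b x (\<iota> a * y) = a \<odot>\<^bsub>N\<^esub> b x y"
  using assms unfolding bilin_def by blast+

context
  fixes \<iota> :: "'k::field \<Rightarrow> 'l::field" and A :: "('k, 'v, 'm) module_scheme"
  assumes vA: "vs A"
begin

lemma tensor2_relations_cases:
  assumes "r \<in> tensor2_relations A (field_as_vs \<iota>)"
  obtains
    x x' y where "r = (\<lambda>z. single (x \<oplus>\<^bsub>A\<^esub> x', y) z - single (x, y) z - single (x', y) z)"
      "x \<in> carrier A" "x' \<in> carrier A"
  | x y y' where "r = (\<lambda>z. single (x, y + y') z - single (x, y) z - single (x, y') z)" "x \<in> carrier A"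
  | a x y where "r = (\<lambda>z. single (a \<odot>\<^bsub>A\<^esub> x, y) z - a * single (x, y) z)" "x \<in> carrier A"
  | a x y where "r = (\<lambda>z. single (x, \<iota> a * y) z - a * single (x, y) z)" "x \<in> carrier A"
  using assms unfolding tensor2_relations_def field_as_vs_simps by blast

lemma tensor2_relations_intros:
  assumes x: "x \<in> carrier A"
  shows "x' \<in> carrier A \<Longrightarrow> (\<lambda>z. single (x \<oplus>\<^bsub>A\<^esub> x', y) z - single (x, y) z - single (x', y) z)
      \<in> tensor2_relations A (field_as_vs \<iota>)"
    and "(\<lambda>z. single (x, y + y') z - single (x, y) z - single (x, y') z) \<in> tensor2_relations A (field_as_vs \<iota>)"
    and "(\<lambda>z. single (a \<odot>\<^bsub>A\<^esub> x, y) z - a * single (x, y) z) \<in> tensor2_relations A (field_as_vs \<iota>)"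
    and "(\<lambda>z. single (x, \<iota> a * y) z - a * single (x, y) z) \<in> tensor2_relations A (field_as_vs \<iota>)"
  unfolding tensor2_relations_def field_as_vs_simps using x by blast+

lemma tensor2_relations_closed:
  "tensor2_relations A (field_as_vs \<iota>) \<subseteq> carrier (free_vs (carrier A \<times> UNIV))"
proof
  fix r assume "r \<in> tensor2_relations A (field_as_vs \<iota>)"
  then show "r \<in> carrier (free_vs (carrier A \<times> UNIV))"
  proof (cases rule: tensor2_relations_cases)
    case (1 x x' y)
    then show ?thesis using vA unfolding 1(1)
      by (intro lin_free_additive(1)[OF lin_id free_vs_vs]) auto
  next
    case (2 x y y')
    then show ?thesis unfolding 2(1)
      by (intro lin_free_additive(1)[OF lin_id free_vs_vs]) auto
  next
    case (3 a x y)
    then show ?thesis using vA unfolding 3(1)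
      by (intro lin_free_homogeneous(1)[OF lin_id free_vs_vs]) auto
  next
    case (4 a x y)
    then show ?thesis unfolding 4(1)
      by (intro lin_free_homogeneous(1)[OF lin_id free_vs_vs]) auto
  qed
qed

lemma tensor2_presented:
  "tensor2 A (field_as_vs \<iota>) = presented_vs (carrier A \<times> UNIV) (tensor2_relations A (field_as_vs \<iota>))"
  by (simp only: tensor2_def tensor2_kernel_def field_as_vs_simps)

lemma pure2_generator:
  "pure2 A (field_as_vs \<iota>) x y = generator (carrier A \<times> UNIV) (tensor2_relations A (field_as_vs \<iota>)) (x, y)"
  by (simp only: pure2_def tensor2_kernel_def field_as_vs_simps)

text \<open>
  As for multilinear maps, one direction shows that \<^const>\<open>pure2\<close> is bilinear and the other one that
  bilinear maps descend to the tensor product.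
\<close>

lemma null_relations2_iff_bilin:
  assumes F: "F \<in> lin (free_vs (carrier A \<times> UNIV)) N" and N: "vs N"
  shows "(\<forall>r\<in>tensor2_relations A (field_as_vs \<iota>). F r = \<zero>\<^bsub>N\<^esub>) \<longleftrightarrow> bilin \<iota> A N (\<lambda>x y. F (single (x, y)))"
proof
  note add = lin_free_additive(2)[OF F N] and hom = lin_free_homogeneous(2)[OF F N]
  {
    assume null: "\<forall>r\<in>tensor2_relations A (field_as_vs \<iota>). F r = \<zero>\<^bsub>N\<^esub>"
    show "bilin \<iota> A N (\<lambda>x y. F (single (x, y)))"
      unfolding bilin_def
    proof (intro conjI ballI allI)
      fix x x' y y' a assume x: "x \<in> carrier A"
      show "F (single (x, y)) \<in> carrier N" using x by (intro lin_closed[OF F]) simp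
      show "F (single (x, y + y')) = F (single (x, y)) \<oplus>\<^bsub>N\<^esub> F (single (x, y'))"
        using null tensor2_relations_intros(2)[OF x, of y y'] x by (intro add[THEN iffD1]) auto
      show "F (single (a \<odot>\<^bsub>A\<^esub> x, y)) = a \<odot>\<^bsub>N\<^esub> F (single (x, y))"
        using null tensor2_relations_intros(3)[OF x, of a y] x vA by (intro hom[THEN iffD1]) auto
      show "F (single (x, \<iota> a * y)) = a \<odot>\<^bsub>N\<^esub> F (single (x, y))"
        using null tensor2_relations_intros(4)[OF x, of a y] x by (intro hom[THEN iffD1]) auto
      assume x': "x' \<in> carrier A"
      show "F (single (x \<oplus>\<^bsub>A\<^esub> x', y)) = F (single (x, y)) \<oplus>\<^bsub>N\<^esub> F (single (x', y))"
        using null tensor2_relations_intros(1)[OF x x', of y] x x' vA by (intro add[THEN iffD1]) auto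
    qed
  }
  assume b: "bilin \<iota> A N (\<lambda>x y. F (single (x, y)))"
  show "\<forall>r\<in>tensor2_relations A (field_as_vs \<iota>). F r = \<zero>\<^bsub>N\<^esub>"
  proof
    fix r assume "r \<in> tensor2_relations A (field_as_vs \<iota>)"
    then show "F r = \<zero>\<^bsub>N\<^esub>"
    proof (cases rule: tensor2_relations_cases)
      case (1 x x' y)
      then show ?thesis unfolding 1(1) using b[unfolded bilin_def] vA by (intro add[THEN iffD2]) auto
    next
      case (2 x y y')
      then show ?thesis unfolding 2(1) using b[unfolded bilin_def] by (intro add[THEN iffD2]) auto
    next
      case (3 a x y)
      then show ?thesis unfolding 3(1) using b[unfolded bilin_def] vA by (intro hom[THEN iffD2]) auto
    next
      case (4 a x y)
      then show ?thesis unfolding 4(1) using b[unfolded bilin_def] by (intro hom[THEN iffD2]) auto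
    qed
  qed
qed

lemma tensor2_vs: "vs (tensor2 A (field_as_vs \<iota>))"
  unfolding tensor2_presented by (rule presented_vs_vs[OF tensor2_relations_closed])

lemma pure2_bilin: "bilin \<iota> A (tensor2 A (field_as_vs \<iota>)) (pure2 A (field_as_vs \<iota>))"
proof -
  have sub: "subsp (vspan (free_vs (carrier A \<times> UNIV)) (tensor2_relations A (field_as_vs \<iota>))) (free_vs (carrier A \<times> UNIV))"
    by (rule subsp_span[OF free_vs_vs tensor2_relations_closed])
  have "bilin \<iota> A (tensor2 A (field_as_vs \<iota>)) (\<lambda>x y. pure2 A (field_as_vs \<iota>) x y)"
    unfolding tensor2_presented pure2_generator
    by (rule iffD1[OF null_relations2_iff_bilin[OF coset_lin[OF sub] quotient_vs_vs[OF sub]]])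
      (intro ballI relation_null[OF tensor2_relations_closed])
  then show ?thesis .
qed

lemma pure2_image: "generator (carrier A \<times> UNIV) (tensor2_relations A (field_as_vs \<iota>)) ` (carrier A \<times> UNIV)
    = {pure2 A (field_as_vs \<iota>) x y | x y. x \<in> carrier A}"
proof -
  have "generator (carrier A \<times> UNIV) (tensor2_relations A (field_as_vs \<iota>)) z = pure2 A (field_as_vs \<iota>) (fst z) (snd z)" for z
    unfolding pure2_generator prod.collapse ..
  then have "generator (carrier A \<times> UNIV) (tensor2_relations A (field_as_vs \<iota>)) ` (carrier A \<times> UNIV)
      = (\<lambda>z. pure2 A (field_as_vs \<iota>) (fst z) (snd z)) ` (carrier A \<times> UNIV)" by (rule image_cong[OF refl])
  also have "(\<lambda>z. h (fst z) (snd z)) ` (carrier A \<times> UNIV) = {h x y | x y. x \<in> carrier A}"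
    for h :: "'v \<Rightarrow> 'l \<Rightarrow> ('v \<times> 'l \<Rightarrow> 'k) set" by force
  finally show ?thesis .
qed

lemma tensor2_span: "vspan (tensor2 A (field_as_vs \<iota>)) {pure2 A (field_as_vs \<iota>) x y | x y. x \<in> carrier A} = carrier (tensor2 A (field_as_vs \<iota>))"
  using presented_vs_span[OF tensor2_relations_closed]
  unfolding tensor2_presented[symmetric] pure2_image .

lemma tensor2_ext:
  fixes N :: "('k, 'w, 'n) module_scheme"
  assumes N: "vs N" and b: "bilin \<iota> A N b"
  shows "\<exists>!h. h \<in> linear_maps (tensor2 A (field_as_vs \<iota>)) N \<and> (\<forall>x\<in>carrier A. \<forall>y. h (pure2 A (field_as_vs \<iota>) x y) = b x y)"
proof -
  let ?X = "carrier A \<times> (UNIV :: 'l set)" and ?b = "\<lambda>z. b (fst z) (snd z)"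
  have cl: "?b z \<in> carrier N" if "z \<in> ?X" for z using that b unfolding bilin_def by auto
  have lin: "free_ext N ?b \<in> lin (free_vs ?X) N" using cl by (rule free_ext_lin[OF N])
  have eq: "free_ext N ?b (single (x, y)) = b x y" if "x \<in> carrier A" for x y
    using free_ext_single[where X = ?X and g = ?b and x = "(x, y)", OF N] cl that by simp
  have "bilin \<iota> A N (\<lambda>x y. free_ext N ?b (single (x, y)))"
    using b vA unfolding bilin_def by (simp add: eq)
  then have "free_ext N ?b r = \<zero>\<^bsub>N\<^esub>" if "r \<in> tensor2_relations A (field_as_vs \<iota>)" for r
    using that iffD2[OF null_relations2_iff_bilin[OF lin N]] by blast
  from presented_vs_ext[where g = ?b, OF tensor2_relations_closed N cl this]
  have "\<exists>!h. h \<in> linear_maps (tensor2 A (field_as_vs \<iota>)) N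
      \<and> (\<forall>z\<in>?X. h (generator ?X (tensor2_relations A (field_as_vs \<iota>)) z) = ?b z)"
    unfolding tensor2_presented by blast
  moreover have "(\<forall>z\<in>?X. h (generator ?X (tensor2_relations A (field_as_vs \<iota>)) z) = ?b z)
      \<longleftrightarrow> (\<forall>x\<in>carrier A. \<forall>y. h (pure2 A (field_as_vs \<iota>) x y) = b x y)" for h :: "('v \<times> 'l \<Rightarrow> 'k) set \<Rightarrow> 'w"
    unfolding pure2_generator by auto
  ultimately show ?thesis by simp
qed

end

text \<open>
  The map \<open>x \<mapsto> x \<otimes> 1\<close>.  It is semilinear and its image spans, so that the whole structure of the extended
  spaces is controlled by their elements of this form.
\<close>

definition incl :: "('k::field \<Rightarrow> 'l::field) \<Rightarrow> ('k, 'v, 'm) module_scheme \<Rightarrow> 'v \<Rightarrow> ('v \<times> 'l \<Rightarrow> 'k) set" where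
  "incl \<iota> A x = pure2 A (field_as_vs \<iota>) x 1"

definition semilin ::
  "('k::field \<Rightarrow> 'l::field) \<Rightarrow> ('k, 'v, 'm) module_scheme \<Rightarrow> ('l, 'w, 'n) module_scheme \<Rightarrow> ('v \<Rightarrow> 'w) \<Rightarrow> bool" where
  "semilin \<iota> A N g \<longleftrightarrow> (\<forall>x\<in>carrier A. g x \<in> carrier N) \<and>
    (\<forall>x\<in>carrier A. \<forall>y\<in>carrier A. g (x \<oplus>\<^bsub>A\<^esub> y) = g x \<oplus>\<^bsub>N\<^esub> g y) \<and>
    (\<forall>a. \<forall>x\<in>carrier A. g (a \<odot>\<^bsub>A\<^esub> x) = \<iota> a \<odot>\<^bsub>N\<^esub> g x)"

lemma
  assumes "semilin \<iota> A N g" "x \<in> carrier A"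
  shows semilin_closed: "g x \<in> carrier N"
    and semilin_add: "y \<in> carrier A \<Longrightarrow> g (x \<oplus>\<^bsub>A\<^esub> y) = g x \<oplus>\<^bsub>N\<^esub> g y"
    and semilin_smult: "g (a \<odot>\<^bsub>A\<^esub> x) = \<iota> a \<odot>\<^bsub>N\<^esub> g x"
  using assms unfolding semilin_def by blast+

lemma semilinI:
  assumes "\<And>x. x \<in> carrier A \<Longrightarrow> g x \<in> carrier N"
    "\<And>x y. \<lbrakk>x \<in> carrier A; y \<in> carrier A\<rbrakk> \<Longrightarrow> g (x \<oplus>\<^bsub>A\<^esub> y) = g x \<oplus>\<^bsub>N\<^esub> g y"
    "\<And>a x. x \<in> carrier A \<Longrightarrow> g (a \<odot>\<^bsub>A\<^esub> x) = \<iota> a \<odot>\<^bsub>N\<^esub> g x"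
  shows "semilin \<iota> A N g"
  unfolding semilin_def using assms by blast

context
  fixes \<iota> :: "'k::field \<Rightarrow> 'l::field"
  assumes \<iota>: "field_hom \<iota>"
begin

interpretation \<iota>: field_hom \<iota> by (rule \<iota>)

text \<open>
  Restriction of scalars, for the maps below that are linear over the small field only.
\<close>

definition restrict_scalars :: "('l, 'w, 'n) module_scheme \<Rightarrow> ('k, 'w) module" where
  "restrict_scalars N = \<lparr>carrier = carrier N, mult = undefined, one = undefined, zero = zero N,
     add = add N, smult = (\<lambda>a. smult N (\<iota> a))\<rparr>"

lemma restrict_scalars_simps [simp]:
  "carrier (restrict_scalars N) = carrier N" "\<zero>\<^bsub>restrict_scalars N\<^esub> = \<zero>\<^bsub>N\<^esub>"
  "x \<oplus>\<^bsub>restrict_scalars N\<^esub> y = x \<oplus>\<^bsub>N\<^esub> y" "a \<odot>\<^bsub>restrict_scalars N\<^esub> x = \<iota> a \<odot>\<^bsub>N\<^esub> x"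
  by (simp_all add: restrict_scalars_def)

lemma restrict_scalars_vs:
  assumes "vs N"
  shows "vs (restrict_scalars N)"
  by (rule vsI; (unfold restrict_scalars_simps)?)
    (use assms in \<open>simp_all add: vs_ac vs_l_distr vs_r_distr vs_smult_assoc \<iota>.hom_add \<iota>.hom_mult\<close>)

lemma restrict_scalars_lin: "h \<in> lin M N \<Longrightarrow> h \<in> lin (restrict_scalars M) (restrict_scalars N)"
  by (rule linI) (simp_all add: lin_closed lin_add lin_smult)

context
  fixes A :: "('k, 'v) filtered_data"
  assumes vA: "vs A"
begin

private abbreviation (input) "L \<equiv> field_as_vs \<iota>"
private abbreviation (input) "T \<equiv> tensor2 A L"
private abbreviation (input) "S \<equiv> scalar_ext \<iota> A"

lemmas pure2_closed = bilin_closed[OF pure2_bilin[OF vA, of \<iota>]]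
  and pure2_add_left = bilin_add_left[OF pure2_bilin[OF vA, of \<iota>]]
  and pure2_add_right = bilin_add_right[OF pure2_bilin[OF vA, of \<iota>]]
  and pure2_smult_left = bilin_smult_left[OF pure2_bilin[OF vA, of \<iota>]]
  and pure2_smult_right = bilin_smult_right[OF pure2_bilin[OF vA, of \<iota>]]

lemma pures_closed: "{pure2 A L x y | x y. x \<in> carrier A} \<subseteq> carrier T"
  using pure2_closed by blast

lemma scalar_ext_simps:
  "carrier S = carrier T" "\<zero>\<^bsub>S\<^esub> = \<zero>\<^bsub>T\<^esub>" "add S = add T"
  "filt S p = vspan T {pure2 A L x y | x y. x \<in> filt A p}"
  by (simp_all add: scalar_ext_def Let_def)

lemma tensor2_lin_eqI:
  assumes "f \<in> lin T N" "g \<in> lin T N" "vs N" "\<And>x y. x \<in> carrier A \<Longrightarrow> f (pure2 A L x y) = g (pure2 A L x y)"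
    "t \<in> carrier T"
  shows "f t = g t"
proof (rule lin_eq_on_span[OF assms(1,2) tensor2_vs[OF vA] assms(3) pures_closed])
  show "t \<in> vspan T {pure2 A L x y | x y. x \<in> carrier A}" using assms(5) unfolding tensor2_span[OF vA] .
qed (use assms(4) in blast)

lemma smult_scalar_ext_lin: "smult S l \<in> lin T T"
  and smult_scalar_ext: "x \<in> carrier A \<Longrightarrow> l \<odot>\<^bsub>S\<^esub> pure2 A L x y = pure2 A L x (l * y)"
proof -
  have "bilin \<iota> A T (\<lambda>x y. pure2 A L x (l * y))"
    unfolding bilin_def
    by (simp add: pure2_closed pure2_add_left pure2_add_right pure2_smult_left distrib_left
        mult.left_commute[of l] pure2_smult_right)
  from theI'[OF tensor2_ext[OF vA tensor2_vs[OF vA] this]]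
  have "smult S l \<in> linear_maps T T \<and> (\<forall>x\<in>carrier A. \<forall>y. l \<odot>\<^bsub>S\<^esub> pure2 A L x y = pure2 A L x (l * y))"
    by (simp add: scalar_ext_def Let_def)
  then show "smult S l \<in> lin T T" "x \<in> carrier A \<Longrightarrow> l \<odot>\<^bsub>S\<^esub> pure2 A L x y = pure2 A L x (l * y)"
    by (simp_all add: linear_maps_iff)
qed

lemma smult_scalar_ext_restrict:
  assumes "t \<in> carrier T"
  shows "\<iota> a \<odot>\<^bsub>S\<^esub> t = a \<odot>\<^bsub>T\<^esub> t"
  by (rule tensor2_lin_eqI[OF smult_scalar_ext_lin lin_scalar[OF tensor2_vs[OF vA]] tensor2_vs[OF vA] _ assms])
    (simp add: smult_scalar_ext pure2_smult_right)

lemma scalar_ext_vs: "vs S"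
proof (rule vsI; (unfold scalar_ext_simps)?)
  note T = tensor2_vs[OF vA, of \<iota>]
  note m = smult_scalar_ext_lin
  show "\<zero>\<^bsub>T\<^esub> \<in> carrier T" using T by simp
  fix x y z l l' assume x: "x \<in> carrier T"
  show "l \<odot>\<^bsub>S\<^esub> x \<in> carrier T" by (rule lin_closed[OF m x])
  show "x \<oplus>\<^bsub>T\<^esub> \<zero>\<^bsub>T\<^esub> = x" using T x by simp
  show "(l + l') \<odot>\<^bsub>S\<^esub> x = l \<odot>\<^bsub>S\<^esub> x \<oplus>\<^bsub>T\<^esub> l' \<odot>\<^bsub>S\<^esub> x"
    by (rule tensor2_lin_eqI[OF m lin_plus[OF m m T] T _ x])
      (simp add: smult_scalar_ext pure2_add_right distrib_right)
  show "(l * l') \<odot>\<^bsub>S\<^esub> x = l \<odot>\<^bsub>S\<^esub> (l' \<odot>\<^bsub>S\<^esub> x)"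
    by (rule tensor2_lin_eqI[OF m lin_comp[OF m m] T _ x]) (simp add: smult_scalar_ext mult.assoc)
  show "1 \<odot>\<^bsub>S\<^esub> x = x"
    by (rule tensor2_lin_eqI[OF m lin_id T _ x]) (simp add: smult_scalar_ext)
  show "0 \<odot>\<^bsub>S\<^esub> x = \<zero>\<^bsub>T\<^esub>"
    using smult_scalar_ext_restrict[OF x, of 0] T x by simp
  assume y: "y \<in> carrier T"
  show "x \<oplus>\<^bsub>T\<^esub> y \<in> carrier T" using T x y by simp
  show "x \<oplus>\<^bsub>T\<^esub> y = y \<oplus>\<^bsub>T\<^esub> x" by (rule vs_comm[OF T x y])
  show "l \<odot>\<^bsub>S\<^esub> (x \<oplus>\<^bsub>T\<^esub> y) = l \<odot>\<^bsub>S\<^esub> x \<oplus>\<^bsub>T\<^esub> l \<odot>\<^bsub>S\<^esub> y" by (rule lin_add[OF m x y])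
  assume z: "z \<in> carrier T"
  show "x \<oplus>\<^bsub>T\<^esub> y \<oplus>\<^bsub>T\<^esub> z = x \<oplus>\<^bsub>T\<^esub> (y \<oplus>\<^bsub>T\<^esub> z)" by (rule vs_assoc[OF T x y z])
qed

text \<open>
  On \<open>A \<otimes> 'l\<close> the scalars of the small field act in the same way through \<open>\<iota>\<close> as in the tensor product.
\<close>

lemma scalar_ext_lin_restrict: "lin T N = lin (restrict_scalars S) N"
proof -
  have "smult T a t = smult (restrict_scalars S) a t" if "t \<in> carrier T" for a t
    using smult_scalar_ext_restrict[OF that] by simp
  moreover have "carrier T = carrier (restrict_scalars S)" "add T = add (restrict_scalars S)"
    by (simp_all add: scalar_ext_simps restrict_scalars_def)
  ultimately show ?thesis unfolding LinearCombinations.module_hom_def by auto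
qed

lemma scalar_ext_subsp:
  assumes "subsp W S"
  shows "subsp W T"
proof (rule subspI[OF tensor2_vs[OF vA]])
  show "W \<subseteq> carrier T" "\<zero>\<^bsub>T\<^esub> \<in> W"
    using subsp_subset[OF assms] subsp_zero[OF assms] unfolding scalar_ext_simps .
  fix x y a assume x: "x \<in> W"
  then have "x \<in> carrier T" using \<open>W \<subseteq> carrier T\<close> by blast
  then show "a \<odot>\<^bsub>T\<^esub> x \<in> W" using subsp_smult[OF assms x, of "\<iota> a"] smult_scalar_ext_restrict by simp
  assume "y \<in> W"
  with x show "x \<oplus>\<^bsub>T\<^esub> y \<in> W" using subsp_add[OF assms] unfolding scalar_ext_simps by blast
qed

lemma pure2_eq_smult_incl: "x \<in> carrier A \<Longrightarrow> pure2 A L x y = y \<odot>\<^bsub>S\<^esub> incl \<iota> A x"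
  unfolding incl_def by (simp add: smult_scalar_ext)

lemma incl_semilin: "semilin \<iota> A S (incl \<iota> A)"
proof (rule semilinI)
  fix x y a assume x: "x \<in> carrier A"
  show "incl \<iota> A x \<in> carrier S" unfolding incl_def scalar_ext_simps by (rule pure2_closed[OF x])
  show "incl \<iota> A (a \<odot>\<^bsub>A\<^esub> x) = \<iota> a \<odot>\<^bsub>S\<^esub> incl \<iota> A x"
    unfolding incl_def smult_scalar_ext_restrict[OF pure2_closed[OF x]] by (rule pure2_smult_left[OF x])
  assume y: "y \<in> carrier A"
  show "incl \<iota> A (x \<oplus>\<^bsub>A\<^esub> y) = incl \<iota> A x \<oplus>\<^bsub>S\<^esub> incl \<iota> A y"
    unfolding incl_def scalar_ext_simps by (rule pure2_add_left[OF x y])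
qed

lemma incl_closed: "x \<in> carrier A \<Longrightarrow> incl \<iota> A x \<in> carrier S"
  by (rule semilin_closed[OF incl_semilin])

lemma incl_zero: "incl \<iota> A \<zero>\<^bsub>A\<^esub> = \<zero>\<^bsub>S\<^esub>"
  using semilin_smult[OF incl_semilin vs_zero[OF vA], of 0] incl_closed[OF vs_zero[OF vA]] scalar_ext_vs vA
  by simp

text \<open>
  The filtration of \<^const>\<open>scalar_ext\<close> is defined by spans over the small field.  They are already
  subspaces over the large one, because scalar multiplication maps generators \<open>x \<otimes> y\<close> to generators.
\<close>

lemma span_incl:
  assumes "P \<subseteq> carrier A"
  shows "vspan T {pure2 A L x y | x y. x \<in> P} = vspan S (incl \<iota> A ` P)"
proof
  let ?P = "{pure2 A L x y | x y. x \<in> P}"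
  have P: "?P \<subseteq> carrier T" using assms pure2_closed by blast
  have I: "incl \<iota> A ` P \<subseteq> carrier S" using assms incl_closed by blast
  note T = tensor2_vs[OF vA, of \<iota>] and S = scalar_ext_vs
  show "vspan T ?P \<subseteq> vspan S (incl \<iota> A ` P)"
  proof (rule span_least[OF T P scalar_ext_subsp[OF subsp_span[OF S I]]])
    have "pure2 A L x y \<in> vspan S (incl \<iota> A ` P)" if x: "x \<in> P" for x y
    proof -
      have "x \<in> carrier A" using x assms by blast
      have "incl \<iota> A x \<in> vspan S (incl \<iota> A ` P)" using span_base[OF S I] x by blast
      then show ?thesis
        unfolding pure2_eq_smult_incl[OF \<open>x \<in> carrier A\<close>] by (rule subsp_smult[OF subsp_span[OF S I]])
    qed
    then show "?P \<subseteq> vspan S (incl \<iota> A ` P)" by blast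
  qed
  note W = subsp_span[OF T P]
  have "subsp (vspan T ?P) S"
  proof (rule subspI[OF S]; (unfold scalar_ext_simps)?)
    show "vspan T ?P \<subseteq> carrier T" by (rule subsp_subset[OF W])
    show "\<zero>\<^bsub>T\<^esub> \<in> vspan T ?P" by (rule subsp_zero[OF W])
    show "\<And>x y. \<lbrakk>x \<in> vspan T ?P; y \<in> vspan T ?P\<rbrakk> \<Longrightarrow> x \<oplus>\<^bsub>T\<^esub> y \<in> vspan T ?P" by (rule subsp_add[OF W])
    fix l x assume "x \<in> vspan T ?P"
    moreover have "smult S l ` vspan T ?P \<subseteq> vspan T ?P"
    proof (rule span_image_subset[OF smult_scalar_ext_lin T P W])
      have "l \<odot>\<^bsub>S\<^esub> pure2 A L x y \<in> vspan T ?P" if "x \<in> P" for x y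
      proof -
        have "x \<in> carrier A" using that assms by blast
        then show ?thesis unfolding smult_scalar_ext[OF \<open>x \<in> carrier A\<close>]
          using span_base[OF T P] that by blast
      qed
      then show "smult S l ` ?P \<subseteq> vspan T ?P" by blast
    qed
    ultimately show "l \<odot>\<^bsub>S\<^esub> x \<in> vspan T ?P" by blast
  qed
  then show "vspan S (incl \<iota> A ` P) \<subseteq> vspan T ?P"
  proof (rule span_least[OF S I])
    show "incl \<iota> A ` P \<subseteq> vspan T ?P" using span_base[OF T P] unfolding incl_def by blast
  qed
qed

lemma span_incl_carrier: "vspan S (incl \<iota> A ` carrier A) = carrier S"
  using span_incl[OF order_refl] tensor2_span[OF vA, of \<iota>] unfolding scalar_ext_simps by simp

lemma incl_image_closed: "incl \<iota> A ` carrier A \<subseteq> carrier S"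
  using incl_closed by blast

lemma filt_scalar_ext: "filt A p \<subseteq> carrier A \<Longrightarrow> filt S p = vspan S (incl \<iota> A ` filt A p)"
  unfolding scalar_ext_simps by (rule span_incl)

lemma scalar_ext_lin_eqI:
  assumes "f \<in> lin S N" "g \<in> lin S N" "vs N" "\<And>x. x \<in> carrier A \<Longrightarrow> f (incl \<iota> A x) = g (incl \<iota> A x)"
    "t \<in> carrier S"
  shows "f t = g t"
proof (rule lin_eq_on_span[OF assms(1,2) scalar_ext_vs assms(3) incl_image_closed])
  show "t \<in> vspan S (incl \<iota> A ` carrier A)" using assms(5) unfolding span_incl_carrier .
qed (use assms(4) in blast)

text \<open>
  The universal property of the extension of scalars: \<open>x \<otimes> y \<mapsto> y \<odot> g x\<close> is bilinear over the small field,
  and the induced map is linear over the large one because it is so on generators.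
\<close>

lemma semilin_extend:
  fixes N :: "('l, 'w, 'n) module_scheme"
  assumes N: "vs N" and g: "semilin \<iota> A N g"
  shows "\<exists>h\<in>lin S N. \<forall>x\<in>carrier A. h (incl \<iota> A x) = g x"
proof -
  note N' = restrict_scalars_vs[OF N]
  have b: "bilin \<iota> A (restrict_scalars N) (\<lambda>x y. y \<odot>\<^bsub>N\<^esub> g x)"
    unfolding bilin_def
  proof (intro conjI ballI allI; (unfold restrict_scalars_simps)?)
    fix x x' y y' a assume x: "x \<in> carrier A"
    note gx = semilin_closed[OF g x]
    show "y \<odot>\<^bsub>N\<^esub> g x \<in> carrier N" using N gx by simp
    show "(y + y') \<odot>\<^bsub>N\<^esub> g x = y \<odot>\<^bsub>N\<^esub> g x \<oplus>\<^bsub>N\<^esub> y' \<odot>\<^bsub>N\<^esub> g x" by (rule vs_l_distr[OF N gx])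
    show "y \<odot>\<^bsub>N\<^esub> g (a \<odot>\<^bsub>A\<^esub> x) = \<iota> a \<odot>\<^bsub>N\<^esub> (y \<odot>\<^bsub>N\<^esub> g x)"
      using N gx by (simp add: semilin_smult[OF g x] vs_smult_assoc mult.commute)
    show "(\<iota> a * y) \<odot>\<^bsub>N\<^esub> g x = \<iota> a \<odot>\<^bsub>N\<^esub> (y \<odot>\<^bsub>N\<^esub> g x)" using N gx by (simp add: vs_smult_assoc)
    assume x': "x' \<in> carrier A"
    show "y \<odot>\<^bsub>N\<^esub> g (x \<oplus>\<^bsub>A\<^esub> x') = y \<odot>\<^bsub>N\<^esub> g x \<oplus>\<^bsub>N\<^esub> y \<odot>\<^bsub>N\<^esub> g x'"
      unfolding semilin_add[OF g x x'] by (rule vs_r_distr[OF N gx semilin_closed[OF g x']])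
  qed
  from tensor2_ext[OF vA N' b] obtain h where h: "h \<in> lin T (restrict_scalars N)"
    "\<And>x y. x \<in> carrier A \<Longrightarrow> h (pure2 A L x y) = y \<odot>\<^bsub>N\<^esub> g x"
    unfolding linear_maps_iff by blast
  have "h (l \<odot>\<^bsub>S\<^esub> t) = l \<odot>\<^bsub>N\<^esub> h t" if t: "t \<in> carrier T" for l t
  proof (rule tensor2_lin_eqI[OF lin_comp[OF smult_scalar_ext_lin h(1)] lin_comp[OF h(1)] N' _ t])
    show "(\<lambda>x. l \<odot>\<^bsub>N\<^esub> x) \<in> lin (restrict_scalars N) (restrict_scalars N)"
      by (rule restrict_scalars_lin[OF lin_scalar[OF N]])
    fix x y assume x: "x \<in> carrier A"
    show "h (l \<odot>\<^bsub>S\<^esub> pure2 A L x y) = l \<odot>\<^bsub>N\<^esub> h (pure2 A L x y)"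
      using N semilin_closed[OF g x] by (simp add: smult_scalar_ext[OF x] h(2)[OF x] vs_smult_assoc)
  qed
  moreover have "h t \<in> carrier N" "u \<in> carrier T \<Longrightarrow> h (t \<oplus>\<^bsub>T\<^esub> u) = h t \<oplus>\<^bsub>N\<^esub> h u" if "t \<in> carrier T" for t u
    using lin_closed[OF h(1) that] lin_add[OF h(1) that] by simp_all
  ultimately have "h \<in> lin S N" by (intro linI) (simp_all add: scalar_ext_simps)
  moreover have "h (incl \<iota> A x) = g x" if x: "x \<in> carrier A" for x
    using h(2)[OF x, of 1] N semilin_closed[OF g x] unfolding incl_def by simp
  ultimately show ?thesis by blast
qed

text \<open>
  The retraction is \<open>x \<otimes> y \<mapsto> r y \<odot> x\<close>.  It respects the filtrations because each step of the extended one is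
  spanned by the \<open>x \<otimes> y\<close> with \<open>x\<close> in the same step of the given one.
\<close>

lemma scalar_retraction:
  assumes r: "\<And>x y. r (x + y) = r x + r y" "\<And>a y. r (\<iota> a * y) = a * r y" "r 1 = 1"
  obtains R where "R \<in> lin (restrict_scalars S) A"
    "\<And>l x. x \<in> carrier A \<Longrightarrow> R (l \<odot>\<^bsub>S\<^esub> incl \<iota> A x) = r l \<odot>\<^bsub>A\<^esub> x"
    "\<And>x. x \<in> carrier A \<Longrightarrow> R (incl \<iota> A x) = x"
    "\<And>p t. \<lbrakk>subsp (filt A p) A; t \<in> filt S p\<rbrakk> \<Longrightarrow> R t \<in> filt A p"
proof -
  have b: "bilin \<iota> A A (\<lambda>x y. r y \<odot>\<^bsub>A\<^esub> x)"
    unfolding bilin_def using vA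
    by (simp add: r vs_l_distr vs_r_distr vs_smult_assoc mult.commute[of "r _"])
  from tensor2_ext[OF vA vA b] obtain R where R: "R \<in> lin T A"
    "\<And>x y. x \<in> carrier A \<Longrightarrow> R (pure2 A L x y) = r y \<odot>\<^bsub>A\<^esub> x"
    unfolding linear_maps_iff by blast
  show ?thesis
  proof (rule that[of R])
    show "R \<in> lin (restrict_scalars S) A" using R(1) unfolding scalar_ext_lin_restrict .
    fix l x assume x: "x \<in> carrier A"
    show "R (l \<odot>\<^bsub>S\<^esub> incl \<iota> A x) = r l \<odot>\<^bsub>A\<^esub> x"
      unfolding pure2_eq_smult_incl[OF x, symmetric] by (rule R(2)[OF x])
    show "R (incl \<iota> A x) = x" unfolding incl_def R(2)[OF x] r(3) using vA x by simp
  next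
    fix p t assume W: "subsp (filt A p) A" and t: "t \<in> filt S p"
    have "R ` vspan T {pure2 A L x y | x y. x \<in> filt A p} \<subseteq> filt A p"
    proof (rule span_image_subset[OF R(1) tensor2_vs[OF vA] _ W])
      show "{pure2 A L x y | x y. x \<in> filt A p} \<subseteq> carrier T" using subsp_subset[OF W] pure2_closed by blast
      have "R (pure2 A L x y) \<in> filt A p" if "x \<in> filt A p" for x y
        using R(2)[of x y] subsp_smult[OF W that, of "r y"] subsp_subset[OF W] that by auto
      then show "R ` {pure2 A L x y | x y. x \<in> filt A p} \<subseteq> filt A p" by blast
    qed
    with t show "R t \<in> filt A p" unfolding scalar_ext_simps by blast
  qed
qed

end

lemma filtered_scalar_ext:
  assumes "filtered_vs A"
  shows "filtered_vs (scalar_ext \<iota> A)"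
proof -
  have vA: "vs A" and W: "subsp (filt A p) A" and mono: "mono (filt A)" for p
    using assms by (simp_all add: filtered_vs_def)
  obtain a b where ab: "filt A a = {\<zero>\<^bsub>A\<^esub>}" "filt A b = carrier A"
    using assms unfolding filtered_vs_def by blast
  let ?S = "scalar_ext \<iota> A"
  note S = scalar_ext_vs[OF vA]
  have sub: "filt A p \<subseteq> carrier A" for p by (rule subsp_subset[OF W])
  have filt: "filt ?S p = vspan ?S (incl \<iota> A ` filt A p)" for p by (rule filt_scalar_ext[OF vA sub])
  have I: "incl \<iota> A ` filt A p \<subseteq> carrier ?S" for p using sub incl_closed[OF vA] by blast
  have "subsp (filt ?S p) ?S" for p unfolding filt by (rule subsp_span[OF S I])
  moreover have "mono (filt ?S)"
  proof
    fix p q :: int assume "p \<le> q"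
    then have "filt A p \<subseteq> filt A q" by (rule monoD[OF mono])
    then have "incl \<iota> A ` filt A p \<subseteq> vspan ?S (incl \<iota> A ` filt A q)" using span_base[OF S I, of q] by blast
    then show "filt ?S p \<subseteq> filt ?S q" unfolding filt by (rule span_least[OF S I subsp_span[OF S I]])
  qed
  moreover have "filt ?S a = {\<zero>\<^bsub>?S\<^esub>}" unfolding filt ab by (rule span_zero[OF S]) (simp add: incl_zero[OF vA])
  moreover have "filt ?S b = carrier ?S" unfolding filt ab by (rule span_incl_carrier[OF vA])
  ultimately show ?thesis using S unfolding filtered_vs_def by blast
qed

end

section \<open>Extension of scalars for multilinear maps\<close>

lemma tuples_Cons: "x # xs \<in> tuples (M # Ms) \<longleftrightarrow> x \<in> carrier M \<and> xs \<in> tuples Ms"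
  by (auto simp: tuples_iff nth_Cons less_Suc_eq_0_disj split: nat.split)

lemma tuples_ConsE:
  assumes "zs \<in> tuples (M # Ms)"
  obtains x xs where "zs = x # xs" "x \<in> carrier M" "xs \<in> tuples Ms"
proof (cases zs)
  case Nil
  then show ?thesis using assms by (simp add: tuples_iff)
next
  case (Cons x xs)
  with assms that show ?thesis by (simp add: tuples_Cons)
qed

lemma multilin_Cons:
  assumes m: "multilin (M # Ms) N m" and x: "x \<in> carrier M"
  shows "multilin Ms N (\<lambda>xs. m (x # xs))"
proof (rule multilinI)
  fix xs i assume xs: "xs \<in> tuples Ms"
  then have xxs: "x # xs \<in> tuples (M # Ms)" using x by (simp add: tuples_Cons)
  then show "m (x # xs) \<in> carrier N" by (rule multilin_closed[OF m])
  assume "i < length Ms"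
  then show "(\<lambda>y. m (x # xs[i := y])) \<in> lin (Ms ! i) N" using multilin_slot[OF m xxs, of "Suc i"] by simp
qed

lemma multilin_head:
  assumes m: "multilin (M # Ms) N m" and M: "vs M" and xs: "xs \<in> tuples Ms"
  shows "(\<lambda>x. m (x # xs)) \<in> lin M N"
proof -
  have "\<zero>\<^bsub>M\<^esub> # xs \<in> tuples (M # Ms)" using M xs by (simp add: tuples_Cons)
  from multilin_slot[OF m this, of 0] show ?thesis by simp
qed

lemma multilin_ConsI:
  assumes head: "\<And>xs. xs \<in> tuples Ms \<Longrightarrow> (\<lambda>x. m (x # xs)) \<in> lin M N"
    and tail: "\<And>x. x \<in> carrier M \<Longrightarrow> multilin Ms N (\<lambda>xs. m (x # xs))"
  shows "multilin (M # Ms) N m"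
proof (rule multilinI)
  fix zs i assume "zs \<in> tuples (M # Ms)"
  then obtain x xs where zs: "zs = x # xs" "x \<in> carrier M" "xs \<in> tuples Ms" by (rule tuples_ConsE)
  show "m zs \<in> carrier N" unfolding zs(1) by (rule multilin_closed[OF tail[OF zs(2)] zs(3)])
  assume i: "i < length (M # Ms)"
  show "(\<lambda>y. m (zs[i := y])) \<in> lin ((M # Ms) ! i) N"
  proof (cases i)
    case 0
    then show ?thesis using head[OF zs(3)] by (simp add: zs(1))
  next
    case (Suc j)
    then show ?thesis using multilin_slot[OF tail[OF zs(2)] zs(3), of j] i by (simp add: zs(1))
  qed
qed

lemma multilin_plus:
  assumes "multilin Ms N m" "multilin Ms N m'" "vs N"
  shows "multilin Ms N (\<lambda>xs. m xs \<oplus>\<^bsub>N\<^esub> m' xs)"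
  by (intro multilinI lin_plus vs_add multilin_closed[OF assms(1)] multilin_closed[OF assms(2)]
      multilin_slot[OF assms(1)] multilin_slot[OF assms(2)] assms(3))

lemma multilin_scale: "\<lbrakk>multilin Ms N m; vs N\<rbrakk> \<Longrightarrow> multilin Ms N (\<lambda>xs. a \<odot>\<^bsub>N\<^esub> m xs)"
  by (rule multilin_comp_lin[OF _ lin_scalar])

text \<open>
  Reduces values at arbitrary pure tensors \<open>x\<^sub>i \<otimes> l\<^sub>i\<close> to those at the \<open>x\<^sub>i \<otimes> 1\<close>.
\<close>

lemma multilin_scale_args:
  assumes "multilin Ms N m" "vs N" "\<And>M. M \<in> set Ms \<Longrightarrow> vs M" "xs \<in> tuples Ms" "length ls = length Ms"
  shows "m (map (\<lambda>i. (ls ! i) \<odot>\<^bsub>Ms ! i\<^esub> (xs ! i)) [0..<length Ms]) = prod_list ls \<odot>\<^bsub>N\<^esub> m xs"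
  using assms
proof (induction Ms arbitrary: m xs ls)
  case Nil
  then show ?case using multilin_closed[OF Nil(1,4)] by (simp add: tuples_iff)
next
  case (Cons M Ms)
  obtain x ys where xs: "xs = x # ys" "x \<in> carrier M" "ys \<in> tuples Ms" using Cons.prems(4) by (rule tuples_ConsE)
  obtain l ls' where ls: "ls = l # ls'" "length ls' = length Ms" using Cons.prems(5) by (cases ls) auto
  have M: "vs M" and Ms: "\<And>M. M \<in> set Ms \<Longrightarrow> vs M" using Cons.prems(3) by auto
  have lx: "l \<odot>\<^bsub>M\<^esub> x \<in> carrier M" using M xs(2) by simp
  have "m (map (\<lambda>i. (ls ! i) \<odot>\<^bsub>(M # Ms) ! i\<^esub> (xs ! i)) [0..<length (M # Ms)])
      = m ((l \<odot>\<^bsub>M\<^esub> x) # map (\<lambda>i. (ls' ! i) \<odot>\<^bsub>Ms ! i\<^esub> (ys ! i)) [0..<length Ms])"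
    unfolding xs ls by (simp add: map_upt_Suc del: upt_Suc)
  also have "\<dots> = prod_list ls' \<odot>\<^bsub>N\<^esub> m ((l \<odot>\<^bsub>M\<^esub> x) # ys)"
    by (rule Cons.IH[OF multilin_Cons[OF Cons.prems(1) lx] Cons.prems(2) Ms xs(3) ls(2)])
  also have "m ((l \<odot>\<^bsub>M\<^esub> x) # ys) = l \<odot>\<^bsub>N\<^esub> m (x # ys)"
    by (rule lin_smult[OF multilin_head[OF Cons.prems(1) M xs(3)] xs(2)])
  also have "prod_list ls' \<odot>\<^bsub>N\<^esub> (l \<odot>\<^bsub>N\<^esub> m (x # ys)) = prod_list ls \<odot>\<^bsub>N\<^esub> m xs"
    using multilin_closed[OF Cons.prems(1,4)] Cons.prems(2)
    by (simp add: xs(1) ls(1) vs_smult_assoc mult.commute)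
  finally show ?case .
qed

context
  fixes \<iota> :: "'k::field \<Rightarrow> 'l::field"
  assumes \<iota>: "field_hom \<iota>"
begin

interpretation \<iota>: field_hom \<iota> by (rule \<iota>)

lemmas vS = scalar_ext_vs[OF \<iota>]
  and incl_semilin' = incl_semilin[OF \<iota>]

lemma incl_tuples:
  assumes "\<And>A. A \<in> set As \<Longrightarrow> vs A" "xs \<in> tuples As"
  shows "map2 (incl \<iota>) As xs \<in> tuples (map (scalar_ext \<iota>) As)"
  using incl_closed[OF \<iota> assms(1)[OF nth_mem] tuples_nth[OF assms(2)]] assms(2)
  by (simp add: tuples_iff)

lemma incl_listset:
  assumes "zs \<in> listset (map (\<lambda>i. incl \<iota> (As ! i) ` P i) [0..<length As])"
  obtains xs where "length xs = length As" "\<And>i. i < length As \<Longrightarrow> xs ! i \<in> P i" "zs = map2 (incl \<iota>) As xs"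
proof -
  have zs: "length zs = length As" "\<forall>i<length As. \<exists>x. x \<in> P i \<and> zs ! i = incl \<iota> (As ! i) x"
    using assms by (auto simp: listset_iff)
  then obtain h where h: "\<forall>i<length As. h i \<in> P i \<and> zs ! i = incl \<iota> (As ! i) (h i)" by metis
  show ?thesis
    by (rule that[of "map h [0..<length As]"]) (use h zs(1) in \<open>auto intro: nth_equalityI\<close>)
qed

lemma multilin_scalar_ext_eqI:
  fixes N :: "('l, 'w, 'n) module_scheme"
  assumes m: "multilin (map (scalar_ext \<iota>) As) N m" "multilin (map (scalar_ext \<iota>) As) N m'"
    and As: "\<And>A. A \<in> set As \<Longrightarrow> vs A" and N: "vs N"
    and eq: "\<And>xs. xs \<in> tuples As \<Longrightarrow> m (map2 (incl \<iota>) As xs) = m' (map2 (incl \<iota>) As xs)"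
    and zs: "zs \<in> tuples (map (scalar_ext \<iota>) As)"
  shows "m zs = m' zs"
proof (rule multilin_eq_on_span[where Ss = "map (\<lambda>i. incl \<iota> (As ! i) ` carrier (As ! i)) [0..<length As]",
      OF m _ N _ _ _ _ zs])
  fix ys assume "ys \<in> listset (map (\<lambda>i. incl \<iota> (As ! i) ` carrier (As ! i)) [0..<length As])"
  then obtain xs where "length xs = length As" "\<And>i. i < length As \<Longrightarrow> xs ! i \<in> carrier (As ! i)"
    "ys = map2 (incl \<iota>) As xs" by (rule incl_listset) blast
  then show "m ys = m' ys" using eq[of xs] by (simp add: tuples_iff)
next
  fix i assume "i < length (map (scalar_ext \<iota>) As)"
  then have i: "i < length As" "vs (As ! i)" using As by auto
  show "map (\<lambda>i. incl \<iota> (As ! i) ` carrier (As ! i)) [0..<length As] ! i \<subseteq> carrier (map (scalar_ext \<iota>) As ! i)"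
    using incl_image_closed[OF \<iota> i(2)] i(1) by simp
  show "carrier (map (scalar_ext \<iota>) As ! i) \<subseteq> vspan (map (scalar_ext \<iota>) As ! i)
      (map (\<lambda>i. incl \<iota> (As ! i) ` carrier (As ! i)) [0..<length As] ! i)"
    using span_incl_carrier[OF \<iota> i(2)] i(1) by simp
next
  fix M assume "M \<in> set (map (scalar_ext \<iota>) As)"
  then show "vs M" using vS As by auto
qed simp

text \<open>
  Extend the arguments one at a time, the first one last: when the extended arguments after it are
  fixed, the value is semilinear in the first argument and so extends linearly.
\<close>

lemma multilin_base_change:
  assumes B: "vs B" and "\<And>A. A \<in> set As \<Longrightarrow> vs A" and "multilin As B m"
  shows "\<exists>M. multilin (map (scalar_ext \<iota>) As) (scalar_ext \<iota> B) M \<and>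
    (\<forall>xs\<in>tuples As. M (map2 (incl \<iota>) As xs) = incl \<iota> B (m xs))"
  using assms(2,3)
proof (induction As arbitrary: m)
  case Nil
  have "[] \<in> tuples ([] :: ('k, 'v) filtered_data list)" by (simp add: tuples_iff)
  from multilin_closed[OF Nil(2) this] have "incl \<iota> B (m []) \<in> carrier (scalar_ext \<iota> B)"
    by (rule incl_closed[OF \<iota> B])
  then have "multilin (map (scalar_ext \<iota>) []) (scalar_ext \<iota> B) (\<lambda>_. incl \<iota> B (m []))"
    by (intro multilinI) simp_all
  then show ?case by (intro exI[of _ "\<lambda>_. incl \<iota> B (m [])"] conjI) (simp_all add: tuples_iff)
next
  case (Cons A As)
  let ?S = "scalar_ext \<iota>"
  have A: "vs A" and As: "\<And>A. A \<in> set As \<Longrightarrow> vs A" using Cons.prems(1) by auto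
  note SB = vS[OF B] and i = incl_semilin'[OF B]
  have "\<exists>M. multilin (map ?S As) (?S B) M \<and> (\<forall>xs\<in>tuples As. M (map2 (incl \<iota>) As xs) = incl \<iota> B (m (x # xs)))"
    if "x \<in> carrier A" for x
    by (rule Cons.IH[OF As multilin_Cons[OF Cons.prems(2) that]])
  then obtain M where M: "\<And>x. x \<in> carrier A \<Longrightarrow> multilin (map ?S As) (?S B) (M x)"
    and M_incl: "\<And>x xs. \<lbrakk>x \<in> carrier A; xs \<in> tuples As\<rbrakk> \<Longrightarrow> M x (map2 (incl \<iota>) As xs) = incl \<iota> B (m (x # xs))"
    by metis
  \<comment> \<open>both sides of each law are multilinear in \<open>ts\<close>, and they agree on tuples of elements \<open>x \<otimes> 1\<close>\<close>
  have semi: "semilin \<iota> A (?S B) (\<lambda>x. M x ts)" if ts: "ts \<in> tuples (map ?S As)" for ts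
  proof (rule semilinI)
    fix x y a assume x: "x \<in> carrier A"
    show "M x ts \<in> carrier (?S B)" by (rule multilin_closed[OF M[OF x] ts])
    have ax: "a \<odot>\<^bsub>A\<^esub> x \<in> carrier A" using A x by simp
    show "M (a \<odot>\<^bsub>A\<^esub> x) ts = \<iota> a \<odot>\<^bsub>?S B\<^esub> M x ts"
    proof (rule multilin_scalar_ext_eqI[OF M[OF ax] multilin_scale[OF M[OF x] SB] As SB _ ts])
      fix xs assume xs: "xs \<in> tuples As"
      have "m (x # xs) \<in> carrier B" using multilin_closed[OF Cons.prems(2)] x xs by (simp add: tuples_Cons)
      then show "M (a \<odot>\<^bsub>A\<^esub> x) (map2 (incl \<iota>) As xs) = \<iota> a \<odot>\<^bsub>?S B\<^esub> M x (map2 (incl \<iota>) As xs)"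
        unfolding M_incl[OF x xs] M_incl[OF ax xs] lin_smult[OF multilin_head[OF Cons.prems(2) A xs] x]
        by (rule semilin_smult[OF i])
    qed
    assume y: "y \<in> carrier A"
    have xy: "x \<oplus>\<^bsub>A\<^esub> y \<in> carrier A" using A x y by simp
    show "M (x \<oplus>\<^bsub>A\<^esub> y) ts = M x ts \<oplus>\<^bsub>?S B\<^esub> M y ts"
    proof (rule multilin_scalar_ext_eqI[OF M[OF xy] multilin_plus[OF M[OF x] M[OF y] SB] As SB _ ts])
      fix xs assume xs: "xs \<in> tuples As"
      have "m (x # xs) \<in> carrier B" "m (y # xs) \<in> carrier B"
        using multilin_closed[OF Cons.prems(2)] x y xs by (simp_all add: tuples_Cons)
      then show "M (x \<oplus>\<^bsub>A\<^esub> y) (map2 (incl \<iota>) As xs) = M x (map2 (incl \<iota>) As xs) \<oplus>\<^bsub>?S B\<^esub> M y (map2 (incl \<iota>) As xs)"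
        unfolding M_incl[OF x xs] M_incl[OF y xs] M_incl[OF xy xs] lin_add[OF multilin_head[OF Cons.prems(2) A xs] x y]
        by (rule semilin_add[OF i])
    qed
  qed
  have "\<exists>h. h \<in> lin (?S A) (?S B) \<and> (\<forall>x\<in>carrier A. h (incl \<iota> A x) = M x ts)"
    if "ts \<in> tuples (map ?S As)" for ts
    using semilin_extend[OF \<iota> A SB semi[OF that]] by blast
  then obtain H where H: "\<And>ts. ts \<in> tuples (map ?S As) \<Longrightarrow> H ts \<in> lin (?S A) (?S B)"
    and H_incl: "\<And>ts x. \<lbrakk>ts \<in> tuples (map ?S As); x \<in> carrier A\<rbrakk> \<Longrightarrow> H ts (incl \<iota> A x) = M x ts"
    by metis
  \<comment> \<open>both sides of each law are linear in \<open>t\<close>, and for \<open>t = x \<otimes> 1\<close> the law is that of \<open>M x\<close>\<close>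
  have tail: "multilin (map ?S As) (?S B) (\<lambda>ts. H ts t)" if t: "t \<in> carrier (?S A)" for t
  proof (rule multilinI)
    fix ts j assume ts: "ts \<in> tuples (map ?S As)"
    show "H ts t \<in> carrier (?S B)" by (rule lin_closed[OF H[OF ts] t])
    assume j: "j < length (map ?S As)"
    let ?N = "map ?S As ! j"
    have N: "vs ?N" using j vS[OF As[OF nth_mem]] by simp
    note up = tuples_update[OF ts j]
    show "(\<lambda>y. H (ts[j := y]) t) \<in> lin ?N (?S B)"
    proof (rule linI)
      fix y z a assume y: "y \<in> carrier ?N"
      note Hy = H[OF up[OF y]]
      show "H (ts[j := y]) t \<in> carrier (?S B)" by (rule lin_closed[OF Hy t])
      have ay: "a \<odot>\<^bsub>?N\<^esub> y \<in> carrier ?N" using N y by simp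
      show "H (ts[j := a \<odot>\<^bsub>?N\<^esub> y]) t = a \<odot>\<^bsub>?S B\<^esub> H (ts[j := y]) t"
      proof (rule scalar_ext_lin_eqI[OF \<iota> A H[OF up[OF ay]] lin_scale[OF Hy SB] SB _ t])
        fix x assume x: "x \<in> carrier A"
        show "H (ts[j := a \<odot>\<^bsub>?N\<^esub> y]) (incl \<iota> A x) = a \<odot>\<^bsub>?S B\<^esub> H (ts[j := y]) (incl \<iota> A x)"
          unfolding H_incl[OF up[OF ay] x] H_incl[OF up[OF y] x]
          by (rule lin_smult[OF multilin_slot[OF M[OF x] ts j] y])
      qed
      assume z: "z \<in> carrier ?N"
      note Hz = H[OF up[OF z]]
      have yz: "y \<oplus>\<^bsub>?N\<^esub> z \<in> carrier ?N" using N y z by simp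
      show "H (ts[j := y \<oplus>\<^bsub>?N\<^esub> z]) t = H (ts[j := y]) t \<oplus>\<^bsub>?S B\<^esub> H (ts[j := z]) t"
      proof (rule scalar_ext_lin_eqI[OF \<iota> A H[OF up[OF yz]] lin_plus[OF Hy Hz SB] SB _ t])
        fix x assume x: "x \<in> carrier A"
        show "H (ts[j := y \<oplus>\<^bsub>?N\<^esub> z]) (incl \<iota> A x)
            = H (ts[j := y]) (incl \<iota> A x) \<oplus>\<^bsub>?S B\<^esub> H (ts[j := z]) (incl \<iota> A x)"
          unfolding H_incl[OF up[OF yz] x] H_incl[OF up[OF y] x] H_incl[OF up[OF z] x]
          by (rule lin_add[OF multilin_slot[OF M[OF x] ts j] y z])
      qed
    qed
  qed
  let ?M = "\<lambda>zs. H (tl zs) (hd zs)"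
  have "multilin (map ?S (A # As)) (?S B) ?M"
    unfolding list.map by (rule multilin_ConsI) (simp_all add: H tail)
  moreover have "?M (map2 (incl \<iota>) (A # As) xs) = incl \<iota> B (m xs)" if zs: "xs \<in> tuples (A # As)" for xs
  proof -
    obtain x ys where xs: "xs = x # ys" "x \<in> carrier A" "ys \<in> tuples As"
      using zs by (rule tuples_ConsE)
    have "map2 (incl \<iota>) As ys \<in> tuples (map ?S As)" using As xs(3) by (rule incl_tuples)
    then show ?thesis using xs by (simp add: H_incl M_incl)
  qed
  ultimately show ?case by blast
qed

context
  fixes As :: "('k, 'v) filtered_data list" and B :: "('k, 'v) filtered_data"
  assumes As: "\<And>A. A \<in> set As \<Longrightarrow> vs A" and B: "vs B"
begin

lemma vs_scalar_exts: "M \<in> set (map (scalar_ext \<iota>) As) \<Longrightarrow> vs M"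
  using vS As by auto

text \<open>
  An operation on extended spaces is determined by its values at tuples of elements \<open>x \<otimes> 1\<close>.
\<close>

lemma tensor_scalar_ext_eqI:
  assumes h: "h \<in> linear_maps (tensor (map (scalar_ext \<iota>) As)) (scalar_ext \<iota> B)"
    "h' \<in> linear_maps (tensor (map (scalar_ext \<iota>) As)) (scalar_ext \<iota> B)"
    and eq: "\<And>xs. xs \<in> tuples As \<Longrightarrow> h (pure_tensor (map (scalar_ext \<iota>) As) (map2 (incl \<iota>) As xs))
      = h' (pure_tensor (map (scalar_ext \<iota>) As) (map2 (incl \<iota>) As xs))"
  shows "h = h'"
proof (rule tensor_maps_eqI[OF vs_scalar_exts h vS[OF B]])
  have "h \<in> lin (tensor (map (scalar_ext \<iota>) As)) (scalar_ext \<iota> B)"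
    "h' \<in> lin (tensor (map (scalar_ext \<iota>) As)) (scalar_ext \<iota> B)"
    using h unfolding linear_maps_iff by blast+
  note m = multilin_pure_tensor[OF vs_scalar_exts this(1)] multilin_pure_tensor[OF vs_scalar_exts this(2)]
  fix zs assume zs: "zs \<in> tuples (map (scalar_ext \<iota>) As)"
  show "h (pure_tensor (map (scalar_ext \<iota>) As) zs) = h' (pure_tensor (map (scalar_ext \<iota>) As) zs)"
    by (rule multilin_scalar_ext_eqI[OF m As vS[OF B] eq zs])
qed

text \<open>
  The definite description in \<^const>\<open>base_change\<close> prescribes the values at all tuples \<open>x\<^sub>i \<otimes> l\<^sub>i\<close>.  The case
  where all \<open>l\<^sub>i\<close> are \<open>1\<close> determines the map, and for the extension constructed above the remaining values
  follow by homogeneity.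
\<close>

lemma
  assumes f: "f \<in> lin (tensor As) B"
  shows base_change_linear: "on_op (base_change \<iota>) As B f
      \<in> linear_maps (tensor (map (scalar_ext \<iota>) As)) (scalar_ext \<iota> B)"
    and base_change_incl: "xs \<in> tuples As \<Longrightarrow>
      on_op (base_change \<iota>) As B f (pure_tensor (map (scalar_ext \<iota>) As) (map2 (incl \<iota>) As xs))
      = incl \<iota> B (f (pure_tensor As xs))"
proof -
  let ?S = "scalar_ext \<iota>" and ?L = "field_as_vs \<iota>"
  let ?pures = "\<lambda>xs ls. map (\<lambda>i. pure2 (As ! i) ?L (xs ! i) (ls ! i)) [0..<length As]"
  let ?P = "\<lambda>h. h \<in> linear_maps (tensor (map ?S As)) (?S B) \<and>
        (\<forall>xs\<in>tuples As. \<forall>ls. length ls = length As \<longrightarrow>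
          h (pure_tensor (map ?S As) (?pures xs ls)) = pure2 B ?L (f (pure_tensor As xs)) (prod_list ls))"
  note mf = multilin_pure_tensor[OF As f]
  have ones: "?pures xs (replicate (length As) 1) = map2 (incl \<iota>) As xs" if "xs \<in> tuples As" for xs
    using that by (intro nth_equalityI) (auto simp: tuples_iff incl_def)
  have P_incl: "h (pure_tensor (map ?S As) (map2 (incl \<iota>) As xs)) = incl \<iota> B (f (pure_tensor As xs))"
    if "?P h" "xs \<in> tuples As" for h xs
  proof -
    have "h (pure_tensor (map ?S As) (?pures xs (replicate (length As) 1)))
        = pure2 B ?L (f (pure_tensor As xs)) (prod_list (replicate (length As) 1))"
      using that by simp
    then show ?thesis unfolding ones[OF that(2)] by (simp add: incl_def[of \<iota> B])
  qed
  obtain M where M: "multilin (map ?S As) (?S B) M"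
    and M_incl: "\<And>xs. xs \<in> tuples As \<Longrightarrow> M (map2 (incl \<iota>) As xs) = incl \<iota> B (f (pure_tensor As xs))"
    using multilin_base_change[OF B As mf] by blast
  let ?h = "tensor_map (map ?S As) (?S B) M"
  have "?P ?h"
  proof (intro conjI ballI allI impI)
    show "?h \<in> linear_maps (tensor (map ?S As)) (?S B)"
      by (rule tensor_map_linear[OF vs_scalar_exts M vS[OF B]])
    fix xs and ls :: "'l list" assume xs: "xs \<in> tuples As" and ls: "length ls = length As"
    let ?is = "map2 (incl \<iota>) As xs"
    have "is": "?is \<in> tuples (map ?S As)" by (rule incl_tuples[OF As xs])
    have eq: "?pures xs ls = map (\<lambda>i. (ls ! i) \<odot>\<^bsub>map ?S As ! i\<^esub> (?is ! i)) [0..<length (map ?S As)]"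
      using xs ls pure2_eq_smult_incl[OF \<iota> As[OF nth_mem] tuples_nth[OF xs]]
      by (intro nth_equalityI) (simp_all add: tuples_iff)
    have pt: "?pures xs ls \<in> tuples (map ?S As)"
      using pure2_closed[OF \<iota> As[OF nth_mem] tuples_nth[OF xs]]
      by (simp add: tuples_iff scalar_ext_simps[OF \<iota> As[OF nth_mem]])
    have "?h (pure_tensor (map ?S As) (?pures xs ls)) = M (?pures xs ls)"
      by (rule tensor_map_pure[OF vs_scalar_exts M vS[OF B] pt])
    also have "\<dots> = prod_list ls \<odot>\<^bsub>?S B\<^esub> M ?is"
      unfolding eq by (rule multilin_scale_args[OF M vS[OF B] vs_scalar_exts "is"]) (use ls in simp_all)
    also have "\<dots> = pure2 B ?L (f (pure_tensor As xs)) (prod_list ls)"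
      unfolding M_incl[OF xs]
      by (rule pure2_eq_smult_incl[OF \<iota> B multilin_closed[OF mf xs], symmetric])
    finally show "?h (pure_tensor (map ?S As) (?pures xs ls)) = pure2 B ?L (f (pure_tensor As xs)) (prod_list ls)" .
  qed
  moreover have "h = ?h" if "?P h" for h
    using that \<open>?P ?h\<close> P_incl[OF that] P_incl[OF \<open>?P ?h\<close>] by (intro tensor_scalar_ext_eqI) simp_all
  ultimately have "?P (THE h. ?P h)" by (rule theI)
  moreover have eq: "on_op (base_change \<iota>) As B f = (THE h. ?P h)" by (simp add: base_change_def tuples_def)
  ultimately have P: "?P (on_op (base_change \<iota>) As B f)" unfolding eq by blast
  then show "on_op (base_change \<iota>) As B f \<in> linear_maps (tensor (map ?S As)) (?S B)" by blast
  show "on_op (base_change \<iota>) As B f (pure_tensor (map ?S As) (map2 (incl \<iota>) As xs))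
      = incl \<iota> B (f (pure_tensor As xs))" if "xs \<in> tuples As"
    by (rule P_incl[OF P that])
qed

end

end

section \<open>Base change of an algebra\<close>

lemma map2_permute_list:
  assumes "\<sigma> permutes {..<length xs}" "length xs = length ys"
  shows "map2 f (permute_list \<sigma> xs) (permute_list \<sigma> ys) = permute_list \<sigma> (map2 f xs ys)"
proof (rule nth_equalityI)
  fix i assume "i < length (map2 f (permute_list \<sigma> xs) (permute_list \<sigma> ys))"
  then have "i < length xs" "\<sigma> i < length xs"
    using assms permutes_in_image[OF assms(1), of i] by simp_all
  then show "map2 f (permute_list \<sigma> xs) (permute_list \<sigma> ys) ! i = permute_list \<sigma> (map2 f xs ys) ! i"
    using assms by (simp add: permute_list_nth)
qed (use assms in simp)

lemma map2_concat:
  assumes "map length xss = map length yss"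
  shows "map2 f (concat xss) (concat yss) = concat (map2 (map2 f) xss yss)"
proof -
  have "length xss = length yss" using assms map_eq_imp_length_eq by blast
  then show ?thesis using assms by (induction xss yss rule: list_induct2) simp_all
qed

context
  fixes \<iota> :: "'k::field \<Rightarrow> 'l::field"
    and C :: "('c, 'o) operad_data"
    and V :: "('c, 'o, ('k, 'v) filtered_data, ('v list \<Rightarrow> 'k) set \<Rightarrow> 'v) operad_map_data"
  assumes \<iota>: "field_hom \<iota>" and V: "operad_map C FVect V"
begin

interpretation \<iota>: field_hom \<iota> by (rule \<iota>)
interpretation V: operad_map C FVect V by (rule V)

private abbreviation (input) "K \<equiv> scalar_ext \<iota>"
private abbreviation (input) "A \<equiv> on_color V"
private abbreviation (input) "VK \<equiv> base_change \<iota> \<circ>\<^sub>o V"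
private abbreviation (input) "bc \<equiv> on_op (base_change \<iota>)"

lemma color_filtered: "c \<in> colors C \<Longrightarrow> filtered_vs (A c)"
  using V.on_color_closed by simp

lemma color_vs: "c \<in> colors C \<Longrightarrow> vs (A c)"
  using color_filtered by (simp add: filtered_vs_def)

lemma color_filt: "c \<in> colors C \<Longrightarrow> subsp (filt (A c) p) (A c)"
  using color_filtered by (simp add: filtered_vs_def)

lemma colors_vs:
  assumes "cs \<in> lists (colors C)" "M \<in> set (map A cs)"
  shows "vs M"
  using assms color_vs by auto

lemma op_linear:
  assumes "cs \<in> lists (colors C)" "d \<in> colors C" "f \<in> ops C cs d"
  shows "on_op V cs d f \<in> lin (tensor (map A cs)) (A d)"
  using V.on_op_closed[OF assms] by (simp add: FVect_def linear_maps_iff)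

lemma base_change_on_color: "on_color VK c = K (A c)"
  by (simp add: operad_map_comp_def base_change_def)

lemma base_change_on_op: "on_op VK cs d f = bc (map A cs) (A d) (on_op V cs d f)"
  by (simp add: operad_map_comp_def)

lemma base_change_eqI:
  assumes cs: "cs \<in> lists (colors C)" and d: "d \<in> colors C" and f: "f \<in> lin (tensor (map A cs)) (A d)"
    and h: "h \<in> linear_maps (tensor (map K (map A cs))) (K (A d))"
    and eq: "\<And>xs. xs \<in> tuples (map A cs) \<Longrightarrow>
      h (pure_tensor (map K (map A cs)) (map2 (incl \<iota>) (map A cs) xs)) = incl \<iota> (A d) (f (pure_tensor (map A cs) xs))"
  shows "bc (map A cs) (A d) f = h"
proof (rule tensor_scalar_ext_eqI[OF \<iota> colors_vs[OF cs] color_vs[OF d] base_change_linear[OF \<iota> colors_vs[OF cs] color_vs[OF d] f] h])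
  fix xs assume xs: "xs \<in> tuples (map A cs)"
  show "bc (map A cs) (A d) f (pure_tensor (map K (map A cs)) (map2 (incl \<iota>) (map A cs) xs))
      = h (pure_tensor (map K (map A cs)) (map2 (incl \<iota>) (map A cs) xs))"
    unfolding eq[OF xs] by (rule base_change_incl[OF \<iota> colors_vs[OF cs] color_vs[OF d] f xs])
qed assumption+

text \<open>
  The steps of the extended filtrations are spanned by elements \<open>x \<otimes> 1\<close>, so it suffices to consider such
  arguments, where the claim is the one for \<open>V\<close>.
\<close>

lemma base_change_FVect:
  assumes cs: "cs \<in> lists (colors C)" and d: "d \<in> colors C" and f: "f \<in> ops C cs d"
  shows "bc (map A cs) (A d) (on_op V cs d f) \<in> ops FVect (map K (map A cs)) (K (A d))"
proof -
  let ?F = "bc (map A cs) (A d) (on_op V cs d f)" and ?As = "map A cs"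
  have cc: "\<And>i. i < length cs \<Longrightarrow> cs ! i \<in> colors C" using cs by auto
  have fm: "\<forall>M\<in>set ?As. filtered_module M" using cs color_filtered filtered_vs_module by auto
  have fmS: "\<forall>M\<in>set (map K ?As). filtered_module M"
    using cs color_filtered filtered_scalar_ext[OF \<iota>] filtered_vs_module by auto
  have fd: "filtered_module (A d)" by (rule filtered_vs_module[OF color_filtered[OF d]])
  have fSd: "filtered_module (K (A d))" by (rule filtered_vs_module[OF filtered_scalar_ext[OF \<iota> color_filtered[OF d]]])
  note f' = conjunct2[OF iffD1[OF FVect_ops_iff[OF fm fd] V.on_op_closed[OF cs d f]], rule_format]
  have F: "?F \<in> linear_maps (tensor (map K ?As)) (K (A d))"
    by (rule base_change_linear[OF \<iota> colors_vs[OF cs] color_vs[OF d] op_linear[OF cs d f]]) assumption+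
  have vSs: "\<And>M. M \<in> set (map K ?As) \<Longrightarrow> vs M" using fmS unfolding filtered_module_def by blast
  have m: "multilin (map K ?As) (K (A d)) (\<lambda>zs. ?F (pure_tensor (map K ?As) zs))"
    using F unfolding linear_maps_iff by (intro multilin_pure_tensor[OF vSs]) simp_all
  have "?F (pure_tensor (map K ?As) zs) \<in> filt (K (A d)) p"
    if len: "length is = length (map K ?As)" "length zs = length (map K ?As)" and p: "sum_list is \<le> p"
      and zs: "\<forall>i<length (map K ?As). zs ! i \<in> filt (map K ?As ! i) (is ! i)" for p "is" zs
  proof -
    let ?Ss = "map (\<lambda>i. incl \<iota> (?As ! i) ` filt (?As ! i) (is ! i)) [0..<length ?As]"
    have sub: "filt (?As ! i) p \<subseteq> carrier (?As ! i)" if "i < length cs" for i p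
      using subsp_subset[OF color_filt[OF cc[OF that]]] that by simp
    show ?thesis
    proof (rule multilin_span_subset[where Ss = ?Ss, OF m vSs])
      show "subsp (filt (K (A d)) p) (K (A d))" using fSd by (simp add: filtered_module_def)
      show "length ?Ss = length (map K ?As)" by simp
      show "?Ss ! i \<subseteq> carrier (map K ?As ! i)" if "i < length (map K ?As)" for i
        using that sub[of i] incl_closed[OF \<iota> color_vs[OF cc[of i]]] by auto
      show "zs \<in> listset (map2 vspan (map K ?As) ?Ss)"
        unfolding listset_iff
        using zs len filt_scalar_ext[OF \<iota> color_vs[OF cc] subsp_subset[OF color_filt[OF cc]]] by simp
      fix ys assume "ys \<in> listset ?Ss"
      then obtain xs where xs: "length xs = length ?As" "\<And>i. i < length ?As \<Longrightarrow> xs ! i \<in> filt (?As ! i) (is ! i)"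
        "ys = map2 (incl \<iota>) ?As xs" by (rule incl_listset[OF \<iota>]) blast
      have xt: "xs \<in> tuples ?As" using xs sub unfolding tuples_iff by force
      have "on_op V cs d f (pure_tensor ?As xs) \<in> filt (A d) p"
        by (rule f'[of "is"]) (use len xs p in simp_all)
      moreover have "filt (K (A d)) p = vspan (K (A d)) (incl \<iota> (A d) ` filt (A d) p)"
        by (rule filt_scalar_ext[OF \<iota> color_vs[OF d] subsp_subset[OF color_filt[OF d]]])
      moreover have "incl \<iota> (A d) ` filt (A d) p \<subseteq> carrier (K (A d))"
        using incl_closed[OF \<iota> color_vs[OF d]] subsp_subset[OF color_filt[OF d]] by blast
      ultimately have "incl \<iota> (A d) (on_op V cs d f (pure_tensor ?As xs)) \<in> filt (K (A d)) p"
        using span_base[OF scalar_ext_vs[OF \<iota> color_vs[OF d]]] by blast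
      also have "incl \<iota> (A d) (on_op V cs d f (pure_tensor ?As xs)) = ?F (pure_tensor (map K ?As) ys)"
        unfolding xs(3)
        by (rule base_change_incl[OF \<iota> colors_vs[OF cs] color_vs[OF d] op_linear[OF cs d f] xt, symmetric]) assumption+
      finally show "?F (pure_tensor (map K ?As) ys) \<in> filt (K (A d)) p" .
    qed assumption
  qed
  with F show ?thesis unfolding FVect_ops_iff[OF fmS fSd] by blast
qed

text \<open>
  Each axiom equates two operations on extended spaces.  At arguments \<open>x \<otimes> 1\<close> both have the value \<open>y \<otimes> 1\<close>,
  where \<open>y\<close> is the common value of the two sides of the same axiom for \<open>V\<close>.
\<close>

lemma base_change_operad_map: "operad_map C FVect (base_change \<iota> \<circ>\<^sub>o V)"
proof
  note col = base_change_on_color and op = base_change_on_op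
  have cols: "map (on_color VK) cs = map K (map A cs)" for cs
    by (simp add: col)
  show "on_color VK c \<in> colors FVect" if "c \<in> colors C" for c
    unfolding col using filtered_scalar_ext[OF \<iota> color_filtered[OF that]] by simp
  show "on_op VK cs d f
      \<in> ops FVect (map (on_color VK) cs) (on_color VK d)"
    if "cs \<in> lists (colors C)" "d \<in> colors C" "f \<in> ops C cs d" for cs d f
    unfolding col cols op by (rule base_change_FVect[OF that])
  show "on_op VK [c] c (op_id C c) = op_id FVect (on_color VK c)"
    if c: "c \<in> colors C" for c
  proof -
    note Ac = color_vs[OF c]
    note SAc = scalar_ext_vs[OF \<iota> Ac]
    have cs: "[c] \<in> lists (colors C)" using c by simp
    have "bc (map A [c]) (A c) (multi_id (A c)) = multi_id (K (A c))"
    proof (rule base_change_eqI[OF cs c])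
      show "multi_id (A c) \<in> lin (tensor (map A [c])) (A c)"
        using multi_id_linear[OF Ac] by (simp add: linear_maps_iff)
      show "multi_id (K (A c)) \<in> linear_maps (tensor (map K (map A [c]))) (K (A c))"
        using multi_id_linear[OF SAc] by simp
      fix xs assume xs: "xs \<in> tuples (map A [c])"
      have "length xs = 1" using xs by (simp add: tuples_iff)
      then obtain x where x1: "xs = [x]" by (cases xs) simp_all
      have x2: "x \<in> carrier (A c)" using tuples_nth[OF xs, of 0] by (simp add: x1)
      show "multi_id (K (A c)) (pure_tensor (map K (map A [c])) (map2 (incl \<iota>) (map A [c]) xs))
          = incl \<iota> (A c) (multi_id (A c) (pure_tensor (map A [c]) xs))"
        using multi_id_pure[OF Ac x2] multi_id_pure[OF SAc incl_closed[OF \<iota> Ac x2]] by (simp add: x1)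
    qed
    then show ?thesis using V.on_op_id[OF c] by (simp add: col op)
  qed
  show "on_op VK (permute_list \<sigma> cs) d (op_act C cs d \<sigma> f) =
      op_act FVect (map (on_color VK) cs) (on_color VK d) \<sigma>
        (on_op VK cs d f)"
    if cs: "cs \<in> lists (colors C)" and d: "d \<in> colors C" and f: "f \<in> ops C cs d"
      and \<sigma>: "\<sigma> permutes {..<length cs}" for cs d f \<sigma>
  proof -
    let ?As = "map A cs" and ?f = "on_op V cs d f"
    have \<sigma>A: "\<sigma> permutes {..<length ?As}" "\<sigma> permutes {..<length (map K ?As)}" using \<sigma> by simp_all
    have inv: "inv_into UNIV \<sigma> permutes {..<length cs}" by (rule permutes_inv[OF \<sigma>])
    have ps: "permute_list \<sigma> cs \<in> lists (colors C)" using cs \<sigma> by (simp add: in_lists_conv_set)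
    have pA: "map A (permute_list \<sigma> cs) = permute_list \<sigma> ?As" by (rule permute_list_map[OF \<sigma>, symmetric])
    have pS: "map K (permute_list \<sigma> ?As) = permute_list \<sigma> (map K ?As)" by (rule permute_list_map[OF \<sigma>A(1), symmetric])
    note f' = op_linear[OF cs d f] and vA = colors_vs[OF cs] and vd = color_vs[OF d]
    have vSA: "\<And>M. M \<in> set (map K ?As) \<Longrightarrow> vs M" using scalar_ext_vs[OF \<iota>] vA by auto
    have F: "bc ?As (A d) ?f \<in> lin (tensor (map K ?As)) (K (A d))"
      using base_change_linear[OF \<iota> colors_vs[OF cs] vd f'] by (simp add: linear_maps_iff)
    have "bc (map A (permute_list \<sigma> cs)) (A d) (multi_act ?As (A d) \<sigma> ?f)
        = multi_act (map K ?As) (K (A d)) \<sigma> (bc ?As (A d) ?f)"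
    proof (rule base_change_eqI[OF ps d]; (unfold pA pS)?)
      have "multi_act ?As (A d) \<sigma> ?f \<in> linear_maps (tensor (permute_list \<sigma> ?As)) (A d)"
        by (rule multi_act_linear[OF vA vd \<sigma>A(1) f'])
      then show "multi_act ?As (A d) \<sigma> ?f \<in> lin (tensor (permute_list \<sigma> ?As)) (A d)"
        by (simp add: linear_maps_iff)
      show "multi_act (map K ?As) (K (A d)) \<sigma> (bc ?As (A d) ?f)
          \<in> linear_maps (tensor (permute_list \<sigma> (map K ?As))) (K (A d))"
        by (rule multi_act_linear[OF vSA scalar_ext_vs[OF \<iota> vd] \<sigma>A(2) F])
      fix xs assume xs: "xs \<in> tuples (permute_list \<sigma> ?As)"
      let ?ys = "permute_list (inv_into UNIV \<sigma>) xs"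
      have len: "length xs = length cs" using xs by (simp add: tuples_iff)
      have perm_back: "permute_list (inv_into UNIV \<sigma>) (permute_list \<sigma> ?As) = ?As"
        using inv \<sigma> permutes_inv_o(1)[OF \<sigma>] by (subst permute_list_compose[symmetric]) simp_all
      have "?ys ! i \<in> carrier (?As ! i)" if i: "i < length ?As" for i
      proof -
        have j: "inv_into UNIV \<sigma> i < length cs" using permutes_in_image[OF inv, of i] i by simp
        have "xs ! inv_into UNIV \<sigma> i \<in> carrier (permute_list \<sigma> ?As ! inv_into UNIV \<sigma> i)"
          by (rule tuples_nth[OF xs]) (use j in simp)
        then show ?thesis
          using i j inv len \<sigma>A(1) by (simp add: permute_list_nth permutes_inverses[OF \<sigma>])
      qed
      then have ys: "?ys \<in> tuples ?As" using len by (simp add: tuples_iff)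
      have vpA: "\<And>M. M \<in> set (permute_list \<sigma> ?As) \<Longrightarrow> vs M" using vA \<sigma>A by simp
      have ixs: "map2 (incl \<iota>) (permute_list \<sigma> ?As) xs \<in> tuples (permute_list \<sigma> (map K ?As))"
        using incl_tuples[OF \<iota> vpA xs] unfolding pS by blast
      have "permute_list (inv_into UNIV \<sigma>) (map2 (incl \<iota>) (permute_list \<sigma> ?As) xs) = map2 (incl \<iota>) ?As ?ys"
        using map2_permute_list[of "inv_into UNIV \<sigma>" "permute_list \<sigma> ?As" xs "incl \<iota>"] inv len
        by (simp add: perm_back)
      then have "multi_act (map K ?As) (K (A d)) \<sigma> (bc ?As (A d) ?f)
            (pure_tensor (permute_list \<sigma> (map K ?As)) (map2 (incl \<iota>) (permute_list \<sigma> ?As) xs))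
          = bc ?As (A d) ?f (pure_tensor (map K ?As) (map2 (incl \<iota>) ?As ?ys))"
        using multi_act_pure[OF vSA scalar_ext_vs[OF \<iota> vd] \<sigma>A(2) F ixs] by simp
      also have "\<dots> = incl \<iota> (A d) (?f (pure_tensor ?As ?ys))"
        by (rule base_change_incl[OF \<iota> vA vd f' ys])
      also have "?f (pure_tensor ?As ?ys) = multi_act ?As (A d) \<sigma> ?f (pure_tensor (permute_list \<sigma> ?As) xs)"
        by (rule multi_act_pure[OF vA vd \<sigma>A(1) f' xs, symmetric])
      finally show "multi_act (map K ?As) (K (A d)) \<sigma> (bc ?As (A d) ?f)
            (pure_tensor (permute_list \<sigma> (map K ?As)) (map2 (incl \<iota>) (permute_list \<sigma> ?As) xs))
          = incl \<iota> (A d) (multi_act ?As (A d) \<sigma> ?f (pure_tensor (permute_list \<sigma> ?As) xs))" .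
    qed
    then show ?thesis unfolding col cols op V.on_op_act[OF cs d f \<sigma>] FVect_simps .
  qed
  show "on_op VK (concat css) d (op_comp C css cs d g fs) =
      op_comp FVect (map (map (on_color VK)) css) (map (on_color VK) cs)
        (on_color VK d) (on_op VK cs d g)
        (map (\<lambda>i. on_op VK (css ! i) (cs ! i) (fs ! i)) [0..<length cs])"
    if d: "d \<in> colors C" and g: "g \<in> ops C cs d" and fam: "op_family C css cs fs" for d g css cs fs
  proof -
    have css: "css \<in> lists (lists (colors C))" and cs: "cs \<in> lists (colors C)"
      and lens: "length css = length cs" "length fs = length cs"
      and fs: "\<And>i. i < length cs \<Longrightarrow> fs ! i \<in> ops C (css ! i) (cs ! i)"
      using fam by (simp_all add: op_family_def)
    have csi: "css ! i \<in> lists (colors C)" "cs ! i \<in> colors C" if "i < length cs" for i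
      using css cs that lens by (auto simp: in_lists_conv_set)
    have ccss: "concat css \<in> lists (colors C)" using css by (auto simp: in_lists_conv_set)
    let ?Ass = "map (map A) css" and ?Bs = "map A cs"
    let ?SAss = "map (map K) ?Ass" and ?SBs = "map K ?Bs"
    let ?g = "on_op V cs d g" and ?f = "\<lambda>i. on_op V (css ! i) (cs ! i) (fs ! i)"
    let ?fs = "map ?f [0..<length cs]"
    let ?G = "bc ?Bs (A d) ?g" and ?F = "\<lambda>i. bc (map A (css ! i)) (A (cs ! i)) (?f i)"
    let ?Fs = "map ?F [0..<length cs]"
    have cA: "concat ?Ass = map A (concat css)" by (simp add: map_concat)
    have cS: "concat ?SAss = map K (map A (concat css))" by (simp add: map_concat)
    have vAss: "vs M" if Ms: "Ms \<in> set ?Ass" and M: "M \<in> set Ms" for Ms M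
    proof -
      obtain bs where bs: "bs \<in> set css" "Ms = map A bs" using Ms by auto
      have "bs \<in> lists (colors C)" using css bs(1) by (auto simp only: in_lists_conv_set)
      then show ?thesis using M unfolding bs(2) by (rule colors_vs)
    qed
    have vSAss: "vs M" if Ms: "Ms \<in> set ?SAss" and M: "M \<in> set Ms" for Ms M
    proof -
      obtain Ns where Ns: "Ns \<in> set ?Ass" "Ms = map K Ns" using Ms unfolding set_map by blast
      obtain N where N: "N \<in> set Ns" "M = K N" using M unfolding Ns(2) set_map by blast
      show ?thesis unfolding N(2) by (rule scalar_ext_vs[OF \<iota> vAss[OF Ns(1) N(1)]])
    qed
    note vBs = colors_vs[OF cs] and vd = color_vs[OF d]
    have vSBs: "\<And>M. M \<in> set ?SBs \<Longrightarrow> vs M" using scalar_ext_vs[OF \<iota>] vBs by auto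
    note vSd = scalar_ext_vs[OF \<iota> vd]
    have lA: "length ?Ass = length ?Bs" and lS: "length ?SAss = length ?SBs" using lens by simp_all
    note g' = op_linear[OF cs d g]
    have fi: "?f i \<in> lin (tensor (map A (css ! i))) (A (cs ! i))" if "i < length cs" for i
      by (rule op_linear[OF csi[OF that] fs[OF that]])
    then have f': "?fs ! i \<in> lin (tensor (?Ass ! i)) (?Bs ! i)" if "i < length ?Bs" for i
      using that lens by simp
    have G: "?G \<in> lin (tensor ?SBs) (K (A d))"
      using base_change_linear[OF \<iota> colors_vs[OF cs] vd g'] by (simp add: linear_maps_iff)
    have Fi: "?F i \<in> lin (tensor (map K (map A (css ! i)))) (K (A (cs ! i)))" if "i < length cs" for i
      using base_change_linear[OF \<iota> colors_vs[OF csi(1)[OF that]] color_vs[OF csi(2)[OF that]] fi[OF that]]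
      by (simp add: linear_maps_iff)
    then have F': "?Fs ! i \<in> lin (tensor (?SAss ! i)) (?SBs ! i)" if "i < length ?SBs" for i
      using that lens by simp
    have "bc (map A (concat css)) (A d) (multi_comp ?Ass ?Bs (A d) ?g ?fs)
        = multi_comp ?SAss ?SBs (K (A d)) ?G ?Fs"
    proof (rule base_change_eqI[OF ccss d]; (unfold cA[symmetric] cS[symmetric])?)
      have "multi_comp ?Ass ?Bs (A d) ?g ?fs \<in> linear_maps (tensor (concat ?Ass)) (A d)"
        by (rule multi_comp_linear[OF vAss vBs vd lA g' f'])
      then show "multi_comp ?Ass ?Bs (A d) ?g ?fs \<in> lin (tensor (concat ?Ass)) (A d)"
        by (simp add: linear_maps_iff)
      show "multi_comp ?SAss ?SBs (K (A d)) ?G ?Fs \<in> linear_maps (tensor (map K (concat ?Ass))) (K (A d))"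
        unfolding cA cS[symmetric] by (rule multi_comp_linear[OF vSAss vSBs vSd lS G F'])
      fix xs assume "xs \<in> tuples (concat ?Ass)"
      then obtain xss where xs: "xs = concat xss" and lx: "map length xss = map length ?Ass"
        and xss: "\<And>i. i < length ?Ass \<Longrightarrow> xss ! i \<in> tuples (?Ass ! i)" by (rule tuples_concat) blast
      have lxs: "length xss = length ?Bs" using map_eq_imp_length_eq[OF lx] lens by simp
      have xss': "xss ! i \<in> tuples (?Ass ! i)" if "i < length ?Bs" for i
        using xss[of i] that lens by simp
      let ?iss = "map2 (map2 (incl \<iota>)) ?Ass xss"
      have ixs: "map2 (incl \<iota>) (concat ?Ass) xs = concat ?iss"
        unfolding xs by (rule map2_concat[OF lx[symmetric]])
      have liss: "length ?iss = length ?SBs" using lxs lens by simp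
      have tup: "xss ! i \<in> tuples (map A (css ! i))" if "i < length cs" for i
        using xss'[of i] that lens by simp
      have issi: "?iss ! i = map2 (incl \<iota>) (map A (css ! i)) (xss ! i)" if "i < length cs" for i
        using that lens lxs by simp
      have iss: "?iss ! i \<in> tuples (?SAss ! i)" if "i < length ?SBs" for i
        using incl_tuples[OF \<iota> colors_vs[OF csi(1)] tup, of i] that lens issi[of i] by simp
      have fx: "?f i (pure_tensor (map A (css ! i)) (xss ! i)) \<in> carrier (A (cs ! i))" if "i < length cs" for i
        by (rule lin_closed[OF fi[OF that] pure_tensor_closed[OF colors_vs[OF csi(1)[OF that]] tup[OF that]]])
      let ?ys = "map (\<lambda>i. ?f i (pure_tensor (map A (css ! i)) (xss ! i))) [0..<length cs]"
      have ys: "?ys \<in> tuples ?Bs" using fx by (simp add: tuples_iff)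
      have "multi_comp ?SAss ?SBs (K (A d)) ?G ?Fs (pure_tensor (concat ?SAss) (concat ?iss))
          = ?G (pure_tensor ?SBs (map (\<lambda>i. (?Fs ! i) (pure_tensor (?SAss ! i) (?iss ! i))) [0..<length ?SBs]))"
        by (rule multi_comp_pure[OF vSAss vSBs vSd lS G F' liss iss])
      also have "map (\<lambda>i. (?Fs ! i) (pure_tensor (?SAss ! i) (?iss ! i))) [0..<length ?SBs]
          = map2 (incl \<iota>) ?Bs ?ys"
      proof (rule nth_equalityI)
        fix i assume "i < length (map (\<lambda>i. (?Fs ! i) (pure_tensor (?SAss ! i) (?iss ! i))) [0..<length ?SBs])"
        then have i: "i < length cs" by simp
        have "?F i (pure_tensor (map K (map A (css ! i))) (map2 (incl \<iota>) (map A (css ! i)) (xss ! i)))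
            = incl \<iota> (A (cs ! i)) (?f i (pure_tensor (map A (css ! i)) (xss ! i)))"
          by (rule base_change_incl[OF \<iota> colors_vs[OF csi(1)[OF i]] color_vs[OF csi(2)[OF i]] fi[OF i] tup[OF i]])
        then show "map (\<lambda>i. (?Fs ! i) (pure_tensor (?SAss ! i) (?iss ! i))) [0..<length ?SBs] ! i
            = map2 (incl \<iota>) ?Bs ?ys ! i"
          using i lens lxs by simp
      qed simp
      also have "?G (pure_tensor ?SBs (map2 (incl \<iota>) ?Bs ?ys)) = incl \<iota> (A d) (?g (pure_tensor ?Bs ?ys))"
        by (rule base_change_incl[OF \<iota> colors_vs[OF cs] vd g' ys])
      also have "?ys = map (\<lambda>i. (?fs ! i) (pure_tensor (?Ass ! i) (xss ! i))) [0..<length ?Bs]"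
        using lens by (intro nth_equalityI) simp_all
      also have "?g (pure_tensor ?Bs \<dots>) = multi_comp ?Ass ?Bs (A d) ?g ?fs (pure_tensor (concat ?Ass) (concat xss))"
        by (rule multi_comp_pure[OF vAss vBs vd lA g' f' lxs xss', symmetric])
      finally show "multi_comp ?SAss ?SBs (K (A d)) ?G ?Fs
            (pure_tensor (map K (concat ?Ass)) (map2 (incl \<iota>) (concat ?Ass) xs))
          = incl \<iota> (A d) (multi_comp ?Ass ?Bs (A d) ?g ?fs (pure_tensor (concat ?Ass) xs))"
        unfolding ixs unfolding cA cS[symmetric] unfolding xs .
    qed
    moreover have colss: "map (map (on_color VK)) css = ?SAss" by (simp add: col)
    ultimately show ?thesis
      unfolding colss cols col[of d] op V.on_op_comp[OF d g fam] FVect_simps by blast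
  qed
qed


section \<open>Transfer of weight derivations\<close>

lemma base_change_on_colors: "map (on_color VK) cs = map K (map A cs)"
  by (simp add: base_change_on_color)

lemma operation_multilin:
  assumes "cs \<in> lists (colors C)" "d \<in> colors C" "f \<in> ops C cs d"
  shows "multilin (map A cs) (A d) (operation V cs d f)"
  unfolding operation_def by (rule multilin_pure_tensor[OF colors_vs[OF assms(1)] op_linear[OF assms]])

lemma base_change_operation_multilin:
  assumes cs: "cs \<in> lists (colors C)" and d: "d \<in> colors C" and f: "f \<in> ops C cs d"
  shows "multilin (map K (map A cs)) (K (A d)) (operation VK cs d f)"
  unfolding operation_def base_change_on_colors base_change_on_op
proof (rule multilin_pure_tensor)
  show "vs M" if "M \<in> set (map K (map A cs))" for M
    using that scalar_ext_vs[OF \<iota> colors_vs[OF cs]] unfolding set_map[of K] by blast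
  have "bc (map A cs) (A d) (on_op V cs d f) \<in> linear_maps (tensor (map K (map A cs))) (K (A d))"
    by (rule base_change_linear[OF \<iota> colors_vs[OF cs] color_vs[OF d] op_linear[OF cs d f]])
  then show "bc (map A cs) (A d) (on_op V cs d f) \<in> lin (tensor (map K (map A cs))) (K (A d))"
    by (simp add: linear_maps_iff)
qed

lemma base_change_operation_incl:
  assumes cs: "cs \<in> lists (colors C)" and d: "d \<in> colors C" and f: "f \<in> ops C cs d"
    and xs: "xs \<in> tuples (map A cs)"
  shows "operation VK cs d f (map2 (incl \<iota>) (map A cs) xs) = incl \<iota> (A d) (operation V cs d f xs)"
  unfolding operation_def base_change_on_colors base_change_on_op
  by (rule base_change_incl[OF \<iota> colors_vs[OF cs] color_vs[OF d] op_linear[OF cs d f] xs])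

lemma map2_incl_update:
  assumes "i < length As" "length xs = length As"
  shows "(map2 (incl \<iota>) As xs)[i := incl \<iota> (As ! i) x] = map2 (incl \<iota>) As (xs[i := x])"
  using assms by (intro nth_equalityI) (auto simp: nth_list_update)

lemma minus_of_int_hom: "\<iota> (- of_int p) = - of_int p"
proof -
  have "\<iota> (of_int p) = of_int p" by (cases p) (simp_all add: hom_distribs)
  then show ?thesis by (simp add: \<iota>.hom_uminus)
qed

text \<open>
  The derivation is \<open>D \<otimes> 1\<close>; its defining equations have to be checked only at elements \<open>x \<otimes> 1\<close>.
\<close>

lemma weight_derivation_extend:
  assumes D: "weight_derivation C V D"
  obtains E where "weight_derivation C VK E"
proof -
  have W: "weight_operator (A c) (filt (A c)) (D c)" if "c \<in> colors C" for c
    using D that unfolding weight_derivation_def by blast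
  have Dlin: "D c \<in> lin (A c) (A c)"
    and weight: "\<And>p x. x \<in> filt (A c) p \<Longrightarrow> D c x \<oplus>\<^bsub>A c\<^esub> (- of_int p) \<odot>\<^bsub>A c\<^esub> x \<in> filt (A c) (p - 1)"
    if "c \<in> colors C" for c
    using W[OF that] by (simp_all add: weight_operator_def)
  have semi: "semilin \<iota> (A c) (K (A c)) (\<lambda>x. incl \<iota> (A c) (D c x))" if c: "c \<in> colors C" for c
  proof (rule semilinI)
    note i = incl_semilin[OF \<iota> color_vs[OF c]] and d = Dlin[OF c]
    fix x y a assume x: "x \<in> carrier (A c)"
    show "incl \<iota> (A c) (D c x) \<in> carrier (K (A c))" by (rule semilin_closed[OF i lin_closed[OF d x]])
    show "incl \<iota> (A c) (D c (a \<odot>\<^bsub>A c\<^esub> x)) = \<iota> a \<odot>\<^bsub>K (A c)\<^esub> incl \<iota> (A c) (D c x)"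
      unfolding lin_smult[OF d x] by (rule semilin_smult[OF i lin_closed[OF d x]])
    assume y: "y \<in> carrier (A c)"
    show "incl \<iota> (A c) (D c (x \<oplus>\<^bsub>A c\<^esub> y)) = incl \<iota> (A c) (D c x) \<oplus>\<^bsub>K (A c)\<^esub> incl \<iota> (A c) (D c y)"
      unfolding lin_add[OF d x y] by (rule semilin_add[OF i lin_closed[OF d x] lin_closed[OF d y]])
  qed
  have "\<exists>h. h \<in> lin (K (A c)) (K (A c)) \<and> (\<forall>x\<in>carrier (A c). h (incl \<iota> (A c) x) = incl \<iota> (A c) (D c x))"
    if c: "c \<in> colors C" for c
    using semilin_extend[OF \<iota> color_vs[OF c] scalar_ext_vs[OF \<iota> color_vs[OF c]] semi[OF c]] by blast
  then obtain E where E: "\<And>c. c \<in> colors C \<Longrightarrow> E c \<in> lin (K (A c)) (K (A c))"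
    and E_incl: "\<And>c x. \<lbrakk>c \<in> colors C; x \<in> carrier (A c)\<rbrakk> \<Longrightarrow> E c (incl \<iota> (A c) x) = incl \<iota> (A c) (D c x)"
    by metis
  have "weight_derivation C VK E"
    unfolding weight_derivation_def
  proof (intro conjI ballI; (unfold base_change_on_color base_change_on_colors)?)
    fix c assume c: "c \<in> colors C"
    note vA = color_vs[OF c] and W = color_filt[OF c]
    note vS = scalar_ext_vs[OF \<iota> vA] and i = incl_semilin[OF \<iota> vA]
    have filt: "filt (K (A c)) p = vspan (K (A c)) (incl \<iota> (A c) ` filt (A c) p)" for p
      by (rule filt_scalar_ext[OF \<iota> vA subsp_subset[OF W]])
    have sub: "incl \<iota> (A c) ` filt (A c) p \<subseteq> carrier (K (A c))" for p
      using incl_closed[OF \<iota> vA] subsp_subset[OF W] by blast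
    show "weight_operator (K (A c)) (filt (K (A c))) (E c)"
      unfolding weight_operator_def
    proof (intro conjI allI ballI)
      show "E c \<in> lin (K (A c)) (K (A c))" by (rule E[OF c])
      fix p t assume t: "t \<in> filt (K (A c)) p"
      let ?T = "\<lambda>t. E c t \<oplus>\<^bsub>K (A c)\<^esub> (- of_int p) \<odot>\<^bsub>K (A c)\<^esub> t"
      have "?T ` vspan (K (A c)) (incl \<iota> (A c) ` filt (A c) p) \<subseteq> filt (K (A c)) (p - 1)"
      proof (rule span_image_subset[OF _ vS sub])
        show "?T \<in> lin (K (A c)) (K (A c))" by (rule lin_plus[OF E[OF c] lin_scalar[OF vS] vS])
        show "subsp (filt (K (A c)) (p - 1)) (K (A c))" unfolding filt by (rule subsp_span[OF vS sub])
        have "?T (incl \<iota> (A c) x) \<in> filt (K (A c)) (p - 1)" if x: "x \<in> filt (A c) p" for x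
        proof -
          have xc: "x \<in> carrier (A c)" using x subsp_subset[OF W] by blast
          note Dx = lin_closed[OF Dlin[OF c] xc]
          have "?T (incl \<iota> (A c) x) = incl \<iota> (A c) (D c x) \<oplus>\<^bsub>K (A c)\<^esub> \<iota> (- of_int p) \<odot>\<^bsub>K (A c)\<^esub> incl \<iota> (A c) x"
            unfolding E_incl[OF c xc] minus_of_int_hom ..
          also have "\<dots> = incl \<iota> (A c) (D c x \<oplus>\<^bsub>A c\<^esub> (- of_int p) \<odot>\<^bsub>A c\<^esub> x)"
            unfolding semilin_smult[OF i xc, symmetric]
            by (rule semilin_add[OF i Dx vs_smult[OF vA xc], symmetric])
          also have "\<dots> \<in> filt (K (A c)) (p - 1)"
            using weight[OF c x] span_base[OF vS sub, of "p - 1"] unfolding filt by blast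
          finally show ?thesis .
        qed
        then show "?T ` (incl \<iota> (A c) ` filt (A c) p) \<subseteq> filt (K (A c)) (p - 1)" by blast
      qed
      with t show "?T t \<in> filt (K (A c)) (p - 1)" unfolding filt by blast
    qed
  next
    fix cs d f zs
    assume cs: "cs \<in> lists (colors C)" and d: "d \<in> colors C" and f: "f \<in> ops C cs d"
      and zs: "zs \<in> tuples (map K (map A cs))"
    let ?As = "map A cs" and ?F = "operation VK cs d f" and ?f = "operation V cs d f"
    note F = base_change_operation_multilin[OF cs d f] and fm = operation_multilin[OF cs d f]
    note vS = scalar_ext_vs[OF \<iota> color_vs[OF d]]
    have cc: "\<And>i. i < length cs \<Longrightarrow> cs ! i \<in> colors C" using cs by auto
    have vSs: "vs M" if "M \<in> set (map K ?As)" for M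
      using that scalar_ext_vs[OF \<iota> colors_vs[OF cs]] unfolding set_map[of K] by blast
    show "E d (?F zs) = leibniz (K (A d)) ?F (\<lambda>i. E (cs ! i)) zs"
    proof (rule multilin_scalar_ext_eqI[OF \<iota> multilin_comp_lin[OF F E[OF d]] multilin_leibniz[OF F vSs vS] colors_vs[OF cs] vS _ zs])
      show "E (cs ! i) \<in> lin (map K ?As ! i) (map K ?As ! i)" if "i < length (map K ?As)" for i
        using E[OF cc] that by simp
      fix xs assume xs: "xs \<in> tuples ?As"
      let ?is = "map2 (incl \<iota>) ?As xs"
      have len: "length xs = length cs" using xs by (simp add: tuples_iff)
      have xi: "xs ! i \<in> carrier (A (cs ! i))" if "i < length cs" for i
        using tuples_nth[OF xs, of i] that by simp
      have up: "xs[i := D (cs ! i) (xs ! i)] \<in> tuples ?As" if "i < length cs" for i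
        by (rule tuples_update[OF xs]) (use that lin_closed[OF Dlin[OF cc[OF that]] xi[OF that]] in simp_all)
      have "E d (?F ?is) = incl \<iota> (A d) (D d (?f xs))"
        unfolding base_change_operation_incl[OF cs d f xs] by (rule E_incl[OF d multilin_closed[OF fm xs]])
      also have "D d (?f xs) = leibniz (A d) ?f (\<lambda>i. D (cs ! i)) xs"
        using D cs d f xs unfolding weight_derivation_def by blast
      also have "incl \<iota> (A d) \<dots> = finsum (K (A d)) (\<lambda>i. incl \<iota> (A d) (?f (xs[i := D (cs ! i) (xs ! i)]))) {..<length xs}"
        unfolding leibniz_def
      proof (rule additive_finsum[OF _ _ _ color_vs[OF d] vS finite_lessThan])
        note i = incl_semilin[OF \<iota> color_vs[OF d]]
        show "incl \<iota> (A d) x \<in> carrier (K (A d))" if "x \<in> carrier (A d)" for x by (rule semilin_closed[OF i that])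
        show "incl \<iota> (A d) (x \<oplus>\<^bsub>A d\<^esub> y) = incl \<iota> (A d) x \<oplus>\<^bsub>K (A d)\<^esub> incl \<iota> (A d) y"
          if "x \<in> carrier (A d)" "y \<in> carrier (A d)" for x y by (rule semilin_add[OF i that])
        show "incl \<iota> (A d) \<zero>\<^bsub>A d\<^esub> = \<zero>\<^bsub>K (A d)\<^esub>" by (rule incl_zero[OF \<iota> color_vs[OF d]])
        show "?f (xs[i := D (cs ! i) (xs ! i)]) \<in> carrier (A d)" if "i \<in> {..<length xs}" for i
          by (rule multilin_closed[OF fm up]) (use that len in simp)
      qed
      also have "\<dots> = leibniz (K (A d)) ?F (\<lambda>i. E (cs ! i)) ?is"
        unfolding leibniz_def
      proof (rule finsum_cong_vs[OF vS])
        show "{..<length xs} = {..<length ?is}" using len by simp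
        fix i assume "i \<in> {..<length ?is}"
        then have i: "i < length cs" using len by simp
        have "E (cs ! i) (?is ! i) = incl \<iota> (?As ! i) (D (cs ! i) (xs ! i))"
          using E_incl[OF cc[OF i] xi[OF i]] i len by simp
        then have "?is[i := E (cs ! i) (?is ! i)] = map2 (incl \<iota>) ?As (xs[i := D (cs ! i) (xs ! i)])"
          using map2_incl_update[of i ?As xs] i len by simp
        then show eq: "incl \<iota> (A d) (?f (xs[i := D (cs ! i) (xs ! i)])) = ?F (?is[i := E (cs ! i) (?is ! i)])"
          using base_change_operation_incl[OF cs d f up[OF i]] by simp
        show "?F (?is[i := E (cs ! i) (?is ! i)]) \<in> carrier (K (A d))"
          unfolding eq[symmetric] by (rule incl_closed[OF \<iota> color_vs[OF d] multilin_closed[OF fm up[OF i]]])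
      qed
      finally show "E d (?F ?is) = leibniz (K (A d)) ?F (\<lambda>i. E (cs ! i)) ?is" .
    qed assumption+
  qed
  then show ?thesis by (rule that)
qed

text \<open>
  A retraction \<open>r\<close> of \<open>\<iota>\<close> that is linear over the small field induces retractions \<open>R\<close> of the maps \<open>x \<mapsto> x \<otimes> 1\<close>,
  and \<open>D x = R (E (x \<otimes> 1))\<close> is the required derivation.  The weight condition holds since \<open>R\<close> respects the
  filtrations.  In the Leibniz rule only one argument at a time is not of the form \<open>x \<otimes> 1\<close>, and for such
  arguments \<open>R\<close> commutes with the operations.  In other words, \<open>r\<close> applied to a solution of affine linear
  equations with coefficients in the small field is again a solution.
\<close>

lemma weight_derivation_restrict:
  assumes E: "weight_derivation C VK E"
  obtains D where "weight_derivation C V D"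
proof -
  obtain r where r: "\<And>x y. r (x + y) = r x + r y" "\<And>a y. r (\<iota> a * y) = a * r y" "r 1 = (1::'k)"
    by (rule functional_retraction[OF \<iota>], rule that) assumption+
  let ?rs = "restrict_scalars \<iota>"
  note rs = restrict_scalars_simps[OF \<iota>]
  have W: "weight_operator (K (A c)) (filt (K (A c))) (E c)" if "c \<in> colors C" for c
    using E that unfolding weight_derivation_def base_change_on_color by blast
  have Elin: "E c \<in> lin (K (A c)) (K (A c))"
    and weight: "\<And>p t. t \<in> filt (K (A c)) p \<Longrightarrow> E c t \<oplus>\<^bsub>K (A c)\<^esub> (- of_int p) \<odot>\<^bsub>K (A c)\<^esub> t \<in> filt (K (A c)) (p - 1)"
    if "c \<in> colors C" for c
    using W[OF that] by (simp_all add: weight_operator_def)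
  have "\<exists>R. R \<in> lin (?rs (K (A c))) (A c) \<and>
      (\<forall>l. \<forall>x\<in>carrier (A c). R (l \<odot>\<^bsub>K (A c)\<^esub> incl \<iota> (A c) x) = r l \<odot>\<^bsub>A c\<^esub> x) \<and>
      (\<forall>x\<in>carrier (A c). R (incl \<iota> (A c) x) = x) \<and>
      (\<forall>p. \<forall>t\<in>filt (K (A c)) p. R t \<in> filt (A c) p)" if c: "c \<in> colors C" for c
    by (rule scalar_retraction[OF \<iota> color_vs[OF c], of r]) (use r color_filt[OF c] in blast)+
  then obtain R where R: "\<And>c. c \<in> colors C \<Longrightarrow> R c \<in> lin (?rs (K (A c))) (A c)"
    and R_smult: "\<And>c l x. \<lbrakk>c \<in> colors C; x \<in> carrier (A c)\<rbrakk> \<Longrightarrow> R c (l \<odot>\<^bsub>K (A c)\<^esub> incl \<iota> (A c) x) = r l \<odot>\<^bsub>A c\<^esub> x"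
    and R_incl: "\<And>c x. \<lbrakk>c \<in> colors C; x \<in> carrier (A c)\<rbrakk> \<Longrightarrow> R c (incl \<iota> (A c) x) = x"
    and R_filt: "\<And>c p t. \<lbrakk>c \<in> colors C; t \<in> filt (K (A c)) p\<rbrakk> \<Longrightarrow> R c t \<in> filt (A c) p"
    by metis
  have R_closed: "R c t \<in> carrier (A c)" if "c \<in> colors C" "t \<in> carrier (K (A c))" for c t
    using lin_closed[OF R[OF that(1)], of t] that(2) unfolding rs by blast
  have R_add: "R c (t \<oplus>\<^bsub>K (A c)\<^esub> u) = R c t \<oplus>\<^bsub>A c\<^esub> R c u"
    if "c \<in> colors C" "t \<in> carrier (K (A c))" "u \<in> carrier (K (A c))" for c t u
    using lin_add[OF R[OF that(1)], of t u] that(2,3) unfolding rs by blast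
  have R_zero: "R c \<zero>\<^bsub>K (A c)\<^esub> = \<zero>\<^bsub>A c\<^esub>" if "c \<in> colors C" for c
    using R_incl[OF that vs_zero[OF color_vs[OF that]]] unfolding incl_zero[OF \<iota> color_vs[OF that]] .
  define D where "D c x = R c (E c (incl \<iota> (A c) x))" for c x
  have D: "D c \<in> lin (A c) (A c)" if c: "c \<in> colors C" for c
  proof -
    note i = incl_semilin[OF \<iota> color_vs[OF c]]
    have "incl \<iota> (A c) \<in> lin (A c) (?rs (K (A c)))"
      by (rule linI; unfold rs) (rule semilin_closed[OF i] semilin_add[OF i] semilin_smult[OF i]; assumption)+
    from lin_comp[OF lin_comp[OF this restrict_scalars_lin[OF \<iota> Elin[OF c]]] R[OF c]]
    show ?thesis unfolding D_def .
  qed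
  have "weight_derivation C V D"
    unfolding weight_derivation_def
  proof (intro conjI ballI)
    fix c assume c: "c \<in> colors C"
    note vA = color_vs[OF c]
    note vS = scalar_ext_vs[OF \<iota> vA]
    show "weight_operator (A c) (filt (A c)) (D c)"
      unfolding weight_operator_def
    proof (intro conjI allI ballI)
      show "D c \<in> lin (A c) (A c)" by (rule D[OF c])
      fix p x assume x: "x \<in> filt (A c) p"
      note sub = subsp_subset[OF color_filt[OF c]]
      have xc: "x \<in> carrier (A c)" using x sub by blast
      have ix: "incl \<iota> (A c) x \<in> carrier (K (A c))" by (rule incl_closed[OF \<iota> vA xc])
      have "incl \<iota> (A c) ` filt (A c) p \<subseteq> carrier (K (A c))" using sub incl_closed[OF \<iota> vA] by blast
      from span_base[OF vS this] x have "incl \<iota> (A c) x \<in> filt (K (A c)) p"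
        unfolding filt_scalar_ext[OF \<iota> vA sub] by blast
      from R_filt[OF c weight[OF c this]]
      have "R c (E c (incl \<iota> (A c) x) \<oplus>\<^bsub>K (A c)\<^esub> (- of_int p) \<odot>\<^bsub>K (A c)\<^esub> incl \<iota> (A c) x) \<in> filt (A c) (p - 1)" .
      also have "R c (E c (incl \<iota> (A c) x) \<oplus>\<^bsub>K (A c)\<^esub> (- of_int p) \<odot>\<^bsub>K (A c)\<^esub> incl \<iota> (A c) x)
          = D c x \<oplus>\<^bsub>A c\<^esub> r (- of_int p) \<odot>\<^bsub>A c\<^esub> x"
        unfolding R_add[OF c lin_closed[OF Elin[OF c] ix] vs_smult[OF vS ix]] R_smult[OF c xc] D_def ..
      also have "r (- of_int p) = - of_int p"
        using r(2)[of "- of_int p" 1] r(3) unfolding minus_of_int_hom by simp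
      finally show "D c x \<oplus>\<^bsub>A c\<^esub> (- of_int p) \<odot>\<^bsub>A c\<^esub> x \<in> filt (A c) (p - 1)" .
    qed
  next
    fix cs d f xs
    assume cs: "cs \<in> lists (colors C)" and d: "d \<in> colors C" and f: "f \<in> ops C cs d"
      and xs: "xs \<in> tuples (map A cs)"
    let ?As = "map A cs" and ?F = "operation VK cs d f" and ?f = "operation V cs d f"
    let ?is = "map2 (incl \<iota>) ?As xs"
    note F = base_change_operation_multilin[OF cs d f] and fm = operation_multilin[OF cs d f]
    note vA = color_vs[OF d]
    note vS = scalar_ext_vs[OF \<iota> vA]
    have cc: "\<And>i. i < length cs \<Longrightarrow> cs ! i \<in> colors C" using cs by auto
    have len: "length xs = length cs" using xs by (simp add: tuples_iff)
    have xi: "xs ! i \<in> carrier (A (cs ! i))" if "i < length cs" for i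
      using tuples_nth[OF xs, of i] that by simp
    have "is": "?is \<in> tuples (map K ?As)" by (rule incl_tuples[OF \<iota> colors_vs[OF cs] xs])
    \<comment> \<open>both sides are linear in \<open>t\<close> over the small field, so \<open>t = x \<otimes> y\<close> suffices\<close>
    have slot: "R d (?F (?is[i := t])) = ?f (xs[i := R (cs ! i) t])"
      if i: "i < length cs" and t: "t \<in> carrier (K (A (cs ! i)))" for i t
    proof -
      note c = cc[OF i]
      note vc = color_vs[OF c]
      have iA: "i < length ?As" "i < length (map K ?As)" and nth: "?As ! i = A (cs ! i)" "map K ?As ! i = K (A (cs ! i))"
        using i by simp_all
      have Fi: "(\<lambda>t. ?F (?is[i := t])) \<in> lin (K (A (cs ! i))) (K (A d))"
        using multilin_slot[OF F "is" iA(2)] unfolding nth .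
      have fi: "(\<lambda>x. ?f (xs[i := x])) \<in> lin (A (cs ! i)) (A d)"
        using multilin_slot[OF fm xs iA(1)] unfolding nth .
      show ?thesis
      proof (rule tensor2_lin_eqI[OF \<iota> vc _ _ vA])
        show "(\<lambda>t. R d (?F (?is[i := t]))) \<in> lin (tensor2 (A (cs ! i)) (field_as_vs \<iota>)) (A d)"
          unfolding scalar_ext_lin_restrict[OF \<iota> vc]
          by (rule lin_comp[OF restrict_scalars_lin[OF \<iota> Fi] R[OF d]])
        show "(\<lambda>t. ?f (xs[i := R (cs ! i) t])) \<in> lin (tensor2 (A (cs ! i)) (field_as_vs \<iota>)) (A d)"
          unfolding scalar_ext_lin_restrict[OF \<iota> vc] by (rule lin_comp[OF R[OF c] fi])
        show "t \<in> carrier (tensor2 (A (cs ! i)) (field_as_vs \<iota>))"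
          using t unfolding scalar_ext_simps[OF \<iota> vc] .
        fix x y assume x: "x \<in> carrier (A (cs ! i))"
        have up: "xs[i := x] \<in> tuples ?As" by (rule tuples_update[OF xs iA(1)]) (use x nth in simp)
        have "?F (?is[i := y \<odot>\<^bsub>K (A (cs ! i))\<^esub> incl \<iota> (A (cs ! i)) x])
            = y \<odot>\<^bsub>K (A d)\<^esub> ?F (?is[i := incl \<iota> (A (cs ! i)) x])"
          by (rule lin_smult[OF Fi incl_closed[OF \<iota> vc x]])
        also have "?is[i := incl \<iota> (A (cs ! i)) x] = map2 (incl \<iota>) ?As (xs[i := x])"
          using map2_incl_update[of i ?As xs x] iA(1) len unfolding nth by simp
        also have "?F \<dots> = incl \<iota> (A d) (?f (xs[i := x]))" by (rule base_change_operation_incl[OF cs d f up])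
        finally have "R d (?F (?is[i := y \<odot>\<^bsub>K (A (cs ! i))\<^esub> incl \<iota> (A (cs ! i)) x]))
            = r y \<odot>\<^bsub>A d\<^esub> ?f (xs[i := x])"
          using R_smult[OF d multilin_closed[OF fm up]] by simp
        also have "\<dots> = ?f (xs[i := R (cs ! i) (y \<odot>\<^bsub>K (A (cs ! i))\<^esub> incl \<iota> (A (cs ! i)) x)])"
          unfolding R_smult[OF c x] by (rule lin_smult[OF fi x, symmetric])
        finally show "R d (?F (?is[i := pure2 (A (cs ! i)) (field_as_vs \<iota>) x y]))
            = ?f (xs[i := R (cs ! i) (pure2 (A (cs ! i)) (field_as_vs \<iota>) x y)])"
          unfolding pure2_eq_smult_incl[OF \<iota> vc x] .
      qed
    qed
    have Ei: "E (cs ! i) (?is ! i) \<in> carrier (K (A (cs ! i)))" "?is ! i = incl \<iota> (A (cs ! i)) (xs ! i)"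
      if i: "i < length cs" for i
    proof -
      show "?is ! i = incl \<iota> (A (cs ! i)) (xs ! i)" using i len by simp
      then show "E (cs ! i) (?is ! i) \<in> carrier (K (A (cs ! i)))"
        using lin_closed[OF Elin[OF cc[OF i]] incl_closed[OF \<iota> color_vs[OF cc[OF i]] xi[OF i]]] by simp
    qed
    have "D d (?f xs) = R d (E d (?F ?is))"
      unfolding D_def base_change_operation_incl[OF cs d f xs] ..
    also have "E d (?F ?is) = leibniz (K (A d)) ?F (\<lambda>i. E (cs ! i)) ?is"
      using E cs d f "is" unfolding weight_derivation_def base_change_on_color base_change_on_colors by blast
    also have "R d \<dots> = finsum (A d) (\<lambda>i. R d (?F (?is[i := E (cs ! i) (?is ! i)]))) {..<length ?is}"
      unfolding leibniz_def
    proof (rule additive_finsum[OF R_closed[OF d] R_add[OF d] R_zero[OF d] vS vA finite_lessThan])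
      fix i assume "i \<in> {..<length ?is}"
      then have i: "i < length cs" using len by simp
      have "?is[i := E (cs ! i) (?is ! i)] \<in> tuples (map K ?As)"
        by (rule tuples_update[OF "is"]) (use i Ei(1)[OF i] in simp_all)
      then show "?F (?is[i := E (cs ! i) (?is ! i)]) \<in> carrier (K (A d))" by (rule multilin_closed[OF F])
    qed assumption+
    also have "\<dots> = leibniz (A d) ?f (\<lambda>i. D (cs ! i)) xs"
      unfolding leibniz_def
    proof (rule finsum_cong_vs[OF vA])
      show "{..<length ?is} = {..<length xs}" using len by simp
      fix i assume "i \<in> {..<length xs}"
      then have i: "i < length cs" using len by simp
      show "R d (?F (?is[i := E (cs ! i) (?is ! i)])) = ?f (xs[i := D (cs ! i) (xs ! i)])"
        unfolding slot[OF i Ei(1)[OF i]] unfolding Ei(2)[OF i] D_def ..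
      have "xs[i := D (cs ! i) (xs ! i)] \<in> tuples ?As"
        by (rule tuples_update[OF xs]) (use i lin_closed[OF D[OF cc[OF i]] xi[OF i]] in simp_all)
      then show "?f (xs[i := D (cs ! i) (xs ! i)]) \<in> carrier (A d)" by (rule multilin_closed[OF fm])
    qed
    finally show "D d (?f xs) = leibniz (A d) ?f (\<lambda>i. D (cs ! i)) xs" .
  qed
  then show ?thesis by (rule that)
qed

end

section \<open>Descent of splittings\<close>

theorem theorem4p3:
  fixes \<iota> :: "'k::field_char_0 \<Rightarrow> 'l::field"
    and C :: "('c, 'o) operad_data"
    and V :: "('c, 'o, ('k, 'v) filtered_data, ('v list \<Rightarrow> 'k) set \<Rightarrow> 'v) operad_map_data"
  assumes "field_hom \<iota>"
    and "colored_operad C"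
    and "operad_map C FVect V"
    and "\<forall>c\<in>colors C. vectorspace.fin_dim class_ring (on_color V c)"
  shows "lax_splitting C V \<longleftrightarrow> lax_splitting C (base_change \<iota> \<circ>\<^sub>o V)"
proof
  note \<iota> = assms(1) and V = assms(3)
  note VK = base_change_operad_map[OF \<iota> V]
  interpret \<iota>: field_hom \<iota> by (rule \<iota>)
  have char_l: "n = 0" if "of_int n = (0::'l)" for n
  proof -
    have "\<iota> (of_int n) = 0" using minus_of_int_hom[OF \<iota> V, of "- n"] that by simp
    then show "n = 0" by simp
  qed
  show "lax_splitting C (base_change \<iota> \<circ>\<^sub>o V)" if V_split: "lax_splitting C V"
  proof -
    obtain D where "weight_derivation C V D" by (rule splitting_imp_derivation[OF V V_split])
    then obtain E where "weight_derivation C (base_change \<iota> \<circ>\<^sub>o V) E"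
      by (rule weight_derivation_extend[OF \<iota> V])
    then show ?thesis using char_l by (rule derivation_imp_splitting[OF VK])
  qed
  show "lax_splitting C V" if VK_split: "lax_splitting C (base_change \<iota> \<circ>\<^sub>o V)"
  proof -
    obtain E where "weight_derivation C (base_change \<iota> \<circ>\<^sub>o V) E"
      by (rule splitting_imp_derivation[OF VK VK_split])
    then obtain D where "weight_derivation C V D" by (rule weight_derivation_restrict[OF \<iota> V])
    then show ?thesis by (rule derivation_imp_splitting[OF V]) simp
  qed
qed

end
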